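(* For every $\rho>1$ and $K>0$ there is a constant $C_\rho>0$, depending only on $\rho$ and $K$, such that the following holds. Let $n,k\ge 1$ be integers, let $\boldsymbol\Sigma$ be a nonzero $n\times n$ symmetric positive semi-definite matrix, and let $\mathbf Z\in\mathbb R^{k\times n}$ be a random matrix with i.i.d. rows that have zero mean and identity covariance and satisfy the Hanson-Wright inequality with constant $K$. Let $\mathbf X=\mathbf Z\boldsymbol\Sigma^{1/2}$ and $\mathbf P_\perp=\mathbf I-\mathbf X^\dagger\mathbf X$. Let $r=\mathrm{tr}(\boldsymbol\Sigma)/\|\boldsymbol\Sigma\|$ and suppose $r/k=\rho$. Define $\bar{\mathbf P}_\perp=(\gamma\boldsymbol\Sigma+\mathbf I)^{-1}$, where $\gamma>0$ is such that $\mathrm{tr}\,\bar{\mathbf P}_\perp=n-k$. If $r\ge C_\rho$, then $$\Big(1-\frac{C_\rho}{\sqrt r}\Big)\bar{\mathbf P}_\perp\preceq\mathbb E[\mathbf P_\perp]\preceq\Big(1+\frac{C_\rho}{\sqrt r}\Big)\bar{\mathbf P}_\perp .$$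
   Context: $\|\cdot\|$ is the spectral norm, $\|\cdot\|_F$ the Frobenius norm, $(\cdot)^\dagger$ the Moore-Penrose pseudoinverse, and $\preceq$ the positive semi-definite (Loewner) ordering. A random vector $\mathbf x\in\mathbb R^n$ satisfies the Hanson-Wright inequality with constant $K$ if for every nonzero $n\times n$ real matrix $\mathbf B$ and every $t\ge 0$, $$\Pr\{|\mathbf x^\top\mathbf B\mathbf x-\mathrm{tr}(\mathbf B)|\ge t\}\le 2\exp\Big(-\min\Big\{\frac{t^2}{K^4\|\mathbf B\|_F^2},\frac{t}{K^2\|\mathbf B\|}\Big\}\Big).$$ *)

theory Defs
  imports
    "HOL-Probability.Probability"
    "Jordan_Normal_Form.Gauss_Jordan_Elimination"
begin

hide_const (open) Finite_Cartesian_Product.vec Finite_Cartesian_Product.mat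
  Finite_Cartesian_Product.row Finite_Cartesian_Product.transpose
hide_type (open) Finite_Cartesian_Product.vec
no_notation vec_nth (infixl "$" 90)
no_notation inner (infix "\<bullet>" 70)

definition mat_trace :: "real mat \<Rightarrow> real" where
  "mat_trace A = (\<Sum>i<dim_row A. A $$ (i, i))"

definition spectral_norm :: "real mat \<Rightarrow> real" where
  "spectral_norm A =
     (SUP x \<in> {x \<in> carrier_vec (dim_col A). x \<bullet> x \<le> 1}. sqrt ((A *\<^sub>v x) \<bullet> (A *\<^sub>v x)))"

definition frobenius_norm :: "real mat \<Rightarrow> real" where
  "frobenius_norm A = sqrt (\<Sum>i<dim_row A. \<Sum>j<dim_col A. (A $$ (i, j))\<^sup>2)"

definition psd_mat :: "nat \<Rightarrow> real mat \<Rightarrow> bool" where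
  "psd_mat n A \<longleftrightarrow> A \<in> carrier_mat n n \<and> transpose_mat A = A \<and>
     (\<forall>x \<in> carrier_vec n. 0 \<le> x \<bullet> (A *\<^sub>v x))"

(* Not the order on matrices already declared in Jordan_Normal_Form.Matrix, which is entrywise. *)
definition loewner_le :: "nat \<Rightarrow> real mat \<Rightarrow> real mat \<Rightarrow> bool" where
  "loewner_le n A B \<longleftrightarrow> A \<in> carrier_mat n n \<and> B \<in> carrier_mat n n \<and> psd_mat n (B - A)"

definition psd_sqrt :: "real mat \<Rightarrow> real mat" where
  "psd_sqrt A = (THE B. psd_mat (dim_row A) B \<and> B * B = A)"

(* The four Penrose equations determine the pseudoinverse uniquely. *)
definition is_pseudoinverse :: "real mat \<Rightarrow> real mat \<Rightarrow> bool" where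
  "is_pseudoinverse A B \<longleftrightarrow> B \<in> carrier_mat (dim_col A) (dim_row A) \<and>
     A * B * A = A \<and> B * A * B = B \<and>
     transpose_mat (A * B) = A * B \<and> transpose_mat (B * A) = B * A"

definition pseudoinverse :: "real mat \<Rightarrow> real mat" where
  "pseudoinverse A = (THE B. is_pseudoinverse A B)"

definition hanson_wright :: "'a measure \<Rightarrow> nat \<Rightarrow> ('a \<Rightarrow> real vec) \<Rightarrow> real \<Rightarrow> bool" where
  "hanson_wright M n x K \<longleftrightarrow>
     (\<forall>B \<in> carrier_mat n n. B \<noteq> 0\<^sub>m n n \<longrightarrow> (\<forall>t\<ge>0.
        measure M {\<omega> \<in> space M. \<bar>x \<omega> \<bullet> (B *\<^sub>v x \<omega>) - mat_trace B\<bar> \<ge> t}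
        \<le> 2 * exp (- min (t\<^sup>2 / (K ^ 4 * (frobenius_norm B)\<^sup>2)) (t / (K\<^sup>2 * spectral_norm B)))))"

(* The integrability clauses matter because a Bochner integral is 0 when it does not exist. *)
definition zero_mean_identity_cov :: "'a measure \<Rightarrow> nat \<Rightarrow> ('a \<Rightarrow> real vec) \<Rightarrow> bool" where
  "zero_mean_identity_cov M n x \<longleftrightarrow>
     (\<forall>i<n. integrable M (\<lambda>\<omega>. x \<omega> $ i) \<and> integral\<^sup>L M (\<lambda>\<omega>. x \<omega> $ i) = 0) \<and>
     (\<forall>i<n. \<forall>j<n. integrable M (\<lambda>\<omega>. x \<omega> $ i * x \<omega> $ j) \<and>
        integral\<^sup>L M (\<lambda>\<omega>. x \<omega> $ i * x \<omega> $ j) = (if i = j then 1 else 0))"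

(* Rows are read as functions in the product space over {..<n}, since the type of vectors of
   variable dimension carries no Borel sigma-algebra.  Measurability of the rows is part of
   indep_vars. *)
definition row_fun :: "nat \<Rightarrow> ('a \<Rightarrow> real mat) \<Rightarrow> nat \<Rightarrow> 'a \<Rightarrow> nat \<Rightarrow> real" where
  "row_fun n Z i \<omega> = (\<lambda>j\<in>{..<n}. Z \<omega> $$ (i, j))"

definition iid_rows :: "'a measure \<Rightarrow> nat \<Rightarrow> nat \<Rightarrow> ('a \<Rightarrow> real mat) \<Rightarrow> bool" where
  "iid_rows M k n Z \<longleftrightarrow>
     (\<forall>\<omega> \<in> space M. Z \<omega> \<in> carrier_mat k n) \<and>
     prob_space.indep_vars M (\<lambda>_. PiM {..<n} (\<lambda>_. borel)) (row_fun n Z) {..<k} \<and>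
     (\<forall>i<k. \<forall>i'<k. distr M (PiM {..<n} (\<lambda>_. borel)) (row_fun n Z i) =
                    distr M (PiM {..<n} (\<lambda>_. borel)) (row_fun n Z i'))"

definition expectation_mat :: "'a measure \<Rightarrow> nat \<Rightarrow> nat \<Rightarrow> ('a \<Rightarrow> real mat) \<Rightarrow> real mat" where
  "expectation_mat M m n P = mat m n (\<lambda>(i, j). integral\<^sup>L M (\<lambda>\<omega>. P \<omega> $$ (i, j)))"

definition proj_perp :: "nat \<Rightarrow> real mat \<Rightarrow> real mat" where
  "proj_perp n X = 1\<^sub>m n - pseudoinverse X * X"

(* For S positive semi-definite and g > 0 the matrix g S + I is invertible, so the
   value of mat_inverse is not None in the use below. *)
definition proj_perp_equiv :: "nat \<Rightarrow> real mat \<Rightarrow> real \<Rightarrow> real mat" where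
  "proj_perp_equiv n S g = the (mat_inverse (g \<cdot>\<^sub>m S + 1\<^sub>m n))"

definition expected_projection_bound :: "real \<Rightarrow> real \<Rightarrow> real \<Rightarrow> 'a measure \<Rightarrow> bool" where
  "expected_projection_bound \<rho> K C M \<longleftrightarrow>
     (\<forall>n k S Z g.
        n \<ge> 1 \<longrightarrow> k \<ge> 1 \<longrightarrow>
        psd_mat n S \<longrightarrow> S \<noteq> 0\<^sub>m n n \<longrightarrow>
        iid_rows M k n Z \<longrightarrow>
        (\<forall>i<k. zero_mean_identity_cov M n (\<lambda>\<omega>. row (Z \<omega>) i) \<and>
               hanson_wright M n (\<lambda>\<omega>. row (Z \<omega>) i) K) \<longrightarrow>
        g > 0 \<longrightarrow> mat_trace (proj_perp_equiv n S g) = real n - real k \<longrightarrow>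
        (let r = mat_trace S / spectral_norm S;
             EP = expectation_mat M n n (\<lambda>\<omega>. proj_perp n (Z \<omega> * psd_sqrt S));
             P = proj_perp_equiv n S g
         in r / real k = \<rho> \<longrightarrow> r \<ge> C \<longrightarrow>
            loewner_le n ((1 - C / sqrt r) \<cdot>\<^sub>m P) EP \<and>
            loewner_le n EP ((1 + C / sqrt r) \<cdot>\<^sub>m P)))"

(* HOL cannot place an existential quantifier over C outside a quantifier over sample space
   types.  C is therefore chosen for probability spaces carried by the type of matrices itself,
   on which every law of a random matrix is realised (by the identity).  The second condition of
   the theorem that uses this predicate moves any such C to an arbitrary sample space type. *)
definition uniform_projection_constant :: "real \<Rightarrow> real \<Rightarrow> real \<Rightarrow> bool" where
  "uniform_projection_constant \<rho> K C \<longleftrightarrow>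
     (\<forall>M :: real mat measure. prob_space M \<longrightarrow> expected_projection_bound \<rho> K C M)"

end

theory Submission
  imports Defs
    "Jordan_Normal_Form.Char_Poly"
    "HOL-Computational_Algebra.Fundamental_Theorem_Algebra"
    "HOL-Real_Asymp.Real_Asymp"
begin

text \<open>
  After scaling \<open>\<Sigma>\<close> to norm at most 1, let \<open>P = l (l I + X\<^sup>T X)\<^sup>-\<^sup>1\<close> with \<open>l = 1 / k\<close> be the ridge version of the
  projection, and let \<open>Q\<^sub>i\<close> be the same matrix without the row \<open>x\<^sub>i\<close>. Then
  \<open>I - P = (\<Sum>i. x\<^sub>i x\<^sub>i\<^sup>T Q\<^sub>i / q\<^sub>i)\<close> with \<open>q\<^sub>i = l + x\<^sub>i\<^sup>T Q\<^sub>i x\<^sub>i\<close>. Given \<open>Q\<^sub>i\<close>, the Hanson--Wright inequality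
  concentrates \<open>q\<^sub>i\<close> around \<open>l + tr (\<Sigma> Q\<^sub>i)\<close>, which differs by at most 1 from \<open>l + tr (\<Sigma> P)\<close>; the latter always lies
  between \<open>(\<rho> - 1) k\<close> and \<open>\<rho> k + 1\<close> and, by the Efron--Stein inequality, has variance at most \<open>k\<close>. Replacing \<open>q\<^sub>i\<close> by
  \<open>\<tau> = l + E tr (\<Sigma> P)\<close> and \<open>Q\<^sub>i\<close> by \<open>P\<close> gives \<open>I - E P = (k / \<tau>) \<Sigma> E P + O(1 / \<surd>k)\<close> in operator norm, that is,
  \<open>E P = (I + (k / \<tau>) \<Sigma>)\<^sup>-\<^sup>1 + O(1 / \<surd>k)\<close>. Taking traces against \<open>\<Sigma>\<close> shows that \<open>k / \<tau>\<close> nearly solves the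
  equation that defines \<open>\<gamma>\<close>, so \<open>k / \<tau> = \<gamma> + O(1 / \<surd>k)\<close>. Because \<open>\<rho> > 1\<close> bounds \<open>\<gamma>\<close>, the limit is bounded below by
  a multiple of the identity, and the additive error becomes multiplicative. Finally \<open>P\<close> dominates the
  projection, and the trace of the difference is at most \<open>l (\<Sum>i. 1 / q\<^sub>i)\<close>.
\<close>

subsection \<open>Diagonalization of real symmetric matrices\<close>

text \<open>The projection itself resists a leave-one-out argument: rows may be linearly dependent
  with positive probability, and Hanson-Wright gives no sure lower bound for
  \<open>x \<bullet> (Q *\<^sub>v x)\<close>. The ridge parameter supplies 1 / q <= k always, and
  the event q < t / 2, where nothing better is known, must be rare enough to pay for the powers of
  k. This fixes the exponent 12: the p-th moment of q - t is O(k^(p/2)), so the event has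
  probability O(k^(-p/2)); the splitting used there costs k^4, and each of the k rows may contribute
  only O(k^(-3/2)). With this splitting 12 is the least even p that suffices. The deterministic
  input is that one row changes tr (\<Sigma> P) by at most 1, whatever its length. Starting from tr
  \<Sigma> = \<rho> k, this gives the lower bound (\<rho> - 1) k, the bounded differences, and the
  price of exchanging Q_i and P in a trace. The dimension n never enters a constant, since rows are
  met only through linear forms in vectors of norm at most 1 and through quadratic forms whose
  Frobenius norm is at most sqrt (\<rho> k).\<close>

lemma symmetric_scalar_prod:
  fixes A :: "real mat"
  assumes "A \<in> carrier_mat n n" "A\<^sup>T = A" "u \<in> carrier_vec n" "v \<in> carrier_vec n"
  shows "u \<bullet> (A *\<^sub>v v) = v \<bullet> (A *\<^sub>v u)"
proof -
  have "u \<bullet> (A *\<^sub>v v) = (A\<^sup>T *\<^sub>v u) \<bullet> v"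
    using assms by (metis transpose_vec_mult_scalar)
  also have "\<dots> = v \<bullet> (A *\<^sub>v u)"
    using assms by (simp add: comm_scalar_prod[of _ n])
  finally show ?thesis .
qed

lemma mat_mult_unit_vec:
  fixes A :: "real mat"
  assumes "A \<in> carrier_mat m n" "j < n"
  shows "A *\<^sub>v unit_vec n j = col A j"
  using assms by (intro eq_vecI) auto

lemma scalar_prod_self_nonneg: "0 \<le> v \<bullet> (v :: real vec)"
  unfolding scalar_prod_def by (intro sum_nonneg) auto

lemma scalar_prod_self_eq_0:
  assumes "v \<in> carrier_vec n"
  shows "v \<bullet> (v :: real vec) = 0 \<longleftrightarrow> v = 0\<^sub>v n"
proof
  assume "v \<bullet> v = 0"
  then have "\<forall>i\<in>{0..<n}. v $ i * v $ i = 0"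
    using assms unfolding scalar_prod_def by (subst (asm) sum_nonneg_eq_0_iff) auto
  then show "v = 0\<^sub>v n"
    using assms by (intro eq_vecI) auto
qed (use assms in auto)

text \<open>The fundamental theorem of algebra gives a complex eigenvector a + ib. Symmetry, applied
  as b.(Aa) = a.(Ab), forces Im \<mu> (|a|^2 + |b|^2) = 0, so the eigenvalue is real and whichever
  of a, b is nonzero is a real eigenvector.\<close>

lemma real_symmetric_eigenvector:
  fixes A :: "real mat"
  assumes A: "A \<in> carrier_mat n n" and sym: "A\<^sup>T = A" and n: "n > 0"
  shows "\<exists>\<mu> w. w \<in> carrier_vec n \<and> w \<bullet> w = 1 \<and> A *\<^sub>v w = \<mu> \<cdot>\<^sub>v w"
proof -
  define Ac where "Ac = map_mat complex_of_real A"
  have Ac: "Ac \<in> carrier_mat n n"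
    using A by (auto simp: Ac_def)
  have "degree (char_poly Ac) > 0"
    using degree_monic_char_poly[OF Ac] n by simp
  then have "\<not> constant (poly (char_poly Ac))"
    by (simp add: constant_degree)
  then obtain \<mu> where "poly (char_poly Ac) \<mu> = 0"
    using fundamental_theorem_of_algebra by blast
  then have "eigenvalue Ac \<mu>"
    using eigenvalue_root_char_poly[OF Ac] by simp
  then obtain v where v: "v \<in> carrier_vec n" "v \<noteq> 0\<^sub>v n" "Ac *\<^sub>v v = \<mu> \<cdot>\<^sub>v v"
    using Ac by (auto simp: eigenvalue_def eigenvector_def)
  define a where "a = map_vec Re v"
  define b where "b = map_vec Im v"
  have ab: "a \<in> carrier_vec n" "b \<in> carrier_vec n"
    using v by (auto simp: a_def b_def)
  have entry: "(\<Sum>j=0..<n. complex_of_real (A $$ (i, j)) * v $ j) = \<mu> * v $ i" if "i < n" for i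
  proof -
    have "(Ac *\<^sub>v v) $ i = (\<Sum>j=0..<n. complex_of_real (A $$ (i, j)) * v $ j)"
      using that A v(1) by (auto simp: Ac_def scalar_prod_def)
    then show ?thesis
      using v that by (metis carrier_vecD index_smult_vec(1))
  qed
  have Aa: "A *\<^sub>v a = Re \<mu> \<cdot>\<^sub>v a - Im \<mu> \<cdot>\<^sub>v b"
  proof (rule eq_vecI)
    fix i assume "i < dim_vec (Re \<mu> \<cdot>\<^sub>v a - Im \<mu> \<cdot>\<^sub>v b)"
    then have i: "i < n" using ab by auto
    have "(A *\<^sub>v a) $ i = Re (\<Sum>j=0..<n. complex_of_real (A $$ (i, j)) * v $ j)"
      using i A v by (auto simp: scalar_prod_def a_def)
    then show "(A *\<^sub>v a) $ i = (Re \<mu> \<cdot>\<^sub>v a - Im \<mu> \<cdot>\<^sub>v b) $ i"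
      using i v entry[OF i] by (simp add: a_def b_def)
  qed (use A ab in auto)
  have Ab: "A *\<^sub>v b = Im \<mu> \<cdot>\<^sub>v a + Re \<mu> \<cdot>\<^sub>v b"
  proof (rule eq_vecI)
    fix i assume "i < dim_vec (Im \<mu> \<cdot>\<^sub>v a + Re \<mu> \<cdot>\<^sub>v b)"
    then have i: "i < n" using ab by auto
    have "(A *\<^sub>v b) $ i = Im (\<Sum>j=0..<n. complex_of_real (A $$ (i, j)) * v $ j)"
      using i A v by (auto simp: scalar_prod_def b_def)
    then show "(A *\<^sub>v b) $ i = (Im \<mu> \<cdot>\<^sub>v a + Re \<mu> \<cdot>\<^sub>v b) $ i"
      using i v entry[OF i] by (simp add: a_def b_def)
  qed (use A ab in auto)
  have sum0: "a \<bullet> a + b \<bullet> b \<noteq> 0"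
  proof
    assume "a \<bullet> a + b \<bullet> b = 0"
    then have "a \<bullet> a = 0" "b \<bullet> b = 0"
      using scalar_prod_self_nonneg[of a] scalar_prod_self_nonneg[of b] by linarith+
    then have "a = 0\<^sub>v n" "b = 0\<^sub>v n"
      using scalar_prod_self_eq_0 ab by auto
    then have "Re (v $ i) = 0 \<and> Im (v $ i) = 0" if "i < n" for i
      using that v(1) unfolding a_def b_def
      by (metis carrier_vecD index_map_vec(1) index_zero_vec(1))
    then have "v = 0\<^sub>v n"
      using v(1) by (intro eq_vecI) (auto simp: complex_eq_iff)
    then show False using v by simp
  qed
  have "b \<bullet> (A *\<^sub>v a) = a \<bullet> (A *\<^sub>v b)"
    using symmetric_scalar_prod[OF A sym ab(2,1)] .
  then have "Im \<mu> * (a \<bullet> a + b \<bullet> b) = 0"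
    using ab unfolding Aa Ab
    by (simp add: scalar_prod_minus_distrib[of _ n] scalar_prod_add_distrib[of _ n]
        comm_scalar_prod[of b n a] algebra_simps)
  then have im: "Im \<mu> = 0"
    using sum0 by simp
  have "\<exists>w. w \<in> carrier_vec n \<and> w \<bullet> w \<noteq> 0 \<and> A *\<^sub>v w = Re \<mu> \<cdot>\<^sub>v w"
  proof (cases "a \<bullet> a = 0")
    case True
    then have "b \<bullet> b \<noteq> 0" using sum0 by simp
    moreover have "A *\<^sub>v b = Re \<mu> \<cdot>\<^sub>v b"
      using ab unfolding Ab im by (intro eq_vecI) auto
    ultimately show ?thesis using ab by blast
  next
    case False
    moreover have "A *\<^sub>v a = Re \<mu> \<cdot>\<^sub>v a"
      using ab unfolding Aa im by (intro eq_vecI) auto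
    ultimately show ?thesis using ab by blast
  qed
  then obtain w where w: "w \<in> carrier_vec n" "w \<bullet> w \<noteq> 0" "A *\<^sub>v w = Re \<mu> \<cdot>\<^sub>v w"
    by blast
  define w' where "w' = (1 / sqrt (w \<bullet> w)) \<cdot>\<^sub>v w"
  have "w \<bullet> w > 0" using w scalar_prod_self_nonneg[of w] by linarith
  then have "w' \<bullet> w' = 1"
    using w by (simp add: w'_def scalar_prod_smult_distrib[of _ n] field_simps)
  moreover have "A *\<^sub>v w' = Re \<mu> \<cdot>\<^sub>v w'"
    using w A by (simp add: w'_def mult_mat_vec[of _ n n] smult_smult_assoc mult.commute)
  moreover have "w' \<in> carrier_vec n" using w by (simp add: w'_def)
  ultimately show ?thesis by blast
qed

text \<open>Conjugating by a symmetric involution that carries the first unit vector to an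
  eigenvector splits off one coordinate. The case of equality is separate because the reflection
  vector vanishes there.\<close>

lemma orthogonal_mat_with_first_col:
  fixes w :: "real vec"
  assumes w: "w \<in> carrier_vec (Suc m)" and w1: "w \<bullet> w = 1"
  shows "\<exists>H. H \<in> carrier_mat (Suc m) (Suc m) \<and> H\<^sup>T = H \<and> H * H = 1\<^sub>m (Suc m) \<and>
             H *\<^sub>v unit_vec (Suc m) 0 = w"
proof (cases "w = unit_vec (Suc m) 0")
  case True
  then show ?thesis
    by (intro exI[of _ "1\<^sub>m (Suc m)"]) auto
next
  case False
  let ?n = "Suc m"
  define e where "e = (unit_vec ?n 0 :: real vec)"
  define v where "v = e - w"
  have e: "e \<in> carrier_vec ?n" and v: "v \<in> carrier_vec ?n"
    using w by (auto simp: e_def v_def)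
  define N where "N = v \<bullet> v"
  have ew: "e \<bullet> w = w $ 0" "w \<bullet> e = w $ 0" "e \<bullet> e = 1"
    using w by (auto simp: e_def)
  have N: "N = 2 - 2 * w $ 0"
    using w e ew w1 unfolding N_def v_def
    by (simp add: scalar_prod_minus_distrib[of _ ?n] minus_scalar_prod_distrib[of _ ?n])
  have N0: "N \<noteq> 0"
  proof
    assume "N = 0"
    then have "v = 0\<^sub>v ?n" using scalar_prod_self_eq_0[OF v] by (simp add: N_def)
    then have "e $ i - w $ i = 0" if "i < ?n" for i
      using that e w unfolding v_def by (metis carrier_vecD index_minus_vec(1) index_zero_vec(1))
    then have "w = e" using e w by (intro eq_vecI) auto
    then show False using False by (simp add: e_def)
  qed
  \<comment> \<open>the Householder reflection exchanging \<open>e\<close> and \<open>w\<close>\<close>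
  define H where "H = mat ?n ?n (\<lambda>(i, j). (if i = j then 1 else 0) - 2 / N * v $ i * v $ j)"
  have H: "H \<in> carrier_mat ?n ?n" by (simp add: H_def)
  have Hv: "H *\<^sub>v x = x - (2 / N * (v \<bullet> x)) \<cdot>\<^sub>v v" if x: "x \<in> carrier_vec ?n" for x
  proof (rule eq_vecI)
    fix i assume "i < dim_vec (x - (2 / N * (v \<bullet> x)) \<cdot>\<^sub>v v)"
    then have i: "i < ?n" using v by simp
    have "(H *\<^sub>v x) $ i = (\<Sum>j=0..<?n. (if i = j then x $ j else 0) - 2 / N * v $ i * (v $ j * x $ j))"
      using i x by (auto simp: H_def scalar_prod_def algebra_simps simp del: sum.op_ivl_Suc intro!: sum.cong)
    also have "\<dots> = x $ i - 2 / N * v $ i * (v \<bullet> x)"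
      using i x by (simp add: sum_subtractf scalar_prod_def sum_distrib_left
          sum.delta' del: sum.op_ivl_Suc)
    finally show "(H *\<^sub>v x) $ i = (x - (2 / N * (v \<bullet> x)) \<cdot>\<^sub>v v) $ i"
      using i x v by simp
  qed (use v H in auto)
  have "H *\<^sub>v e = w"
  proof -
    have "2 / N * (v \<bullet> e) = 1"
      using N N0 w e ew unfolding v_def
      by (simp add: minus_scalar_prod_distrib[of _ ?n] field_simps)
    then show ?thesis
      using Hv[OF e] e w by (intro eq_vecI) (auto simp: v_def)
  qed
  moreover have "H\<^sup>T = H"
    by (intro eq_matI) (auto simp: H_def)
  moreover have "H * H = 1\<^sub>m ?n"
  proof (rule eq_matI)
    fix i j assume "i < dim_row (1\<^sub>m ?n :: real mat)" "j < dim_col (1\<^sub>m ?n :: real mat)"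
    then have i: "i < ?n" and j: "j < ?n" by auto
    define x where "x = col H j"
    have x: "x \<in> carrier_vec ?n" using H j by (simp add: x_def)
    have x': "x = unit_vec ?n j - (2 / N * v $ j) \<cdot>\<^sub>v v"
    proof -
      have "x = H *\<^sub>v unit_vec ?n j" unfolding x_def using mat_mult_unit_vec[OF H j] by simp
      then show ?thesis using Hv[of "unit_vec ?n j"] j v by simp
    qed
    have vx: "v \<bullet> x = - v $ j"
      unfolding x' using v j N0
      by (simp add: scalar_prod_minus_distrib[of _ ?n] scalar_prod_smult_distrib[of _ ?n] N_def[symmetric])
    have "(H * H) $$ (i, j) = (H *\<^sub>v x) $ i"
      using i j H by (simp add: x_def)
    also have "\<dots> = (unit_vec ?n j :: real vec) $ i"
      unfolding Hv[OF x] vx using i v x by (simp add: x')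
    also have "\<dots> = (1\<^sub>m ?n) $$ (i, j)"
      using i j by simp
    finally show "(H * H) $$ (i, j) = (1\<^sub>m ?n) $$ (i, j)" .
  qed (use H in auto)
  ultimately show ?thesis using H by (auto simp: e_def)
qed

text \<open>Deflation: H A H has first column \<mu> e_0, by symmetry also first row \<mu> e_0, so it
  is block diagonal and the induction hypothesis applies to the remaining block.\<close>

theorem real_symmetric_diagonalization:
  fixes A :: "real mat"
  assumes "A \<in> carrier_mat n n" "A\<^sup>T = A"
  shows "\<exists>U d. U \<in> carrier_mat n n \<and> U\<^sup>T * U = 1\<^sub>m n \<and> U * U\<^sup>T = 1\<^sub>m n \<and>
               A = U * mat_diag n d * U\<^sup>T"
  using assms
proof (induction n arbitrary: A)
  case 0
  then show ?case by (intro exI[of _ "1\<^sub>m 0"] exI[of _ "\<lambda>_. 0"]) auto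
next
  case (Suc m)
  let ?n = "Suc m"
  note A = Suc.prems(1) and sym = Suc.prems(2)
  obtain \<mu> w where w: "w \<in> carrier_vec ?n" "w \<bullet> w = 1" "A *\<^sub>v w = \<mu> \<cdot>\<^sub>v w"
    using real_symmetric_eigenvector[OF A sym] by auto
  obtain H where H: "H \<in> carrier_mat ?n ?n" "H\<^sup>T = H" "H * H = 1\<^sub>m ?n"
    "H *\<^sub>v unit_vec ?n 0 = w"
    using orthogonal_mat_with_first_col[OF w(1,2)] by auto
  define B where "B = H * A * H"
  have B: "B \<in> carrier_mat ?n ?n" using A H by (simp add: B_def)
  have Bsym: "B\<^sup>T = B"
    unfolding B_def using A H sym
    by (simp add: transpose_mult[of _ ?n ?n _ ?n] assoc_mult_mat[of _ ?n ?n _ ?n _ ?n])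
  have Be: "B *\<^sub>v unit_vec ?n 0 = \<mu> \<cdot>\<^sub>v unit_vec ?n 0"
  proof -
    have "B *\<^sub>v unit_vec ?n 0 = H *\<^sub>v (A *\<^sub>v w)"
      unfolding B_def using A H by (simp add: assoc_mult_mat_vec[of _ ?n ?n _ ?n])
    also have "\<dots> = \<mu> \<cdot>\<^sub>v (H *\<^sub>v w)"
      using H w by (simp add: mult_mat_vec[of _ ?n ?n])
    also have "H *\<^sub>v w = (H * H) *\<^sub>v unit_vec ?n 0"
      using H(1) by (simp add: H(4) assoc_mult_mat_vec[of _ ?n ?n _ ?n])
    finally show ?thesis using H by simp
  qed
  have Bcol: "B $$ (i, 0) = (if i = 0 then \<mu> else 0)" if "i < ?n" for i
  proof -
    have "B $$ (i, 0) = (B *\<^sub>v unit_vec ?n 0) $ i"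
      using B that mat_mult_unit_vec[OF B, of 0] by simp
    then show ?thesis using that unfolding Be by (auto simp: unit_vec_def)
  qed
  have Brow: "B $$ (0, i) = (if i = 0 then \<mu> else 0)" if "i < ?n" for i
  proof -
    have "B $$ (0, i) = B\<^sup>T $$ (i, 0)"
      using B that by simp
    then show ?thesis using Bcol[OF that] Bsym by simp
  qed
  define A' where "A' = mat m m (\<lambda>(i, j). B $$ (Suc i, Suc j))"
  have A': "A' \<in> carrier_mat m m" by (simp add: A'_def)
  have "transpose_mat A' = A'"
  proof (rule eq_matI)
    fix i j assume "i < dim_row A'" "j < dim_col A'"
    then have ij: "Suc i < ?n" "Suc j < ?n" by (auto simp: A'_def)
    have "B\<^sup>T $$ (Suc i, Suc j) = B $$ (Suc j, Suc i)"
      using ij B by simp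
    then show "transpose_mat A' $$ (i, j) = A' $$ (i, j)"
      using ij by (simp add: A'_def Bsym)
  qed (simp_all add: A'_def)
  from Suc.IH[OF A' this] obtain U' d' where
    U': "U' \<in> carrier_mat m m" "transpose_mat U' * U' = 1\<^sub>m m" "U' * transpose_mat U' = 1\<^sub>m m"
      "A' = U' * mat_diag m d' * transpose_mat U'"
    by blast
  \<comment> \<open>Block-diagonal embedding. It respects products, transposes, the identity and
    diagonal matrices, so a diagonalization of the small block lifts to \<open>B\<close>.\<close>
  define F where "F = (\<lambda>a (C :: real mat). four_block_mat (mat 1 1 (\<lambda>_. a)) (0\<^sub>m 1 m) (0\<^sub>m m 1) C)"
  have Fmult: "F a C * F b D = F (a * b) (C * D)"
    if "C \<in> carrier_mat m m" "D \<in> carrier_mat m m" for a b :: real and C D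
  proof -
    have "mat 1 1 (\<lambda>_. a) * mat 1 1 (\<lambda>_. b) = mat 1 1 (\<lambda>_. a * b)"
      by (intro eq_matI) (auto simp: scalar_prod_def)
    then show ?thesis
      using that unfolding F_def by (subst mult_four_block_mat[of _ 1 1 _ m _ m _ _ 1 _ m]) auto
  qed
  have Ftrans: "transpose_mat (F a C) = F a (C\<^sup>T)" if "C \<in> carrier_mat m m" for a :: real and C
    using that unfolding F_def by (intro eq_matI) auto
  have F1: "F 1 (1\<^sub>m m) = (1\<^sub>m ?n :: real mat)"
    unfolding F_def by (intro eq_matI) auto
  have Fdiag: "F \<mu> (mat_diag m d') = mat_diag ?n (case_nat \<mu> d')"
    unfolding F_def by (intro eq_matI) (auto simp: mat_diag_def split: nat.split)
  have BF: "B = F \<mu> A'"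
    using B Brow Bcol unfolding F_def by (intro eq_matI) (auto simp: A'_def)
  define V where "V = F 1 U'"
  have V: "V \<in> carrier_mat ?n ?n"
    unfolding V_def F_def using four_block_carrier_mat[of "mat 1 1 (\<lambda>_. 1::real)" 1 1 U' m m] U' by auto
  have VV: "V\<^sup>T * V = 1\<^sub>m ?n" "V * V\<^sup>T = 1\<^sub>m ?n"
    "B = V * mat_diag ?n (case_nat \<mu> d') * V\<^sup>T"
    unfolding V_def using U' by (simp_all add: Ftrans Fmult F1 BF flip: Fdiag)
  define U where "U = H * V"
  have Ut: "U\<^sup>T = V\<^sup>T * H"
    unfolding U_def using H V by (simp add: transpose_mult[of _ ?n ?n _ ?n])
  have U: "U \<in> carrier_mat ?n ?n" using H V by (simp add: U_def)
  have tV: "V\<^sup>T \<in> carrier_mat ?n ?n" using V by simp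
  note assoc = assoc_mult_mat[of _ ?n ?n _ ?n _ ?n]
  have HH: "H * (H * X) = X" if "X \<in> carrier_mat ?n ?n" for X
    using that H(1,3) by (simp flip: assoc)
  have "U\<^sup>T * U = V\<^sup>T * (H * (H * V))"
    unfolding Ut unfolding U_def using H(1) V tV by (simp add: assoc)
  then have 1: "U\<^sup>T * U = 1\<^sub>m ?n"
    using HH[OF V] VV by simp
  have "V * (V\<^sup>T * H) = H"
    using V tV H(1) VV by (simp flip: assoc)
  then have 2: "U * U\<^sup>T = 1\<^sub>m ?n"
    unfolding Ut unfolding U_def using H V tV by (simp add: assoc)
  have "H * B * H = H * (H * (A * (H * H)))"
    unfolding B_def using A H(1) by (simp add: assoc)
  then have "A = H * B * H"
    using A H(3) HH[of A] by simp
  also have "\<dots> = U * mat_diag ?n (case_nat \<mu> d') * U\<^sup>T"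
    using mult_carrier_mat[OF V mult_carrier_mat[OF mat_diag_dim tV, of "case_nat \<mu> d'"]]
    unfolding Ut VV(3) unfolding U_def using H(1) V tV
    by (simp add: assoc mult_carrier_mat[of _ ?n ?n])
  finally show ?case using U 1 2 by blast
qed

lemma mult_mat_zero_vec:
  fixes A :: "real mat"
  assumes "A \<in> carrier_mat m n"
  shows "A *\<^sub>v 0\<^sub>v n = 0\<^sub>v m"
  using assms by (intro eq_vecI) auto

lemma psd_mat_diag_conj:
  fixes U :: "real mat"
  assumes U: "U \<in> carrier_mat n n" "U\<^sup>T * U = 1\<^sub>m n"
  shows "U * mat_diag n d * U\<^sup>T \<in> carrier_mat n n"
    and "transpose_mat (U * mat_diag n d * U\<^sup>T) = U * mat_diag n d * U\<^sup>T"
    and "x \<in> carrier_vec n \<Longrightarrow> x \<bullet> ((U * mat_diag n d * U\<^sup>T) *\<^sub>v x)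
           = (\<Sum>i<n. d i * ((U\<^sup>T *\<^sub>v x) $ i)\<^sup>2)"
proof -
  note assoc = assoc_mult_mat[of _ n n _ n _ n]
  note [simp] = mult_carrier_mat[of _ n n _ n] mult_mat_vec_carrier[of _ n n]
  have tU: "U\<^sup>T \<in> carrier_mat n n" using U by simp
  have D: "mat_diag n d \<in> carrier_mat n n" by simp
  show "U * mat_diag n d * U\<^sup>T \<in> carrier_mat n n"
    using U tU D by simp
  have "transpose_mat (mat_diag n d) = mat_diag n d"
    by (intro eq_matI) (auto simp: mat_diag_def)
  then show "transpose_mat (U * mat_diag n d * U\<^sup>T) = U * mat_diag n d * U\<^sup>T"
    using U(1) tU D by (simp add: transpose_mult[of _ n n _ n] assoc)
  assume x: "x \<in> carrier_vec n"
  define y where "y = U\<^sup>T *\<^sub>v x"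
  have y: "y \<in> carrier_vec n" using x U by (simp add: y_def)
  have "x \<bullet> ((U * mat_diag n d * U\<^sup>T) *\<^sub>v x) = x \<bullet> (U *\<^sub>v (mat_diag n d *\<^sub>v y))"
    using U(1) x tU D by (simp add: y_def assoc_mult_mat_vec[of _ n n _ n])
  also have "\<dots> = y \<bullet> (mat_diag n d *\<^sub>v y)"
    using transpose_vec_mult_scalar[OF U(1) _ x, of "mat_diag n d *\<^sub>v y"] D y unfolding y_def by (metis mult_mat_vec_carrier)
  also have "mat_diag n d *\<^sub>v y = vec n (\<lambda>i. d i * y $ i)"
    using y by (intro eq_vecI)
      (auto simp: mat_diag_def scalar_prod_def if_distrib if_distribR sum.delta cong: if_cong)
  also have "y \<bullet> \<dots> = (\<Sum>i<n. d i * (y $ i)\<^sup>2)"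
    using y by (auto simp: scalar_prod_def power2_eq_square lessThan_atLeast0 intro!: sum.cong)
  finally show "x \<bullet> ((U * mat_diag n d * U\<^sup>T) *\<^sub>v x)
           = (\<Sum>i<n. d i * ((U\<^sup>T *\<^sub>v x) $ i)\<^sup>2)"
    by (simp add: y_def)
qed

lemma orthogonal_mat_norm:
  fixes U :: "real mat"
  assumes U: "U \<in> carrier_mat n n" "U * U\<^sup>T = 1\<^sub>m n" and x: "x \<in> carrier_vec n"
  shows "(\<Sum>i<n. ((U\<^sup>T *\<^sub>v x) $ i)\<^sup>2) = x \<bullet> x"
proof -
  have tU: "U\<^sup>T \<in> carrier_mat n n" using U by simp
  have "(\<Sum>i<n. ((U\<^sup>T *\<^sub>v x) $ i)\<^sup>2) = (U\<^sup>T *\<^sub>v x) \<bullet> (U\<^sup>T *\<^sub>v x)"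
    using U x by (auto simp: scalar_prod_def power2_eq_square lessThan_atLeast0 intro!: sum.cong)
  also have "\<dots> = x \<bullet> (U *\<^sub>v (U\<^sup>T *\<^sub>v x))"
    using transpose_vec_mult_scalar[OF U(1) _ x, of "U\<^sup>T *\<^sub>v x"] U x by simp
  also have "U *\<^sub>v (U\<^sup>T *\<^sub>v x) = (U * U\<^sup>T) *\<^sub>v x"
    using U(1) tU x by (intro assoc_mult_mat_vec[of _ n n _ n, symmetric]) auto
  finally show ?thesis using U x by simp
qed

lemma orthogonal_conj_cancel:
  fixes U :: "real mat"
  assumes U: "U \<in> carrier_mat n n" "U\<^sup>T * U = 1\<^sub>m n"
  shows "(U * mat_diag n d * U\<^sup>T) * (U * mat_diag n e * U\<^sup>T)
         = U * mat_diag n (\<lambda>i. d i * e i) * U\<^sup>T"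
proof -
  note assoc = assoc_mult_mat[of _ n n _ n _ n]
  note [simp] = mult_carrier_mat[of _ n n _ n] mult_mat_vec_carrier[of _ n n]
  have tU: "U\<^sup>T \<in> carrier_mat n n" using U by simp
  have "U\<^sup>T * (U * X) = X" if "X \<in> carrier_mat n n" for X
    using that U tU by (simp flip: assoc)
  moreover have "mat_diag n d * (mat_diag n e * U\<^sup>T) = mat_diag n (\<lambda>i. d i * e i) * U\<^sup>T"
    using tU by (simp flip: assoc)
  ultimately show ?thesis
    using U(1) tU by (simp add: assoc)
qed

text \<open>Both eigenvalue bounds come from evaluating the quadratic form at the columns of
  \<open>U\<close>, where it equals \<open>d i\<close>. The last clause turns any upper bound on the
  form into a bound on the spectrum.\<close>

lemma psd_diagonalization:
  assumes "psd_mat n S"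
  obtains U d where "U \<in> carrier_mat n n" "U\<^sup>T * U = 1\<^sub>m n" "U * U\<^sup>T = 1\<^sub>m n"
    "S = U * mat_diag n d * U\<^sup>T" "\<And>i. i < n \<Longrightarrow> d i \<ge> 0"
    "\<And>i s. i < n \<Longrightarrow> (\<And>x. x \<in> carrier_vec n \<Longrightarrow> x \<bullet> (S *\<^sub>v x) \<le> s * (x \<bullet> x)) \<Longrightarrow> d i \<le> s"
proof -
  obtain U d where U: "U \<in> carrier_mat n n" "U\<^sup>T * U = 1\<^sub>m n" "U * U\<^sup>T = 1\<^sub>m n"
    "S = U * mat_diag n d * U\<^sup>T"
    using assms real_symmetric_diagonalization unfolding psd_mat_def by blast
  have ex: "\<exists>x\<in>carrier_vec n. x \<bullet> x = 1 \<and> x \<bullet> (S *\<^sub>v x) = d i" if i: "i < n" for i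
  proof -
    define x where "x = U *\<^sub>v unit_vec n i"
    have x: "x \<in> carrier_vec n" using U by (simp add: x_def)
    have "U\<^sup>T *\<^sub>v x = (U\<^sup>T * U) *\<^sub>v unit_vec n i"
      using U(1) unfolding x_def by (intro assoc_mult_mat_vec[of _ n n _ n, symmetric]) auto
    then have tx: "U\<^sup>T *\<^sub>v x = unit_vec n i"
      using U by simp
    then have "x \<bullet> (S *\<^sub>v x) = (\<Sum>j<n. d j * ((unit_vec n i :: real vec) $ j)\<^sup>2)"
      using psd_mat_diag_conj(3)[OF U(1,2) x] U(4) by simp
    also have "\<dots> = d i"
      using i by (simp add: unit_vec_def if_distrib if_distribR sum.delta cong: if_cong)
    finally have 1: "x \<bullet> (S *\<^sub>v x) = d i" .
    have "x \<bullet> x = (\<Sum>j<n. ((unit_vec n i :: real vec) $ j)\<^sup>2)"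
      using orthogonal_mat_norm[OF U(1,3) x] tx by simp
    also have "\<dots> = 1"
      using i by (simp add: unit_vec_def if_distrib if_distribR sum.delta cong: if_cong)
    finally show ?thesis using x 1 by blast
  qed
  show thesis
  proof (rule that[OF U])
    show "d i \<ge> 0" if "i < n" for i
      using ex[OF that] assms by (auto simp: psd_mat_def)
    show "d i \<le> s" if "i < n" "\<And>x. x \<in> carrier_vec n \<Longrightarrow> x \<bullet> (S *\<^sub>v x) \<le> s * (x \<bullet> x)" for i s
      using ex[OF that(1)] that(2) by fastforce
  qed
qed

section \<open>Positive semi-definite square roots\<close>

lemma psd_sqrt_exists:
  assumes "psd_mat n S"
  shows "\<exists>B. psd_mat n B \<and> B * B = S"
proof -
  obtain U d where U: "U \<in> carrier_mat n n" "U\<^sup>T * U = 1\<^sub>m n"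
    "S = U * mat_diag n d * U\<^sup>T" and d: "\<And>i. i < n \<Longrightarrow> d i \<ge> 0"
    using psd_diagonalization[OF assms] by metis
  define B where "B = U * mat_diag n (\<lambda>i. sqrt (d i)) * U\<^sup>T"
  have "psd_mat n B"
    using psd_mat_diag_conj(1,2)[OF U(1,2), where d = "\<lambda>i. sqrt (d i)"]
      psd_mat_diag_conj(3)[OF U(1,2), where d = "\<lambda>i. sqrt (d i)"] d
    unfolding psd_mat_def B_def by (auto intro!: sum_nonneg)
  moreover have "B * B = S"
  proof -
    have "mat_diag n (\<lambda>i. sqrt (d i) * sqrt (d i)) = mat_diag n d"
      using d by (intro eq_matI) (auto simp: mat_diag_def)
    then show ?thesis
      unfolding B_def orthogonal_conj_cancel[OF U(1,2)] using U by simp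
  qed
  ultimately show ?thesis by blast
qed

text \<open>Let x be an eigenvector of B - C with eigenvalue d nonzero. Then Bx = Cx + dx, and |Bx|
  = |Cx| gives 2 x.(Cx) + d |x|^2 = 0, hence x.(Bx) = - x.(Cx). Both forms are nonnegative, so they
  vanish, and then so does x.\<close>

lemma psd_sqrt_unique:
  assumes B: "psd_mat n B" and C: "psd_mat n C" and eq: "B * B = C * C"
  shows "B = C"
proof -
  have Bc: "B \<in> carrier_mat n n" and Cc: "C \<in> carrier_mat n n"
    and Bs: "B\<^sup>T = B" and Cs: "C\<^sup>T = C"
    using B C by (auto simp: psd_mat_def)
  define D where "D = B - C"
  have D: "D \<in> carrier_mat n n" using Bc Cc by (simp add: D_def minus_carrier_mat)
  have Ds: "D\<^sup>T = D"
    using Bc Cc Bs Cs by (simp add: D_def transpose_minus[of _ n n])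
  obtain U d where U: "U \<in> carrier_mat n n" "U\<^sup>T * U = 1\<^sub>m n" "U * U\<^sup>T = 1\<^sub>m n"
    "D = U * mat_diag n d * U\<^sup>T"
    using real_symmetric_diagonalization[OF D Ds] by blast
  have "d i = 0" if i: "i < n" for i
  proof (rule ccontr)
    assume di: "d i \<noteq> 0"
    define x where "x = U *\<^sub>v unit_vec n i"
    have x: "x \<in> carrier_vec n" using U by (simp add: x_def)
    have tx: "U\<^sup>T *\<^sub>v x = unit_vec n i"
    proof -
      have "U\<^sup>T *\<^sub>v x = (U\<^sup>T * U) *\<^sub>v unit_vec n i"
        using U(1) unfolding x_def by (intro assoc_mult_mat_vec[of _ n n _ n, symmetric]) auto
      then show ?thesis using U by simp
    qed
    have "D *\<^sub>v x = U *\<^sub>v (mat_diag n d *\<^sub>v unit_vec n i)"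
      using U x tx by (simp add: assoc_mult_mat_vec[of _ n n _ n])
    also have "mat_diag n d *\<^sub>v unit_vec n i = d i \<cdot>\<^sub>v unit_vec n i"
      using i by (subst mat_mult_unit_vec[of _ n]) (auto simp: mat_diag_def)
    finally have Dx: "D *\<^sub>v x = d i \<cdot>\<^sub>v x"
      using U by (simp add: x_def mult_mat_vec[of _ n n])
    have BDx: "B *\<^sub>v x = C *\<^sub>v x + d i \<cdot>\<^sub>v x"
      using Dx[symmetric] Bc Cc x unfolding D_def
      by (simp add: minus_mult_distrib_mat_vec[of _ n n]) (intro eq_vecI; auto)
    have "(B *\<^sub>v x) \<bullet> (B *\<^sub>v x) = x \<bullet> ((B * B) *\<^sub>v x)"
      using symmetric_scalar_prod[OF Bc Bs, of "B *\<^sub>v x" x] Bc x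
      by (simp add: assoc_mult_mat_vec[of _ n n _ n])
    moreover have "(C *\<^sub>v x) \<bullet> (C *\<^sub>v x) = x \<bullet> ((C * C) *\<^sub>v x)"
      using symmetric_scalar_prod[OF Cc Cs, of "C *\<^sub>v x" x] Cc x
      by (simp add: assoc_mult_mat_vec[of _ n n _ n])
    ultimately have "(B *\<^sub>v x) \<bullet> (B *\<^sub>v x) = (C *\<^sub>v x) \<bullet> (C *\<^sub>v x)"
      using eq by simp
    then have "d i * (2 * (x \<bullet> (C *\<^sub>v x)) + d i * (x \<bullet> x)) = 0"
      unfolding BDx using Cc x
      by (simp add: scalar_prod_add_distrib[of _ n] add_scalar_prod_distrib[of _ n]
          comm_scalar_prod[of "C *\<^sub>v x" n x] algebra_simps)
    then have e1: "2 * (x \<bullet> (C *\<^sub>v x)) + d i * (x \<bullet> x) = 0"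
      using di by simp
    have "x \<bullet> (B *\<^sub>v x) = x \<bullet> (C *\<^sub>v x) + d i * (x \<bullet> x)"
      unfolding BDx using Cc x by (simp add: scalar_prod_add_distrib[of _ n])
    then have "x \<bullet> (B *\<^sub>v x) = - (x \<bullet> (C *\<^sub>v x))" using e1 by simp
    moreover have "x \<bullet> (B *\<^sub>v x) \<ge> 0" "x \<bullet> (C *\<^sub>v x) \<ge> 0"
      using B C x by (auto simp: psd_mat_def)
    ultimately have "x \<bullet> (C *\<^sub>v x) = 0" by simp
    then have "x \<bullet> x = 0" using e1 di by simp
    then have "x = 0\<^sub>v n" using scalar_prod_self_eq_0[OF x] by simp
    then have "unit_vec n i = (0\<^sub>v n :: real vec)" using tx U(1) by (simp add: mult_mat_zero_vec[of _ n n])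
    then show False using i by (metis index_unit_vec(1) index_zero_vec(1) zero_neq_one)
  qed
  then have "mat_diag n d = 0\<^sub>m n n"
    by (intro eq_matI) (auto simp: mat_diag_def)
  then have "D = 0\<^sub>m n n" using U by simp
  then have "B $$ (i, j) - C $$ (i, j) = 0" if "i < n" "j < n" for i j
    using that Bc Cc by (metis D_def carrier_matD index_minus_mat(1) index_zero_mat(1))
  then show ?thesis using Bc Cc by (intro eq_matI) auto
qed

lemma psd_sqrt:
  assumes "psd_mat n S"
  shows "psd_mat n (psd_sqrt S)" "psd_sqrt S * psd_sqrt S = S"
proof -
  have "dim_row S = n" using assms by (auto simp: psd_mat_def)
  moreover obtain B where "psd_mat n B \<and> B * B = S"
    using psd_sqrt_exists[OF assms] by blast
  then have "psd_mat n (THE B. psd_mat n B \<and> B * B = S) \<and> 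
      (THE B. psd_mat n B \<and> B * B = S) * (THE B. psd_mat n B \<and> B * B = S) = S"
    using psd_sqrt_unique by (intro theI[of "\<lambda>B. psd_mat n B \<and> B * B = S"]) auto
  ultimately have "psd_mat n (psd_sqrt S) \<and> psd_sqrt S * psd_sqrt S = S"
    unfolding psd_sqrt_def by simp
  then show "psd_mat n (psd_sqrt S)" "psd_sqrt S * psd_sqrt S = S" by auto
qed

section \<open>Frobenius and spectral norms\<close>

lemma scalar_prod_Cauchy_Schwarz:
  fixes u v :: "real vec"
  assumes "u \<in> carrier_vec n" "v \<in> carrier_vec n"
  shows "(u \<bullet> v)\<^sup>2 \<le> (u \<bullet> u) * (v \<bullet> v)"
proof -
  have "(\<Sum>i=0..<n. u $ i * v $ i)\<^sup>2 \<le> (\<Sum>i=0..<n. (u $ i)\<^sup>2) * (\<Sum>i=0..<n. (v $ i)\<^sup>2)"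
    by (rule Cauchy_Schwarz_ineq_sum)
  then show ?thesis
    using assms by (simp add: scalar_prod_def power2_eq_square)
qed

lemma mult_mat_vec_le_frobenius:
  fixes B :: "real mat"
  assumes "B \<in> carrier_mat m n" "x \<in> carrier_vec n"
  shows "(B *\<^sub>v x) \<bullet> (B *\<^sub>v x) \<le> (frobenius_norm B)\<^sup>2 * (x \<bullet> x)"
proof -
  have F: "(frobenius_norm B)\<^sup>2 = (\<Sum>i<m. \<Sum>j<n. (B $$ (i, j))\<^sup>2)"
    using assms unfolding frobenius_norm_def by (simp add: sum_nonneg)
  have "(B *\<^sub>v x) \<bullet> (B *\<^sub>v x) = (\<Sum>i<m. (row B i \<bullet> x)\<^sup>2)"
    using assms by (auto simp: scalar_prod_def[of "B *\<^sub>v x"] power2_eq_square lessThan_atLeast0 intro!: sum.cong)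
  also have "\<dots> \<le> (\<Sum>i<m. (\<Sum>j<n. (B $$ (i, j))\<^sup>2) * (x \<bullet> x))"
  proof (rule sum_mono)
    fix i assume i: "i \<in> {..<m}"
    then have "row B i \<bullet> row B i = (\<Sum>j<n. (B $$ (i, j))\<^sup>2)"
      using assms by (auto simp: scalar_prod_def power2_eq_square lessThan_atLeast0 intro!: sum.cong)
    then show "(row B i \<bullet> x)\<^sup>2 \<le> (\<Sum>j<n. (B $$ (i, j))\<^sup>2) * (x \<bullet> x)"
      using scalar_prod_Cauchy_Schwarz[of "row B i" n x] assms
      by (metis carrier_matD(2) row_carrier)
  qed
  also have "\<dots> = (frobenius_norm B)\<^sup>2 * (x \<bullet> x)"
    unfolding F by (simp add: sum_distrib_right)
  finally show ?thesis .
qed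

lemma frobenius_norm_nonneg: "frobenius_norm B \<ge> 0"
  unfolding frobenius_norm_def by (simp add: sum_nonneg)

text \<open>The Frobenius estimate shows that the set in the definition of
  \<open>spectral_norm\<close> is bounded above; without that its supremum could not be used as an
  upper bound.\<close>

lemma
  assumes B: "B \<in> carrier_mat m n"
  shows mult_mat_vec_le_spectral_norm:
      "x \<in> carrier_vec n \<Longrightarrow> x \<bullet> x \<le> 1 \<Longrightarrow> sqrt ((B *\<^sub>v x) \<bullet> (B *\<^sub>v x)) \<le> spectral_norm B"
    and spectral_norm_le_frobenius_norm: "spectral_norm B \<le> frobenius_norm B"
proof -
  let ?S = "{x \<in> carrier_vec (dim_col B). (x :: real vec) \<bullet> x \<le> 1}"
  have le: "sqrt ((B *\<^sub>v x) \<bullet> (B *\<^sub>v x)) \<le> frobenius_norm B" if "x \<in> ?S" for x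
  proof -
    have "(B *\<^sub>v x) \<bullet> (B *\<^sub>v x) \<le> (frobenius_norm B)\<^sup>2 * (x \<bullet> x)"
      using that B by (intro mult_mat_vec_le_frobenius) auto
    also have "\<dots> \<le> (frobenius_norm B)\<^sup>2 * 1"
      using that by (intro mult_left_mono) auto
    finally show ?thesis
      using frobenius_norm_nonneg[of B] by (simp add: real_le_lsqrt)
  qed
  then have bdd: "bdd_above ((\<lambda>x. sqrt ((B *\<^sub>v x) \<bullet> (B *\<^sub>v x))) ` ?S)"
    by (intro bdd_aboveI2)
  show "sqrt ((B *\<^sub>v x) \<bullet> (B *\<^sub>v x)) \<le> spectral_norm B" if "x \<in> carrier_vec n" "x \<bullet> x \<le> 1" for x
    unfolding spectral_norm_def using that B bdd by (intro cSUP_upper) auto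
  have "?S \<noteq> {}"
    using zero_carrier_vec[of "dim_col B"]
      scalar_prod_left_zero[OF zero_carrier_vec[of "dim_col B"], where 'a = real]
    by (intro ex_in_conv[THEN iffD1] exI[of _ "0\<^sub>v (dim_col B)"]) simp
  then show "spectral_norm B \<le> frobenius_norm B"
    unfolding spectral_norm_def using le by (intro cSUP_least) auto
qed

lemma quadratic_bound_of_unit:
  fixes F G :: "real mat"
  assumes F: "F \<in> carrier_mat n n" and G: "G \<in> carrier_mat n n" and w: "w \<in> carrier_vec n"
    and unit: "\<And>v. v \<in> carrier_vec n \<Longrightarrow> v \<bullet> v = 1 \<Longrightarrow> \<bar>v \<bullet> (F *\<^sub>v v) - v \<bullet> (G *\<^sub>v v)\<bar> \<le> b"
  shows "\<bar>w \<bullet> (F *\<^sub>v w) - w \<bullet> (G *\<^sub>v w)\<bar> \<le> b * (w \<bullet> w)"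
proof (cases "w \<bullet> w = 0")
  case True
  then have "w = 0\<^sub>v n" using scalar_prod_self_eq_0[OF w] by simp
  then show ?thesis using F G by (simp add: mult_mat_zero_vec[of _ n n])
next
  case False
  define a where "a = sqrt (w \<bullet> w)"
  have a: "a > 0" "a * a = w \<bullet> w"
    using False scalar_prod_self_nonneg[of w] by (auto simp: a_def)
  define v where "v = (1 / a) \<cdot>\<^sub>v w"
  have v: "v \<in> carrier_vec n" "v \<bullet> v = 1"
    using w a by (auto simp: v_def scalar_prod_smult_distrib[of _ n] simp flip: a(2))
  have sc: "v \<bullet> (H *\<^sub>v v) = (w \<bullet> (H *\<^sub>v w)) / (a * a)" if "H \<in> carrier_mat n n" for H
    using that w a mult_mat_vec_carrier[OF that w]
    by (simp add: v_def mult_mat_vec[of _ n n] scalar_prod_smult_distrib[of _ n] field_simps)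
  have "\<bar>(w \<bullet> (F *\<^sub>v w) - w \<bullet> (G *\<^sub>v w)) / (a * a)\<bar> \<le> b"
    using unit[OF v] unfolding sc[OF F] sc[OF G] diff_divide_distrib .
  then have "\<bar>w \<bullet> (F *\<^sub>v w) - w \<bullet> (G *\<^sub>v w)\<bar> / (a * a) \<le> b"
    using a(1) by (simp add: abs_mult)
  then show ?thesis using pos_divide_le_eq[OF mult_pos_pos[OF a(1) a(1)]] a(2) by simp
qed

lemma spectral_norm_pos:
  assumes B: "B \<in> carrier_mat m n" and nz: "B \<noteq> 0\<^sub>m m n"
  shows "spectral_norm B > 0"
proof -
  obtain i j where ij: "i < m" "j < n" "B $$ (i, j) \<noteq> 0"
    using B nz by (metis carrier_matD eq_matI index_zero_mat)
  let ?x = "unit_vec n j :: real vec"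
  have "(B *\<^sub>v ?x) $ i = B $$ (i, j)"
    using ij B mat_mult_unit_vec[OF B, of j] by simp
  then have "B *\<^sub>v ?x \<noteq> 0\<^sub>v m"
    using ij by auto
  then have "(B *\<^sub>v ?x) \<bullet> (B *\<^sub>v ?x) > 0"
    using scalar_prod_self_eq_0[of "B *\<^sub>v ?x" m] scalar_prod_self_nonneg[of "B *\<^sub>v ?x"] B by force
  then show ?thesis
    using mult_mat_vec_le_spectral_norm[OF B, of ?x] ij
    by (smt (verit) real_sqrt_gt_zero scalar_prod_left_unit index_unit_vec(1) unit_vec_carrier)
qed

lemma psd_mat_quadratic_le_spectral_norm:
  assumes S: "S \<in> carrier_mat n n" and x: "x \<in> carrier_vec n"
  shows "x \<bullet> (S *\<^sub>v x) \<le> spectral_norm S * (x \<bullet> x)"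
proof (cases "x \<bullet> x = 0")
  case True
  then have "x = 0\<^sub>v n" using scalar_prod_self_eq_0[OF x] by simp
  then show ?thesis using S by simp
next
  case False
  then have pos: "x \<bullet> x > 0" using scalar_prod_self_nonneg[of x] by linarith
  define y where "y = (1 / sqrt (x \<bullet> x)) \<cdot>\<^sub>v x"
  have y: "y \<in> carrier_vec n" "y \<bullet> y = 1"
    using x pos by (auto simp: y_def scalar_prod_smult_distrib[of _ n] field_simps)
  have "(y \<bullet> (S *\<^sub>v y))\<^sup>2 \<le> (y \<bullet> y) * ((S *\<^sub>v y) \<bullet> (S *\<^sub>v y))"
    using S y by (intro scalar_prod_Cauchy_Schwarz) auto
  then have "y \<bullet> (S *\<^sub>v y) \<le> sqrt ((S *\<^sub>v y) \<bullet> (S *\<^sub>v y))"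
    using y by (simp add: real_le_rsqrt)
  also have "\<dots> \<le> spectral_norm S"
    using mult_mat_vec_le_spectral_norm[OF S] y by simp
  finally have "y \<bullet> (S *\<^sub>v y) \<le> spectral_norm S" .
  moreover have "y \<bullet> (S *\<^sub>v y) = (x \<bullet> (S *\<^sub>v x)) / (x \<bullet> x)"
    using x S pos by (simp add: y_def mult_mat_vec[of _ n n] scalar_prod_smult_distrib[of _ n] field_simps)
  ultimately show ?thesis using pos by (simp add: field_simps)
qed

subsection \<open>Ridge resolvents\<close>

lemma rank_one_update_mult_vec:
  fixes Q :: "real mat"
  assumes "Q \<in> carrier_mat n n" "y \<in> carrier_vec n" "v \<in> carrier_vec n"
  shows "mat n n (\<lambda>(i, j). Q $$ (i, j) - y $ i * y $ j / q) *\<^sub>v v = Q *\<^sub>v v - ((y \<bullet> v) / q) \<cdot>\<^sub>v y"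
proof (rule eq_vecI)
  fix i assume "i < dim_vec (Q *\<^sub>v v - ((y \<bullet> v) / q) \<cdot>\<^sub>v y)"
  then have i: "i < n" using assms by simp
  show "(mat n n (\<lambda>(i, j). Q $$ (i, j) - y $ i * y $ j / q) *\<^sub>v v) $ i = (Q *\<^sub>v v - ((y \<bullet> v) / q) \<cdot>\<^sub>v y) $ i"
    using i assms by (simp add: scalar_prod_def left_diff_distrib right_diff_distrib sum_subtractf sum_divide_distrib
        sum_distrib_left sum_distrib_right mult.commute mult.left_commute)
qed (use assms in auto)

text \<open>\<open>ridge n l [x\<^sub>1, \<dots>, x\<^sub>k]\<close> is \<open>l (l I + X\<^sup>T X)\<^sup>-\<^sup>1\<close>, where \<open>X\<close> has rows \<open>x\<^sub>i\<close>; the recursion is the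
  Sherman--Morrison formula, which makes measurability evident.\<close>

primrec ridge :: "nat \<Rightarrow> real \<Rightarrow> real vec list \<Rightarrow> real mat" where
  "ridge n l [] = 1\<^sub>m n"
| "ridge n l (x # xs) =
     mat n n (\<lambda>(i, j). ridge n l xs $$ (i, j)
       - (ridge n l xs *\<^sub>v x) $ i * (ridge n l xs *\<^sub>v x) $ j / (l + x \<bullet> (ridge n l xs *\<^sub>v x)))"

lemma ridge_carrier [simp]: "ridge n l xs \<in> carrier_mat n n"
  by (cases xs) auto

lemma ridge_mult_carrier [simp]: "ridge n l xs *\<^sub>v v \<in> carrier_vec n"
  using carrier_matD(1)[OF ridge_carrier] by (intro carrier_vecI) simp

lemma ridge_symmetric: "transpose_mat (ridge n l xs) = ridge n l xs"
proof (induction xs)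
  case (Cons x xs)
  have "ridge n l xs $$ (i, j) = ridge n l xs $$ (j, i)" if "i < n" "j < n" for i j
    using Cons.IH that by (metis carrier_matD index_transpose_mat(1) ridge_carrier)
  then show ?case by (intro eq_matI) auto
qed simp


lemma ridge_dim [simp]: "dim_row (ridge n l xs) = n" "dim_col (ridge n l xs) = n"
  using carrier_matD[OF ridge_carrier] by auto

lemma ridge_Cons_mult_vec:
  assumes "v \<in> carrier_vec n"
  shows "ridge n l (x # xs) *\<^sub>v v = ridge n l xs *\<^sub>v v
    - (((ridge n l xs *\<^sub>v x) \<bullet> v) / (l + x \<bullet> (ridge n l xs *\<^sub>v x))) \<cdot>\<^sub>v (ridge n l xs *\<^sub>v x)"
  using rank_one_update_mult_vec[OF ridge_carrier ridge_mult_carrier assms] by simp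

lemma ridge_scalar_prod_commute:
  assumes "u \<in> carrier_vec n" "v \<in> carrier_vec n"
  shows "u \<bullet> (ridge n l xs *\<^sub>v v) = v \<bullet> (ridge n l xs *\<^sub>v u)"
  using symmetric_scalar_prod[OF ridge_carrier ridge_symmetric assms] .

text \<open>The first claim is l (l I + X^T X)^-1 in weak form, tested against u, so that no inverse
  has to be formed. Taking u equal to the resolvent of v and dropping the squares gives the second
  claim.\<close>

lemma ridge_resolvent:
  assumes l: "l > 0" and "set xs \<subseteq> carrier_vec n" "u \<in> carrier_vec n" "v \<in> carrier_vec n"
  shows "l * (u \<bullet> (ridge n l xs *\<^sub>v v)) + (\<Sum>x\<leftarrow>xs. (x \<bullet> (ridge n l xs *\<^sub>v v)) * (x \<bullet> u)) = l * (u \<bullet> v)"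
    and "(ridge n l xs *\<^sub>v v) \<bullet> (ridge n l xs *\<^sub>v v) \<le> v \<bullet> (ridge n l xs *\<^sub>v v)"
proof -
  have norm: "w \<bullet> w \<le> v \<bullet> w"
    if "l * (w \<bullet> w) + (\<Sum>x\<leftarrow>xs. (x \<bullet> w) * (x \<bullet> w)) = l * (w \<bullet> v)" "w \<in> carrier_vec n" "v \<in> carrier_vec n"
    for xs v w
  proof -
    have "(\<Sum>x\<leftarrow>xs. (x \<bullet> w) * (x \<bullet> w)) \<ge> 0"
      by (intro sum_list_nonneg) auto
    then have "l * (w \<bullet> w) \<le> l * (w \<bullet> v)" using that by linarith
    then show ?thesis using l comm_scalar_prod[OF that(2,3)] by simp
  qed
  have main: "l * (u \<bullet> (ridge n l xs *\<^sub>v v)) + (\<Sum>x\<leftarrow>xs. (x \<bullet> (ridge n l xs *\<^sub>v v)) * (x \<bullet> u)) = l * (u \<bullet> v)"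
    if "set xs \<subseteq> carrier_vec n" "u \<in> carrier_vec n" "v \<in> carrier_vec n" for xs u v
    using that
  proof (induction xs arbitrary: u v)
    case (Cons x xs)
    define Q where "Q = ridge n l xs"
    define y where "y = Q *\<^sub>v x"
    define q where "q = l + x \<bullet> y"
    have x: "x \<in> carrier_vec n" and xs: "set xs \<subseteq> carrier_vec n" using Cons.prems by auto
    have y: "y \<in> carrier_vec n" by (simp add: y_def Q_def)
    have Qv: "Q *\<^sub>v v \<in> carrier_vec n" by (simp add: Q_def)
    \<comment> \<open>The second claim for the shorter list, available from the induction
      hypothesis, keeps the Sherman-Morrison denominator positive.\<close>
    have "y \<bullet> y \<le> x \<bullet> y"
      using norm[of y xs x] Cons.IH[OF xs y x] y x by (simp add: y_def Q_def)
    then have q: "q > 0" using l scalar_prod_self_nonneg[of y] by (simp add: q_def)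
    have yv: "y \<bullet> v = x \<bullet> (Q *\<^sub>v v)"
      using ridge_scalar_prod_commute[OF x Cons.prems(3)] comm_scalar_prod[OF y Cons.prems(3)]
      by (simp add: y_def Q_def)
    have P: "w \<bullet> (ridge n l (x # xs) *\<^sub>v v) = w \<bullet> (Q *\<^sub>v v) - (y \<bullet> v) / q * (w \<bullet> y)" if "w \<in> carrier_vec n" for w
      using that y Qv unfolding ridge_Cons_mult_vec[OF Cons.prems(3)] Q_def[symmetric] y_def[symmetric] q_def[symmetric]
      by (simp add: scalar_prod_minus_distrib[of _ n])
    have "(\<Sum>w\<leftarrow>xs. (w \<bullet> (ridge n l (x # xs) *\<^sub>v v)) * (w \<bullet> u))
        = (\<Sum>w\<leftarrow>xs. (w \<bullet> (Q *\<^sub>v v)) * (w \<bullet> u) - (y \<bullet> v) / q * ((w \<bullet> y) * (w \<bullet> u)))"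
      using xs by (intro arg_cong[of _ _ sum_list] map_cong refl) (subst P; auto simp: algebra_simps)
    also have "\<dots> = (\<Sum>w\<leftarrow>xs. (w \<bullet> (Q *\<^sub>v v)) * (w \<bullet> u)) - (y \<bullet> v) / q * (\<Sum>w\<leftarrow>xs. (w \<bullet> y) * (w \<bullet> u))"
      by (simp only: sum_list_subtractf sum_list_const_mult)
    also have "(\<Sum>w\<leftarrow>xs. (w \<bullet> (Q *\<^sub>v v)) * (w \<bullet> u)) = l * (u \<bullet> v) - l * (u \<bullet> (Q *\<^sub>v v))"
      using Cons.IH[OF xs Cons.prems(2,3)] by (simp add: Q_def)
    also have "(\<Sum>w\<leftarrow>xs. (w \<bullet> y) * (w \<bullet> u)) = l * (u \<bullet> x) - l * (u \<bullet> y)"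
      using Cons.IH[OF xs Cons.prems(2) x] by (simp add: Q_def y_def)
    finally have S: "(\<Sum>w\<leftarrow>xs. (w \<bullet> (ridge n l (x # xs) *\<^sub>v v)) * (w \<bullet> u))
      = l * (u \<bullet> v) - l * (u \<bullet> (Q *\<^sub>v v)) - (y \<bullet> v) / q * (l * (u \<bullet> x) - l * (u \<bullet> y))" .
    have xP: "x \<bullet> (ridge n l (x # xs) *\<^sub>v v) = (y \<bullet> v) * (l / q)"
      using P[OF x] yv q by (simp add: q_def field_simps del: ridge.simps)
    show ?case
      unfolding list.map sum_list.Cons S xP P[OF Cons.prems(2)] comm_scalar_prod[OF x Cons.prems(2)]
      using q by (simp add: field_simps)
  qed simp
  show "l * (u \<bullet> (ridge n l xs *\<^sub>v v)) + (\<Sum>x\<leftarrow>xs. (x \<bullet> (ridge n l xs *\<^sub>v v)) * (x \<bullet> u)) = l * (u \<bullet> v)"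
    using main assms by blast
  show "(ridge n l xs *\<^sub>v v) \<bullet> (ridge n l xs *\<^sub>v v) \<le> v \<bullet> (ridge n l xs *\<^sub>v v)"
    using norm[OF main[OF assms(2) ridge_mult_carrier assms(4)] ridge_mult_carrier assms(4)] .
qed

lemma mat_eqI_bilinear:
  fixes A B :: "real mat"
  assumes A: "A \<in> carrier_mat n n" and B: "B \<in> carrier_mat n n"
    and eq: "\<And>u v. u \<in> carrier_vec n \<Longrightarrow> v \<in> carrier_vec n \<Longrightarrow> u \<bullet> (A *\<^sub>v v) = u \<bullet> (B *\<^sub>v v)"
  shows "A = B"
proof (rule eq_matI)
  fix i j assume "i < dim_row B" "j < dim_col B"
  then have ij: "i < n" "j < n" using B by auto
  have entry: "C $$ (i, j) = unit_vec n i \<bullet> (C *\<^sub>v unit_vec n j)" if "C \<in> carrier_mat n n" for C :: "real mat"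
    using that ij mat_mult_unit_vec[OF that, of j] by simp
  show "A $$ (i, j) = B $$ (i, j)"
    using eq[of "unit_vec n i" "unit_vec n j"] by (simp add: entry A B)
qed (use A B in auto)

text \<open>Test the resolvent identity of one ordering against the resolvent of the other, and vice
  versa. The two sums over rows coincide, so the two symmetric forms agree.\<close>

lemma ridge_perm:
  assumes l: "l > 0" and xs: "set xs \<subseteq> carrier_vec n" and eq: "mset xs = mset ys"
  shows "ridge n l xs = ridge n l ys"
proof (rule mat_eqI_bilinear)
  fix u v :: "real vec" assume uv: "u \<in> carrier_vec n" "v \<in> carrier_vec n"
  have ys: "set ys \<subseteq> carrier_vec n" using xs eq by (metis set_mset_mset)
  define a where "a = ridge n l xs *\<^sub>v v"
  define b where "b = ridge n l ys *\<^sub>v u"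
  have ab: "a \<in> carrier_vec n" "b \<in> carrier_vec n" by (simp_all add: a_def b_def)
  have "l * (b \<bullet> a) + (\<Sum>x\<leftarrow>xs. (x \<bullet> a) * (x \<bullet> b)) = l * (b \<bullet> v)"
    using ridge_resolvent(1)[OF l xs ab(2) uv(2)] by (simp add: a_def)
  moreover have "l * (a \<bullet> b) + (\<Sum>x\<leftarrow>ys. (x \<bullet> b) * (x \<bullet> a)) = l * (a \<bullet> u)"
    using ridge_resolvent(1)[OF l ys ab(1) uv(1)] by (simp add: b_def)
  moreover have "(\<Sum>x\<leftarrow>xs. (x \<bullet> a) * (x \<bullet> b)) = (\<Sum>x\<leftarrow>ys. (x \<bullet> b) * (x \<bullet> a))"
    using arg_cong[OF eq, of "\<lambda>m. sum_mset (image_mset (\<lambda>x. (x \<bullet> a) * (x \<bullet> b)) m)"]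
    by (simp add: mult.commute flip: sum_mset_sum_list mset_map)
  ultimately have "b \<bullet> v = a \<bullet> u"
    using comm_scalar_prod[OF ab] l by simp
  then have "u \<bullet> a = v \<bullet> b"
    using comm_scalar_prod[OF ab(1) uv(1)] comm_scalar_prod[OF ab(2) uv(2)] by simp
  then show "u \<bullet> (ridge n l xs *\<^sub>v v) = u \<bullet> (ridge n l ys *\<^sub>v v)"
    using ridge_scalar_prod_commute[OF uv] by (simp add: a_def b_def)
qed auto

text \<open>With w the resolvent of v, |w|^2 <= v.w and Cauchy-Schwarz give (v.w)^2 <= |v|^2 (v.w).
  Altogether this is 0 <= R^2 <= R <= I in the Loewner order, in terms of vectors.\<close>

lemma ridge_quadratic_le:
  assumes "l > 0" "set xs \<subseteq> carrier_vec n" "v \<in> carrier_vec n"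
  shows "v \<bullet> (ridge n l xs *\<^sub>v v) \<le> v \<bullet> v" "0 \<le> v \<bullet> (ridge n l xs *\<^sub>v v)"
    "(ridge n l xs *\<^sub>v v) \<bullet> (ridge n l xs *\<^sub>v v) \<le> v \<bullet> v"
proof -
  define w where "w = ridge n l xs *\<^sub>v v"
  have w: "w \<in> carrier_vec n" by (simp add: w_def)
  have ww: "w \<bullet> w \<le> v \<bullet> w"
    using ridge_resolvent(2)[OF assms(1,2,3,3)] by (simp add: w_def)
  then have pos: "0 \<le> v \<bullet> w" using scalar_prod_self_nonneg[of w] by linarith
  have "(v \<bullet> w) * (v \<bullet> w) \<le> (v \<bullet> v) * (w \<bullet> w)"
    using scalar_prod_Cauchy_Schwarz[OF assms(3) w] by (simp add: power2_eq_square)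
  also have "\<dots> \<le> (v \<bullet> v) * (v \<bullet> w)"
    using ww scalar_prod_self_nonneg[of v] by (intro mult_left_mono)
  finally have le: "v \<bullet> w \<le> v \<bullet> v"
    using pos scalar_prod_self_nonneg[of v] by (cases "v \<bullet> w = 0") auto
  show "v \<bullet> (ridge n l xs *\<^sub>v v) \<le> v \<bullet> v" "0 \<le> v \<bullet> (ridge n l xs *\<^sub>v v)"
    "(ridge n l xs *\<^sub>v v) \<bullet> (ridge n l xs *\<^sub>v v) \<le> v \<bullet> v"
    using pos ww le by (auto simp: w_def)
qed

subsection \<open>Leave-one-out identities\<close>

text \<open>Indexing by a finite set makes leaving out row i the set difference
  \<open>I - {i}\<close>. The sorted order is an arbitrary choice, harmless by
  \<open>ridge_perm\<close>.\<close>

definition ridge_on :: "nat \<Rightarrow> real \<Rightarrow> (nat \<Rightarrow> real vec) \<Rightarrow> nat set \<Rightarrow> real mat" where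
  "ridge_on n l x I = ridge n l (map x (sorted_list_of_set I))"

lemma ridge_on_carrier [simp]: "ridge_on n l x I \<in> carrier_mat n n"
  by (simp add: ridge_on_def)

lemma ridge_on_mult_carrier [simp]: "ridge_on n l x I *\<^sub>v v \<in> carrier_vec n"
  by (simp add: ridge_on_def)

lemma ridge_on_dim [simp]: "dim_row (ridge_on n l x I) = n" "dim_col (ridge_on n l x I) = n"
  by (auto simp: ridge_on_def)

lemma ridge_on_commute:
  assumes "u \<in> carrier_vec n" "v \<in> carrier_vec n"
  shows "u \<bullet> (ridge_on n l x I *\<^sub>v v) = v \<bullet> (ridge_on n l x I *\<^sub>v u)"
  using ridge_scalar_prod_commute[OF assms] by (simp add: ridge_on_def)

lemma ridge_on_cong:
  assumes "finite I" "\<And>i. i \<in> I \<Longrightarrow> x i = x' i"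
  shows "ridge_on n l x I = ridge_on n l x' I"
  unfolding ridge_on_def using assms by (metis map_cong set_sorted_list_of_set)

locale ridge_family =
  fixes n :: nat and l :: real and x :: "nat \<Rightarrow> real vec" and I :: "nat set"
  assumes l: "l > 0" and I: "finite I" and x: "\<And>i. i \<in> I \<Longrightarrow> x i \<in> carrier_vec n"
begin

lemma rows_subset: "J \<subseteq> I \<Longrightarrow> set (map x (sorted_list_of_set J)) \<subseteq> carrier_vec n"
  using x I by (auto simp: finite_subset)

lemma ridge_on_resolvent:
  assumes "u \<in> carrier_vec n" "v \<in> carrier_vec n"
  shows "l * (u \<bullet> (ridge_on n l x I *\<^sub>v v)) + (\<Sum>i\<in>I. (x i \<bullet> (ridge_on n l x I *\<^sub>v v)) * (x i \<bullet> u)) = l * (u \<bullet> v)"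
proof -
  have "(\<Sum>y\<leftarrow>map x (sorted_list_of_set I). (y \<bullet> (ridge_on n l x I *\<^sub>v v)) * (y \<bullet> u))
    = (\<Sum>i\<in>I. (x i \<bullet> (ridge_on n l x I *\<^sub>v v)) * (x i \<bullet> u))"
    using I by (simp add: o_def sum_list_distinct_conv_sum_set)
  then show ?thesis
    using ridge_resolvent(1)[OF l rows_subset assms, of I] by (simp add: ridge_on_def)
qed

lemma ridge_on_quadratic:
  assumes "J \<subseteq> I" "v \<in> carrier_vec n"
  shows "v \<bullet> (ridge_on n l x J *\<^sub>v v) \<le> v \<bullet> v" "0 \<le> v \<bullet> (ridge_on n l x J *\<^sub>v v)"
    "(ridge_on n l x J *\<^sub>v v) \<bullet> (ridge_on n l x J *\<^sub>v v) \<le> v \<bullet> v"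
    "(ridge_on n l x J *\<^sub>v v) \<bullet> (ridge_on n l x J *\<^sub>v v) \<le> v \<bullet> (ridge_on n l x J *\<^sub>v v)"
  using ridge_quadratic_le[OF l rows_subset[OF assms(1)] assms(2)]
    ridge_resolvent(2)[OF l rows_subset[OF assms(1)] assms(2,2)]
  by (simp_all add: ridge_on_def)

context
  fixes i assumes i: "i \<in> I"
begin

abbreviation (input) "Q \<equiv> ridge_on n l x (I - {i})"
abbreviation (input) "q \<equiv> l + x i \<bullet> (Q *\<^sub>v x i)"

lemma leave_one_out_pos: "q \<ge> l" "q > 0"
  using ridge_on_quadratic(2)[of "I - {i}" "x i"] x[OF i] l by auto

text \<open>Permutation invariance moves row i to the head of the list, where the recursion is the
  rank-one update formula.\<close>

lemma ridge_on_insert: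
  assumes v: "v \<in> carrier_vec n"
  shows "ridge_on n l x I *\<^sub>v v = Q *\<^sub>v v - ((x i \<bullet> (Q *\<^sub>v v)) / q) \<cdot>\<^sub>v (Q *\<^sub>v x i)"
proof -
  have "mset (map x (sorted_list_of_set I)) = mset (x i # map x (sorted_list_of_set (I - {i})))"
    using i I by (simp add: mset_set.remove[of I i] sorted_list_of_mset_set[symmetric] del: sorted_list_of_mset_set)
  then have "ridge_on n l x I = ridge n l (x i # map x (sorted_list_of_set (I - {i})))"
    unfolding ridge_on_def using ridge_perm[OF l rows_subset] by blast
  then have "ridge_on n l x I *\<^sub>v v = Q *\<^sub>v v - (((Q *\<^sub>v x i) \<bullet> v) / q) \<cdot>\<^sub>v (Q *\<^sub>v x i)"
    using ridge_Cons_mult_vec[OF v, of l "x i"] by (simp add: ridge_on_def del: ridge.simps)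
  moreover have "(Q *\<^sub>v x i) \<bullet> v = x i \<bullet> (Q *\<^sub>v v)"
    using ridge_on_commute[OF x[OF i] v] comm_scalar_prod[of "Q *\<^sub>v x i" n v] v by simp
  ultimately show ?thesis by simp
qed

lemma ridge_on_diff:
  assumes u: "u \<in> carrier_vec n" and v: "v \<in> carrier_vec n"
  shows "u \<bullet> (Q *\<^sub>v v) - u \<bullet> (ridge_on n l x I *\<^sub>v v) = ((Q *\<^sub>v u) \<bullet> x i) * (x i \<bullet> (Q *\<^sub>v v)) / q"
proof -
  have "u \<bullet> (Q *\<^sub>v x i) = (Q *\<^sub>v u) \<bullet> x i"
    using ridge_on_commute[OF u x[OF i]] comm_scalar_prod[of "Q *\<^sub>v u" n "x i"] x[OF i] by simp
  then show ?thesis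
    unfolding ridge_on_insert[OF v] using u x[OF i]
    by (simp add: scalar_prod_minus_distrib[of _ n])
qed

text \<open>The rank-one update multiplies the form by 1 - (x.Qx) / q = l / q. This factor l later
  cancels against the l in the resolvent identity.\<close>

lemma ridge_on_row:
  assumes v: "v \<in> carrier_vec n"
  shows "x i \<bullet> (ridge_on n l x I *\<^sub>v v) = l * (x i \<bullet> (Q *\<^sub>v v)) / q"
proof -
  have "x i \<bullet> (ridge_on n l x I *\<^sub>v v) = x i \<bullet> (Q *\<^sub>v v) - (x i \<bullet> (Q *\<^sub>v v)) / q * (x i \<bullet> (Q *\<^sub>v x i))"
    unfolding ridge_on_insert[OF v] using x[OF i]
    by (simp add: scalar_prod_minus_distrib[of _ n])
  then show ?thesis using leave_one_out_pos(2) by (simp add: field_simps)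
qed

end

text \<open>Insert \<open>ridge_on_row\<close> into the resolvent identity and divide by l. In the
  resulting sum the row \<open>x i\<close> meets only a resolvent that does not contain it, so the
  dependence sits in the scalar denominator alone.\<close>

lemma ridge_on_expansion:
  assumes u: "u \<in> carrier_vec n" and v: "v \<in> carrier_vec n"
  shows "u \<bullet> v - u \<bullet> (ridge_on n l x I *\<^sub>v v)
    = (\<Sum>i\<in>I. (u \<bullet> x i) * (x i \<bullet> (ridge_on n l x (I - {i}) *\<^sub>v v)) / (l + x i \<bullet> (ridge_on n l x (I - {i}) *\<^sub>v x i)))"
    (is "_ = ?S")
proof -
  have "(\<Sum>i\<in>I. (x i \<bullet> (ridge_on n l x I *\<^sub>v v)) * (x i \<bullet> u)) = l * ?S"
    unfolding sum_distrib_left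
    by (intro sum.cong refl) (simp add: ridge_on_row[OF _ v] comm_scalar_prod[OF x u] mult_ac)
  then have "l * ?S = l * (u \<bullet> v - u \<bullet> (ridge_on n l x I *\<^sub>v v))"
    using ridge_on_resolvent[OF u v] by (simp add: algebra_simps)
  then show ?thesis using l by simp
qed

end

section \<open>Traces of the resolvent against the covariance\<close>

lemma mat_trace_conj:
  fixes A Q :: "real mat"
  assumes A: "A \<in> carrier_mat n n" "A\<^sup>T = A" and Q: "Q \<in> carrier_mat n n"
  shows "mat_trace (A * Q * A) = (\<Sum>j<n. col A j \<bullet> (Q *\<^sub>v col A j))"
proof -
  have "mat_trace (A * Q * A) = (\<Sum>j<n. (A * (Q * A)) $$ (j, j))"
    using A Q by (simp add: mat_trace_def assoc_mult_mat[of _ n n _ n _ n])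
  also have "\<dots> = (\<Sum>j<n. row A j \<bullet> (Q *\<^sub>v col A j))"
    using A Q by (intro sum.cong refl) (simp add: mult_carrier_mat[of _ n n])
  also have "\<dots> = (\<Sum>j<n. col A j \<bullet> (Q *\<^sub>v col A j))"
    using A by (intro sum.cong refl) (metis carrier_matD(1) lessThan_iff row_transpose carrier_matD(2))
  finally show ?thesis .
qed

lemma frobenius_norm_cols:
  fixes B :: "real mat"
  assumes "B \<in> carrier_mat m n"
  shows "(frobenius_norm B)\<^sup>2 = (\<Sum>j<n. col B j \<bullet> col B j)"
proof -
  have "(frobenius_norm B)\<^sup>2 = (\<Sum>i<m. \<Sum>j<n. (B $$ (i, j))\<^sup>2)"
    using assms unfolding frobenius_norm_def by (simp add: sum_nonneg)
  also have "\<dots> = (\<Sum>j<n. \<Sum>i<m. (B $$ (i, j))\<^sup>2)"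
    by (rule sum.swap)
  finally show ?thesis
    using assms by (simp add: scalar_prod_def power2_eq_square lessThan_atLeast0)
qed

text \<open>\<open>A\<close> stands for the square root of the covariance scaled to norm at most 1.
  Writing \<open>A * R * A\<close> for tr (\<Sigma> R) keeps the matrix symmetric and expresses its
  trace as a sum of quadratic forms at the columns of \<open>A\<close>.\<close>

locale ridge_trace = ridge_family +
  fixes A :: "real mat"
  assumes A: "A \<in> carrier_mat n n" "A\<^sup>T = A"
    and contr: "\<And>w. w \<in> carrier_vec n \<Longrightarrow> (A *\<^sub>v w) \<bullet> (A *\<^sub>v w) \<le> w \<bullet> w"
begin

lemma col_carrier [simp]: "j < n \<Longrightarrow> col A j \<in> carrier_vec n"
  using A by auto

text \<open>The difference is |Ay|^2 / q with y = Q x_i, and |Ay|^2 <= |y|^2 <= x_i.y <= q. The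
  denominator grows with the row, so the bound 1 holds for rows of any length.\<close>

lemma ridge_trace_diff:
  assumes i: "i \<in> I"
  shows "mat_trace (A * ridge_on n l x (I - {i}) * A) - mat_trace (A * ridge_on n l x I * A) \<in> {0..1}"
proof -
  let ?Q = "ridge_on n l x (I - {i})"
  define y where "y = ?Q *\<^sub>v x i"
  define q where "q = l + x i \<bullet> y"
  have q: "q > 0" using leave_one_out_pos(2)[OF i] by (simp add: q_def y_def)
  have y: "y \<in> carrier_vec n" by (simp add: y_def)
  have eq: "col A j \<bullet> (?Q *\<^sub>v col A j) - col A j \<bullet> (ridge_on n l x I *\<^sub>v col A j) = ((A *\<^sub>v y) $ j * (A *\<^sub>v y) $ j) / q"
    if j: "j < n" for j
  proof -
    have "x i \<bullet> (?Q *\<^sub>v col A j) = col A j \<bullet> y"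
      using ridge_on_commute[of "x i" n "col A j"] x[OF i] j by (simp add: y_def)
    moreover have "(?Q *\<^sub>v col A j) \<bullet> x i = x i \<bullet> (?Q *\<^sub>v col A j)"
      by (rule comm_scalar_prod[OF ridge_on_mult_carrier x[OF i]])
    moreover have "(A *\<^sub>v y) $ j = col A j \<bullet> y"
      using A j by (metis carrier_matD index_mult_mat_vec row_transpose)
    ultimately show ?thesis
      using ridge_on_diff[OF i, of "col A j" "col A j"] j by (simp add: q_def y_def)
  qed
  have "mat_trace (A * ?Q * A) - mat_trace (A * ridge_on n l x I * A) = (\<Sum>j<n. ((A *\<^sub>v y) $ j * (A *\<^sub>v y) $ j) / q)"
    by (simp add: mat_trace_conj[OF A] eq flip: sum_subtractf)
  also have "\<dots> = ((A *\<^sub>v y) \<bullet> (A *\<^sub>v y)) / q"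
    using A(1) by (simp add: scalar_prod_def lessThan_atLeast0 sum_divide_distrib)
  finally have d: "mat_trace (A * ?Q * A) - mat_trace (A * ridge_on n l x I * A) = ((A *\<^sub>v y) \<bullet> (A *\<^sub>v y)) / q" .
  have "(A *\<^sub>v y) \<bullet> (A *\<^sub>v y) \<le> y \<bullet> y" by (rule contr[OF y])
  also have "\<dots> \<le> x i \<bullet> y"
    using ridge_on_quadratic(4)[of "I - {i}" "x i"] x[OF i] by (auto simp: y_def)
  also have "\<dots> \<le> q" using l by (simp add: q_def)
  finally show ?thesis
    unfolding d using q scalar_prod_self_nonneg[of "A *\<^sub>v y"] by simp
qed

text \<open>\<open>A\<close> is a contraction and Q^2 <= Q, so the squared Frobenius norm is bounded
  by a trace. It is therefore of order k, and fluctuations of quadratic forms are of order sqrt k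
  against a mean of order k.\<close>

lemma frobenius_norm_ridge_conj:
  assumes J: "J \<subseteq> I"
  shows "(frobenius_norm (A * ridge_on n l x J * A))\<^sup>2 \<le> mat_trace (A * ridge_on n l x J * A)"
proof -
  let ?Q = "ridge_on n l x J"
  have "(frobenius_norm (A * ?Q * A))\<^sup>2 = (\<Sum>j<n. (A *\<^sub>v (?Q *\<^sub>v col A j)) \<bullet> (A *\<^sub>v (?Q *\<^sub>v col A j)))"
  proof (subst frobenius_norm_cols[of _ n n])
    show "A * ?Q * A \<in> carrier_mat n n" using A by (simp add: mult_carrier_mat[of _ n n])
    have "col (A * ?Q * A) j = A *\<^sub>v (?Q *\<^sub>v col A j)" if "j < n" for j
      using A that by (simp add: assoc_mult_mat[of _ n n _ n _ n] mult_carrier_mat[of _ n n]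
          col_mult2[of _ n n _ n])
    then show "(\<Sum>j<n. col (A * ?Q * A) j \<bullet> col (A * ?Q * A) j)
      = (\<Sum>j<n. (A *\<^sub>v (?Q *\<^sub>v col A j)) \<bullet> (A *\<^sub>v (?Q *\<^sub>v col A j)))"
      by simp
  qed
  also have "\<dots> \<le> (\<Sum>j<n. col A j \<bullet> (?Q *\<^sub>v col A j))"
    using contr ridge_on_quadratic(4)[OF J] by (intro sum_mono) (meson col_carrier lessThan_iff order_trans ridge_on_mult_carrier)
  also have "\<dots> = mat_trace (A * ?Q * A)"
    by (simp add: mat_trace_conj[OF A])
  finally show ?thesis .
qed

lemma ridge_trace_le:
  assumes J: "J \<subseteq> I"
  shows "mat_trace (A * ridge_on n l x J * A) \<le> mat_trace (A * A)"
    and "0 \<le> mat_trace (A * ridge_on n l x J * A)"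
proof -
  have "mat_trace (A * A) = (\<Sum>j<n. col A j \<bullet> (1\<^sub>m n *\<^sub>v col A j))"
    using mat_trace_conj[OF A, of "1\<^sub>m n"] A by simp
  then show "mat_trace (A * ridge_on n l x J * A) \<le> mat_trace (A * A)"
    using ridge_on_quadratic(1)[OF J] by (simp add: mat_trace_conj[OF A]) (intro sum_mono, simp)
  show "0 \<le> mat_trace (A * ridge_on n l x J * A)"
    using ridge_on_quadratic(2)[OF J] by (simp add: mat_trace_conj[OF A]) (intro sum_nonneg, simp)
qed

end

text \<open>Without rows the resolvent is the identity, and each added row lowers the trace by at
  most 1.\<close>

lemma ridge_trace_ge:
  assumes "ridge_trace n l x I A"
  shows "mat_trace (A * ridge_on n l x I * A) \<ge> mat_trace (A * A) - real (card I)"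
proof -
  interpret ridge_trace n l x I A by fact
  show ?thesis using I assms
  proof (induction I rule: finite_induct)
    case empty
    then show ?case using A by (simp add: ridge_on_def)
  next
    case (insert i I)
    interpret J: ridge_trace n l x "insert i I" A by fact
    have "ridge_trace n l x I A"
      using J.ridge_trace_axioms unfolding ridge_trace_def ridge_family_def by auto
    then have "mat_trace (A * ridge_on n l x I * A) \<ge> mat_trace (A * A) - real (card I)"
      using insert by simp
    moreover have "insert i I - {i} = I" using insert by auto
    ultimately show ?case
      using J.ridge_trace_diff[of i] insert by auto
  qed
qed

section \<open>Entrywise measurability of random vectors and matrices\<close>

definition vec_measurable :: "'a measure \<Rightarrow> nat \<Rightarrow> ('a \<Rightarrow> real vec) \<Rightarrow> bool" where
  "vec_measurable M n f \<longleftrightarrow> (\<forall>\<omega>. f \<omega> \<in> carrier_vec n) \<and> (\<forall>i<n. (\<lambda>\<omega>. f \<omega> $ i) \<in> borel_measurable M)"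

text \<open>Dimensions are required at every point, not just on the space of \<open>M\<close>, so
  that index computations can be rewritten as equalities of functions.\<close>

definition mat_measurable :: "'a measure \<Rightarrow> nat \<Rightarrow> nat \<Rightarrow> ('a \<Rightarrow> real mat) \<Rightarrow> bool" where
  "mat_measurable M m n F \<longleftrightarrow> (\<forall>\<omega>. F \<omega> \<in> carrier_mat m n) \<and>
     (\<forall>i<m. \<forall>j<n. (\<lambda>\<omega>. F \<omega> $$ (i, j)) \<in> borel_measurable M)"

lemma vec_measurable_const: "v \<in> carrier_vec n \<Longrightarrow> vec_measurable M n (\<lambda>_. v)"
  by (simp add: vec_measurable_def)

lemma mat_measurable_const: "A \<in> carrier_mat m n \<Longrightarrow> mat_measurable M m n (\<lambda>_. A)"
  by (simp add: mat_measurable_def)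

lemma borel_measurable_scalar_prod:
  assumes "vec_measurable M n f" "vec_measurable M n g"
  shows "(\<lambda>\<omega>. f \<omega> \<bullet> g \<omega>) \<in> borel_measurable M"
proof -
  have "dim_vec (g \<omega>) = n" for \<omega>
    using assms(2) by (auto simp: vec_measurable_def)
  then have "(\<lambda>\<omega>. f \<omega> \<bullet> g \<omega>) = (\<lambda>\<omega>. \<Sum>i=0..<n. f \<omega> $ i * g \<omega> $ i)"
    by (simp add: scalar_prod_def)
  moreover have "(\<lambda>\<omega>. f \<omega> $ i * g \<omega> $ i) \<in> borel_measurable M" if "i < n" for i
    using assms that by (intro borel_measurable_times) (auto simp: vec_measurable_def)
  then have "(\<lambda>\<omega>. \<Sum>i=0..<n. f \<omega> $ i * g \<omega> $ i) \<in> borel_measurable M"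
    by (intro borel_measurable_sum) simp
  ultimately show ?thesis by simp
qed

lemma vec_measurable_row:
  assumes F: "mat_measurable M m n F" and i: "i < m"
  shows "vec_measurable M n (\<lambda>\<omega>. row (F \<omega>) i)"
proof -
  have "F \<omega> \<in> carrier_mat m n" for \<omega> using F by (simp add: mat_measurable_def)
  then have d: "dim_row (F \<omega>) = m" "dim_col (F \<omega>) = n" for \<omega> by blast+
  then have "row (F \<omega>) i \<in> carrier_vec n" for \<omega> by (simp add: carrier_vecI)
  moreover have "(\<lambda>\<omega>. F \<omega> $$ (i, j)) \<in> borel_measurable M" if "j < n" for j
    using F i that by (simp add: mat_measurable_def)
  ultimately show ?thesis using i by (simp add: vec_measurable_def d)
qed

lemma vec_measurable_col:
  assumes F: "mat_measurable M m n F" and j: "j < n"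
  shows "vec_measurable M m (\<lambda>\<omega>. col (F \<omega>) j)"
proof -
  have "F \<omega> \<in> carrier_mat m n" for \<omega> using F by (simp add: mat_measurable_def)
  then have d: "dim_row (F \<omega>) = m" "dim_col (F \<omega>) = n" for \<omega> by blast+
  then have "col (F \<omega>) j \<in> carrier_vec m" for \<omega> by (simp add: carrier_vecI)
  moreover have "(\<lambda>\<omega>. F \<omega> $$ (i, j)) \<in> borel_measurable M" if "i < m" for i
    using F j that by (simp add: mat_measurable_def)
  ultimately show ?thesis using j by (simp add: vec_measurable_def d)
qed

lemma vec_measurable_mult_mat_vec:
  assumes F: "mat_measurable M m n F" and f: "vec_measurable M n f"
  shows "vec_measurable M m (\<lambda>\<omega>. F \<omega> *\<^sub>v f \<omega>)"
  unfolding vec_measurable_def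
proof (intro conjI allI impI)
  show "F \<omega> *\<^sub>v f \<omega> \<in> carrier_vec m" for \<omega>
    using assms by (auto simp: vec_measurable_def mat_measurable_def intro: mult_mat_vec_carrier)
  fix i assume i: "i < m"
  have "vec_measurable M n (\<lambda>\<omega>. row (F \<omega>) i)"
    by (rule vec_measurable_row[OF F i])
  then have "(\<lambda>\<omega>. row (F \<omega>) i \<bullet> f \<omega>) \<in> borel_measurable M"
    by (rule borel_measurable_scalar_prod[OF _ f])
  moreover have "dim_row (F \<omega>) = m" for \<omega>
    using F by (auto simp: mat_measurable_def)
  then have "(\<lambda>\<omega>. (F \<omega> *\<^sub>v f \<omega>) $ i) = (\<lambda>\<omega>. row (F \<omega>) i \<bullet> f \<omega>)"
    using i by simp
  ultimately show "(\<lambda>\<omega>. (F \<omega> *\<^sub>v f \<omega>) $ i) \<in> borel_measurable M" by simp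
qed

lemma mat_measurable_mult:
  assumes F: "mat_measurable M m n F" and G: "mat_measurable M n p G"
  shows "mat_measurable M m p (\<lambda>\<omega>. F \<omega> * G \<omega>)"
  unfolding mat_measurable_def
proof (intro conjI allI impI)
  show "F \<omega> * G \<omega> \<in> carrier_mat m p" for \<omega>
    using assms by (auto simp: mat_measurable_def intro: mult_carrier_mat)
  fix i j assume i: "i < m" and j: "j < p"
  have "vec_measurable M n (\<lambda>\<omega>. row (F \<omega>) i)" "vec_measurable M n (\<lambda>\<omega>. col (G \<omega>) j)"
    by (rule vec_measurable_row[OF F i], rule vec_measurable_col[OF G j])
  then have "(\<lambda>\<omega>. row (F \<omega>) i \<bullet> col (G \<omega>) j) \<in> borel_measurable M"
    by (rule borel_measurable_scalar_prod)
  moreover have "dim_row (F \<omega>) = m" "dim_col (G \<omega>) = p" for \<omega>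
    using F G by (auto simp: mat_measurable_def)
  then have "(\<lambda>\<omega>. (F \<omega> * G \<omega>) $$ (i, j)) = (\<lambda>\<omega>. row (F \<omega>) i \<bullet> col (G \<omega>) j)"
    using i j by simp
  ultimately show "(\<lambda>\<omega>. (F \<omega> * G \<omega>) $$ (i, j)) \<in> borel_measurable M" by simp
qed

lemma borel_measurable_mat_trace:
  assumes "mat_measurable M n n F"
  shows "(\<lambda>\<omega>. mat_trace (F \<omega>)) \<in> borel_measurable M"
proof -
  have "dim_row (F \<omega>) = n" for \<omega>
    using assms by (auto simp: mat_measurable_def)
  then have "(\<lambda>\<omega>. mat_trace (F \<omega>)) = (\<lambda>\<omega>. \<Sum>i<n. F \<omega> $$ (i, i))"
    by (simp add: mat_trace_def)
  then show ?thesis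
    using assms by (auto simp: mat_measurable_def intro!: borel_measurable_sum)
qed

lemma mat_measurable_ridge:
  assumes "\<And>g. g \<in> set gs \<Longrightarrow> vec_measurable M n g"
  shows "mat_measurable M n n (\<lambda>\<omega>. ridge n l (map (\<lambda>g. g \<omega>) gs))"
  using assms
proof (induction gs)
  case Nil
  then show ?case by (simp add: mat_measurable_def)
next
  case (Cons g gs)
  define Q where "Q \<omega> = ridge n l (map (\<lambda>g. g \<omega>) gs)" for \<omega>
  have Q: "mat_measurable M n n Q" unfolding Q_def using Cons by simp
  have g: "vec_measurable M n g" using Cons by auto
  have Qg: "vec_measurable M n (\<lambda>\<omega>. Q \<omega> *\<^sub>v g \<omega>)"
    by (rule vec_measurable_mult_mat_vec[OF Q g])
  have q: "(\<lambda>\<omega>. g \<omega> \<bullet> (Q \<omega> *\<^sub>v g \<omega>)) \<in> borel_measurable M"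
    by (rule borel_measurable_scalar_prod[OF g Qg])
  have "(\<lambda>\<omega>. Q \<omega> $$ (i, j) - (Q \<omega> *\<^sub>v g \<omega>) $ i * (Q \<omega> *\<^sub>v g \<omega>) $ j / (l + g \<omega> \<bullet> (Q \<omega> *\<^sub>v g \<omega>)))
      \<in> borel_measurable M" if "i < n" "j < n" for i j
    using Q Qg q that unfolding mat_measurable_def vec_measurable_def
    by (intro borel_measurable_diff borel_measurable_divide borel_measurable_times borel_measurable_add
        borel_measurable_const) auto
  then show ?case
    by (auto simp: mat_measurable_def simp flip: Q_def simp del: index_mult_mat_vec)
qed

lemma mat_measurable_ridge_on:
  assumes "finite I" "\<And>i. i \<in> I \<Longrightarrow> vec_measurable M n (\<lambda>\<omega>. x \<omega> i)"
  shows "mat_measurable M n n (\<lambda>\<omega>. ridge_on n l (x \<omega>) I)"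
  using mat_measurable_ridge[of "map (\<lambda>i \<omega>. x \<omega> i) (sorted_list_of_set I)" M n l] assms
  by (auto simp: ridge_on_def o_def)

subsection \<open>Product measures, variance and tail bounds\<close>

text \<open>Tonelli with coordinate i innermost: a conditional bound that is uniform in the other
  coordinates is a bound for the whole integral, and finiteness yields integrability.\<close>

lemma PiM_integral_coordinate_le:
  fixes D :: "'b measure" and I :: "'i set" and g :: "('i \<Rightarrow> 'b) \<Rightarrow> real"
  assumes D: "prob_space D" and I: "finite I" "i \<in> I"
    and g: "g \<in> borel_measurable (PiM I (\<lambda>_. D))" and nn: "\<And>\<omega>. g \<omega> \<ge> 0"
    and int: "\<And>w. w \<in> space (PiM I (\<lambda>_. D)) \<Longrightarrow> integrable D (\<lambda>y. g (w(i := y)))"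
    and le: "\<And>w. w \<in> space (PiM I (\<lambda>_. D)) \<Longrightarrow> (\<integral>y. g (w(i := y)) \<partial>D) \<le> b"
  shows "integrable (PiM I (\<lambda>_. D)) g" and "(\<integral>\<omega>. g \<omega> \<partial>PiM I (\<lambda>_. D)) \<le> b"
proof -
  interpret D: prob_space D by fact
  interpret product_prob_space "\<lambda>_::'i. D" I
    by unfold_locales
  let ?J = "I - {i}"
  interpret J: prob_space "PiM ?J (\<lambda>_. D)"
    by (intro prob_space_PiM D)
  have ins: "insert i ?J = I" using I by auto
  \<comment> \<open>An arbitrary filler for coordinate i: the hypotheses speak of points of the full
    product, and the filler is overwritten at once.\<close>
  obtain y0 where y0: "y0 \<in> space D" using D.not_empty by blast
  have b: "b \<ge> 0"
  proof -
    obtain \<omega> where "\<omega> \<in> space (PiM I (\<lambda>_. D))"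
      using prob_space.not_empty[OF prob_space_PiM[of I "\<lambda>_. D", OF D]] by blast
    then show ?thesis using le[of \<omega>] nn by (meson Bochner_Integration.integral_nonneg order_trans)
  qed
  have inner: "(\<integral>\<^sup>+ y. ennreal (g (x(i := y))) \<partial>D) \<le> ennreal b" if x: "x \<in> space (PiM ?J (\<lambda>_. D))" for x
  proof -
    have "x(i := y0) \<in> space (PiM I (\<lambda>_. D))"
      using x y0 I by (auto simp: space_PiM PiE_def extensional_def)
    from int[OF this] le[OF this] show ?thesis
      using nn by (simp add: nn_integral_eq_integral ennreal_leI)
  qed
  have "(\<integral>\<^sup>+ \<omega>. ennreal (g \<omega>) \<partial>PiM (insert i ?J) (\<lambda>_. D))
      = (\<integral>\<^sup>+ x. (\<integral>\<^sup>+ y. ennreal (g (x(i := y))) \<partial>D) \<partial>PiM ?J (\<lambda>_. D))"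
    using I(1) g by (intro product_nn_integral_insert) (auto simp only: ins finite_Diff measurable_compose[OF g measurable_ennreal])
  also have "\<dots> \<le> (\<integral>\<^sup>+ x. ennreal b \<partial>PiM ?J (\<lambda>_. D))"
    by (intro nn_integral_mono inner)
  also have "\<dots> = ennreal b"
    by (simp add: J.emeasure_space_1)
  finally have le': "(\<integral>\<^sup>+ \<omega>. ennreal (g \<omega>) \<partial>PiM I (\<lambda>_. D)) \<le> ennreal b"
    by (simp only: ins)
  then show i: "integrable (PiM I (\<lambda>_. D)) g"
    using g nn by (intro integrableI_nonneg) (auto simp: le_less_trans)
  show "(\<integral>\<omega>. g \<omega> \<partial>PiM I (\<lambda>_. D)) \<le> b"
    using le' nn b by (simp add: nn_integral_eq_integral[OF i])
qed

text \<open>Fubini counterpart: functions with equal conditional means given the other coordinates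
  have equal means.\<close>

lemma PiM_integral_coordinate_eq:
  fixes D :: "'b measure" and I :: "'i set" and f g :: "('i \<Rightarrow> 'b) \<Rightarrow> real"
  assumes D: "prob_space D" and I: "finite I" "i \<in> I"
    and f: "integrable (PiM I (\<lambda>_. D)) f" and g: "integrable (PiM I (\<lambda>_. D)) g"
    and eq: "\<And>w. w \<in> space (PiM I (\<lambda>_. D)) \<Longrightarrow> (\<integral>y. f (w(i := y)) \<partial>D) = (\<integral>y. g (w(i := y)) \<partial>D)"
  shows "(\<integral>w. f w \<partial>PiM I (\<lambda>_. D)) = (\<integral>w. g w \<partial>PiM I (\<lambda>_. D))"
proof -
  interpret D: prob_space D by fact
  interpret product_prob_space "\<lambda>_::'i. D" I
    by unfold_locales
  let ?J = "I - {i}"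
  have ins: "insert i ?J = I" using I by auto
  obtain y0 where y0: "y0 \<in> space D" using D.not_empty by blast
  have fub: "(\<integral>w. h w \<partial>PiM I (\<lambda>_. D)) = (\<integral>x. (\<integral>y. h (x(i := y)) \<partial>D) \<partial>PiM ?J (\<lambda>_. D))"
    if "integrable (PiM I (\<lambda>_. D)) h" for h :: "('i \<Rightarrow> 'b) \<Rightarrow> real"
    using product_integral_insert[of ?J i h] that I(1) unfolding ins by simp
  have "(\<integral>y. f (x(i := y)) \<partial>D) = (\<integral>y. g (x(i := y)) \<partial>D)" if x: "x \<in> space (PiM ?J (\<lambda>_. D))" for x
  proof -
    have "x(i := y0) \<in> space (PiM I (\<lambda>_. D))"
      using x y0 I by (auto simp: space_PiM PiE_def extensional_def)
    from eq[OF this] show ?thesis by (simp only: fun_upd_upd)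
  qed
  then show ?thesis
    unfolding fub[OF f] fub[OF g] by (rule Bochner_Integration.integral_cong[OF refl])
qed

lemma norm_power2_le:
  fixes x B :: real
  assumes "\<bar>x\<bar> \<le> B"
  shows "norm (x\<^sup>2) \<le> B\<^sup>2"
  using power_mono[OF assms, of 2] by simp

text \<open>The Efron--Stein inequality for functions with bounded differences, by integrating out one
  coordinate at a time.\<close>

lemma bounded_differences_variance:
  fixes D :: "'b measure" and I :: "'i set" and f :: "('i \<Rightarrow> 'b) \<Rightarrow> real"
  assumes D: "prob_space D" and I: "finite I"
    and f: "f \<in> borel_measurable (PiM I (\<lambda>_. D))"
    and bd: "\<And>\<omega>. \<omega> \<in> space (PiM I (\<lambda>_. D)) \<Longrightarrow> \<bar>f \<omega>\<bar> \<le> B"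
    and diff: "\<And>i w y. i \<in> I \<Longrightarrow> w \<in> space (PiM I (\<lambda>_. D)) \<Longrightarrow> y \<in> space D \<Longrightarrow> \<bar>f (w(i := y)) - f w\<bar> \<le> 1"
  shows "(\<integral>\<omega>. (f \<omega> - (\<integral>\<omega>. f \<omega> \<partial>PiM I (\<lambda>_. D)))\<^sup>2 \<partial>PiM I (\<lambda>_. D)) \<le> card I"
  using I f bd diff
proof (induction I arbitrary: f rule: finite_induct)
  case empty
  interpret P: prob_space "PiM {} (\<lambda>_::'i. D)"
    by (intro prob_space_PiM D)
  have sp: "space (PiM {} (\<lambda>_::'i. D)) = {\<lambda>_. undefined}"
    by (simp add: space_PiM)
  have "(\<integral>\<omega>. f \<omega> \<partial>PiM {} (\<lambda>_::'i. D)) = (\<integral>\<omega>. f (\<lambda>_. undefined) \<partial>PiM {} (\<lambda>_::'i. D))"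
    by (intro Bochner_Integration.integral_cong) (auto simp: sp)
  then have m: "(\<integral>\<omega>. f \<omega> \<partial>PiM {} (\<lambda>_::'i. D)) = f (\<lambda>_. undefined)"
    by (simp add: P.prob_space)
  have "(\<integral>\<omega>. (f \<omega> - f (\<lambda>_. undefined))\<^sup>2 \<partial>PiM {} (\<lambda>_::'i. D)) = (\<integral>\<omega>. 0 \<partial>PiM {} (\<lambda>_::'i. D))"
    by (intro Bochner_Integration.integral_cong) (auto simp: sp)
  then show ?case unfolding m by simp
next
  case (insert i I)
  interpret D: prob_space D by fact
  interpret product_prob_space "\<lambda>_::'i. D" I
    by unfold_locales
  let ?P = "PiM I (\<lambda>_. D)" and ?P' = "PiM (insert i I) (\<lambda>_. D)"
  interpret P: prob_space ?P by (intro prob_space_PiM D)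
  interpret P': prob_space ?P' by (intro prob_space_PiM D)
  note f[measurable] = insert.prems(1)
  note fin[simp] = insert.hyps(1,2)
  have upd: "x(i := y) \<in> space ?P'" if "x \<in> space ?P" "y \<in> space D" for x y
    using that by (auto simp: space_PiM PiE_def extensional_def)
  have fxy [measurable]: "(\<lambda>(x, y). f (x(i := y))) \<in> borel_measurable (?P \<Otimes>\<^sub>M D)"
    by measurable
  have fy [measurable]: "(\<lambda>y. f (x(i := y))) \<in> borel_measurable D" if "x \<in> space ?P" for x
    using measurable_compose[OF measurable_Pair1'[OF that] fxy] by simp
  have fint: "integrable D (\<lambda>y. f (x(i := y)))" if "x \<in> space ?P" for x
    using insert.prems(2) upd that
    by (intro D.integrable_const_bound[where B = B] fy AE_I2) auto
  \<comment> \<open>The conditional mean given the coordinates in \<open>I\<close>. It inherits the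
    bound and the differences, so the induction hypothesis applies to it.\<close>
  define h where "h x = (\<integral>y. f (x(i := y)) \<partial>D)" for x
  have h [measurable]: "h \<in> borel_measurable ?P"
    unfolding h_def using fxy by (intro D.borel_measurable_lebesgue_integral) simp
  have hB: "\<bar>h x\<bar> \<le> B" if x: "x \<in> space ?P" for x
  proof -
    have "\<bar>h x\<bar> \<le> (\<integral>y. \<bar>f (x(i := y))\<bar> \<partial>D)"
      unfolding h_def by (rule integral_abs_bound)
    also have "\<dots> \<le> (\<integral>y. B \<partial>D)"
      using insert.prems(2) upd x fint[OF x] by (intro integral_mono) auto
    finally show ?thesis by (simp add: D.prob_space)
  qed
  have hdiff: "\<bar>h (x(j := z)) - h x\<bar> \<le> 1" if j: "j \<in> I" and x: "x \<in> space ?P" and z: "z \<in> space D" for j x z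
  proof -
    have ij: "i \<noteq> j" using j insert.hyps(2) by blast
    have xz: "x(j := z) \<in> space ?P"
      using j x z by (auto simp: space_PiM PiE_def extensional_def)
    have "h (x(j := z)) - h x = (\<integral>y. f (x(j := z, i := y)) - f (x(i := y)) \<partial>D)"
      unfolding h_def using fint[OF x] fint[OF xz] by simp
    also have "\<bar>\<dots>\<bar> \<le> (\<integral>y. \<bar>f (x(j := z, i := y)) - f (x(i := y))\<bar> \<partial>D)"
      by (rule integral_abs_bound)
    also have "\<dots> \<le> (\<integral>y. 1 \<partial>D)"
    proof (intro integral_mono)
      fix y assume y: "y \<in> space D"
      show "\<bar>f (x(j := z, i := y)) - f (x(i := y))\<bar> \<le> 1"
        using insert.prems(3)[OF insertI2[OF j] upd[OF x y] z] by (simp only: fun_upd_twist[OF ij, of x])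
    qed (use fint[OF x] fint[OF xz] in auto)
    finally show ?thesis by (simp add: D.prob_space)
  qed
  have fI: "integrable ?P' f"
    using insert.prems(2) by (intro P'.integrable_const_bound[where B = B] AE_I2) auto
  define m where "m = (\<integral>\<omega>. f \<omega> \<partial>?P')"
  have m: "m = (\<integral>x. h x \<partial>?P)"
    unfolding m_def h_def using fI by (intro product_integral_insert) auto
  have hint: "integrable ?P h"
    using hB by (intro P.integrable_const_bound[where B = B] AE_I2) auto
  have mB: "\<bar>m\<bar> \<le> B"
  proof -
    have "\<bar>m\<bar> \<le> (\<integral>x. \<bar>h x\<bar> \<partial>?P)" unfolding m by (rule integral_abs_bound)
    also have "\<dots> \<le> (\<integral>x. B \<partial>?P)" using hB hint by (intro integral_mono) auto
    finally show ?thesis by (simp add: P.prob_space)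
  qed
  have sq: "integrable ?P (\<lambda>x. (h x - m)\<^sup>2)"
  proof (intro P.integrable_const_bound[where B = "(2 * B)\<^sup>2"] AE_I2)
    fix x assume "x \<in> space ?P"
    then have "\<bar>h x - m\<bar> \<le> 2 * B" using hB[of x] mB by linarith
    then show "norm ((h x - m)\<^sup>2) \<le> (2 * B)\<^sup>2"
      by (rule norm_power2_le)
  qed simp
  have fsq: "integrable ?P' (\<lambda>\<omega>. (f \<omega> - m)\<^sup>2)"
  proof (intro P'.integrable_const_bound[where B = "(2 * B)\<^sup>2"] AE_I2)
    fix \<omega> assume "\<omega> \<in> space ?P'"
    then have "\<bar>f \<omega> - m\<bar> \<le> 2 * B" using insert.prems(2)[of \<omega>] mB by linarith
    then show "norm ((f \<omega> - m)\<^sup>2) \<le> (2 * B)\<^sup>2"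
      by (rule norm_power2_le)
  qed simp
  have inner: "(\<integral>y. (f (x(i := y)) - m)\<^sup>2 \<partial>D) \<le> 1 + (h x - m)\<^sup>2" if x: "x \<in> space ?P" for x
  proof -
    have fh: "\<bar>f (x(i := y)) - h x\<bar> \<le> 1" if y: "y \<in> space D" for y
    proof -
      have "f (x(i := y)) - h x = (\<integral>y'. f (x(i := y)) - f (x(i := y')) \<partial>D)"
        unfolding h_def using fint[OF x] by (simp add: D.prob_space)
      also have "\<bar>\<dots>\<bar> \<le> (\<integral>y'. \<bar>f (x(i := y)) - f (x(i := y'))\<bar> \<partial>D)"
        by (rule integral_abs_bound)
      also have "\<dots> \<le> (\<integral>y'. 1 \<partial>D)"
      proof (intro integral_mono)
        fix y' assume y': "y' \<in> space D"
        show "\<bar>f (x(i := y)) - f (x(i := y'))\<bar> \<le> 1"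
          using insert.prems(3)[OF insertI1 upd[OF x y'] y] by (simp only: fun_upd_upd)
      qed (use fint[OF x] in auto)
      finally show ?thesis by (simp add: D.prob_space)
    qed
    \<comment> \<open>Expand around the conditional mean \<open>h x\<close>: the square of f - h is
      at most 1, and the cross term integrates to 0. Each coordinate thus adds at most 1 to the
      variance.\<close>
    have "(\<integral>y. (f (x(i := y)) - m)\<^sup>2 \<partial>D) \<le> (\<integral>y. 1 + 2 * (h x - m) * (f (x(i := y)) - h x) + (h x - m)\<^sup>2 \<partial>D)"
    proof (intro integral_mono)
      show "integrable D (\<lambda>y. (f (x(i := y)) - m)\<^sup>2)"
      proof (intro D.integrable_const_bound[where B = "(2 * B)\<^sup>2"] AE_I2)
        fix y assume "y \<in> space D"
        then have "\<bar>f (x(i := y)) - m\<bar> \<le> 2 * B" using insert.prems(2)[of "x(i := y)"] upd[OF x] mB by fastforce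
        then show "norm ((f (x(i := y)) - m)\<^sup>2) \<le> (2 * B)\<^sup>2"
      by (rule norm_power2_le)
      qed (use fy[OF x] in simp)
      fix y assume "y \<in> space D"
      then have "(f (x(i := y)) - h x)\<^sup>2 \<le> 1" using fh[of y] by (simp add: abs_square_le_1)
      then show "(f (x(i := y)) - m)\<^sup>2 \<le> 1 + 2 * (h x - m) * (f (x(i := y)) - h x) + (h x - m)\<^sup>2"
        by (simp add: power2_eq_square algebra_simps)
    qed (use fint[OF x] in auto)
    also have "\<dots> = 1 + (h x - m)\<^sup>2"
      using fint[OF x] by (simp add: D.prob_space h_def)
    finally show ?thesis .
  qed
  have "(\<integral>\<omega>. (f \<omega> - m)\<^sup>2 \<partial>?P') = (\<integral>x. (\<integral>y. (f (x(i := y)) - m)\<^sup>2 \<partial>D) \<partial>?P)"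
    using fsq by (intro product_integral_insert) auto
  also have "\<dots> \<le> (\<integral>x. 1 + (h x - m)\<^sup>2 \<partial>?P)"
  proof (intro integral_mono inner)
    show "integrable ?P (\<lambda>x. \<integral>y. (f (x(i := y)) - m)\<^sup>2 \<partial>D)"
    proof (intro P.integrable_const_bound[where B = "1 + (2 * B)\<^sup>2"] AE_I2)
      fix x assume x: "x \<in> space ?P"
      then have "\<bar>h x - m\<bar> \<le> 2 * B" using hB[of x] mB by linarith
      then have "(h x - m)\<^sup>2 \<le> (2 * B)\<^sup>2" using norm_power2_le by fastforce
      then show "norm (\<integral>y. (f (x(i := y)) - m)\<^sup>2 \<partial>D) \<le> 1 + (2 * B)\<^sup>2"
        using inner[OF x] by (simp add: Bochner_Integration.integral_nonneg)
    next
      have "(\<lambda>(x, y). (f (x(i := y)) - m)\<^sup>2) \<in> borel_measurable (?P \<Otimes>\<^sub>M D)"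
        by measurable
      then show "(\<lambda>x. \<integral>y. (f (x(i := y)) - m)\<^sup>2 \<partial>D) \<in> borel_measurable ?P"
        by (intro D.borel_measurable_lebesgue_integral)
    qed
  qed (use sq in auto)
  also have "\<dots> = 1 + (\<integral>x. (h x - m)\<^sup>2 \<partial>?P)"
    using sq by (simp add: P.prob_space)
  also have "(\<integral>x. (h x - m)\<^sup>2 \<partial>?P) \<le> card I"
    unfolding m using insert.IH[OF h hB hdiff] by simp
  finally show ?case
    by (simp add: m_def)
qed

text \<open>A bound for the twelfth moment of a variable whose tail is at most 3 exp (-s): on the
  slice where the absolute value lies between m and m + 1 its twelfth power is at most (m + 1)^12,
  and the tail at m bounds the probability of the slice.\<close>

definition exp_tail_moment :: real where
  "exp_tail_moment = (\<Sum>m. 3 * real (Suc m) ^ 12 * exp (- real m))"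

lemma exp_tail_summable: "summable (\<lambda>m. 3 * real (Suc m) ^ 12 * exp (- real m))"
proof (rule summable_comparison_test_ev)
  show "summable (\<lambda>m. 1 / real m ^ 2)"
    using inverse_power_summable[of 2, where 'a = real] by (simp add: inverse_eq_divide)
  show "\<forall>\<^sub>F m in sequentially. norm (3 * real (Suc m) ^ 12 * exp (- real m)) \<le> 1 / real m ^ 2"
    unfolding norm_mult norm_power real_norm_def by real_asymp
qed

lemma exponential_tail_moment:
  fixes Y :: "'a \<Rightarrow> real"
  assumes M: "prob_space M" and Y[measurable]: "Y \<in> borel_measurable M" and f: "f > 0"
    and tail: "\<And>s. s \<ge> 0 \<Longrightarrow> measure M {\<omega> \<in> space M. \<bar>Y \<omega>\<bar> \<ge> s} \<le> 3 * exp (- s / f)"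
  shows "integrable M (\<lambda>\<omega>. Y \<omega> ^ 12)" and "(\<integral>\<omega>. Y \<omega> ^ 12 \<partial>M) \<le> exp_tail_moment * f ^ 12"
proof -
  interpret prob_space M by fact
  define c where "c m = 3 * real (Suc m) ^ 12 * exp (- real m)" for m
  define E where "E m = {\<omega> \<in> space M. \<bar>Y \<omega>\<bar> \<ge> real m * f}" for m
  have E [measurable]: "E m \<in> sets M" for m unfolding E_def by measurable
  have pm: "measure M (E m) \<le> 3 * exp (- real m)" for m
    unfolding E_def using tail[of "real m * f"] f by simp
  have pt: "ennreal (Y \<omega> ^ 12) \<le> (\<Sum>m. ennreal (f ^ 12 * real (Suc m) ^ 12) * indicator (E m) \<omega>)"
    if \<omega>: "\<omega> \<in> space M" for \<omega>
  proof -
    define m where "m = nat \<lfloor>\<bar>Y \<omega>\<bar> / f\<rfloor>"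
    have m1: "real m \<le> \<bar>Y \<omega>\<bar> / f" "\<bar>Y \<omega>\<bar> / f \<le> real (Suc m)"
      unfolding m_def using f by (auto simp: of_nat_nat) linarith
    have "\<omega> \<in> E m" using m1(1) f \<omega> by (simp add: E_def field_simps)
    have "\<bar>Y \<omega>\<bar> \<le> f * real (Suc m)" using m1(2) f by (simp add: field_simps)
    then have "\<bar>Y \<omega>\<bar> ^ 12 \<le> (f * real (Suc m)) ^ 12" by (intro power_mono) auto
    then have "Y \<omega> ^ 12 \<le> f ^ 12 * real (Suc m) ^ 12"
      by (simp add: power_mult_distrib power_even_abs)
    then have "ennreal (Y \<omega> ^ 12) \<le> ennreal (f ^ 12 * real (Suc m) ^ 12) * indicator (E m) \<omega>"
      using \<open>\<omega> \<in> E m\<close> by (simp add: ennreal_leI)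
    also have "\<dots> \<le> (\<Sum>m. ennreal (f ^ 12 * real (Suc m) ^ 12) * indicator (E m) \<omega>)"
      using sum_le_suminf[where f = "\<lambda>m. ennreal (f ^ 12 * real (Suc m) ^ 12) * indicator (E m) \<omega>", OF summableI, of "{m}"]
      by (metis (lifting) finite.emptyI finite.insertI sum.empty sum.insert add.right_neutral empty_iff zero_le)
    finally show ?thesis .
  qed
  have "(\<integral>\<^sup>+ \<omega>. ennreal (Y \<omega> ^ 12) \<partial>M) \<le> (\<integral>\<^sup>+ \<omega>. (\<Sum>m. ennreal (f ^ 12 * real (Suc m) ^ 12) * indicator (E m) \<omega>) \<partial>M)"
    by (intro nn_integral_mono pt)
  also have "\<dots> = (\<Sum>m. \<integral>\<^sup>+ \<omega>. ennreal (f ^ 12 * real (Suc m) ^ 12) * indicator (E m) \<omega> \<partial>M)"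
    by (intro nn_integral_suminf) measurable
  also have "\<dots> = (\<Sum>m. ennreal (f ^ 12 * real (Suc m) ^ 12) * ennreal (measure M (E m)))"
    by (simp add: nn_integral_cmult_indicator emeasure_eq_measure)
  also have "\<dots> \<le> (\<Sum>m. ennreal (f ^ 12 * c m))"
  proof (intro suminf_le allI)
    fix m
    have "f ^ 12 * real (Suc m) ^ 12 * measure M (E m) \<le> f ^ 12 * real (Suc m) ^ 12 * (3 * exp (- real m))"
      using f pm by (intro mult_left_mono) auto
    also have "\<dots> = f ^ 12 * c m" by (simp add: c_def)
    finally show "ennreal (f ^ 12 * real (Suc m) ^ 12) * ennreal (measure M (E m)) \<le> ennreal (f ^ 12 * c m)"
      using f by (simp add: ennreal_leI flip: ennreal_mult)
  qed auto
  also have "\<dots> = ennreal (\<Sum>m. f ^ 12 * c m)"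
    using f exp_tail_summable by (intro suminf_ennreal2 summable_mult) (auto simp: c_def)
  also have "(\<Sum>m. f ^ 12 * c m) = exp_tail_moment * f ^ 12"
    using exp_tail_summable unfolding c_def exp_tail_moment_def
    by (subst suminf_mult) (simp_all only: mult.commute)
  finally have le: "(\<integral>\<^sup>+ \<omega>. ennreal (Y \<omega> ^ 12) \<partial>M) \<le> ennreal (exp_tail_moment * f ^ 12)" .
  have nn: "Y \<omega> ^ 12 \<ge> 0" for \<omega> by simp
  show i: "integrable M (\<lambda>\<omega>. Y \<omega> ^ 12)"
    using le nn by (intro integrableI_nonneg) (auto simp: le_less_trans)
  have "exp_tail_moment \<ge> 0"
    unfolding exp_tail_moment_def by (intro suminf_nonneg exp_tail_summable) auto
  then show "(\<integral>\<omega>. Y \<omega> ^ 12 \<partial>M) \<le> exp_tail_moment * f ^ 12"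
    using le nn f by (simp add: nn_integral_eq_integral[OF i])
qed

text \<open>Since s^2 >= s - 1/4, the Gaussian regime is absorbed into the exponential one at the
  price exp (1/4) <= 3/2, which turns the factor 2 into 3.\<close>

lemma min_sub_exponential:
  fixes s b :: real
  assumes "s \<ge> 0" "s \<le> b"
  shows "2 * exp (- min (s\<^sup>2) b) \<le> 3 * exp (- s)"
proof -
  have "(s - 1/2)\<^sup>2 \<ge> 0" by simp
  then have "s\<^sup>2 \<ge> s - 1/4" by (simp add: power2_eq_square algebra_simps)
  then have "min (s\<^sup>2) b \<ge> s - 1/4" using assms by linarith
  then have "exp (- min (s\<^sup>2) b) \<le> exp (1/4 + - s)" by (subst exp_le_cancel_iff) linarith
  also have "\<dots> = exp (1/4) * exp (- s)" by (rule exp_add)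
  also have "exp (1/4) \<le> (3/2::real)"
  proof (rule ccontr)
    assume "\<not> exp (1/4) \<le> (3/2::real)"
    then have "(3/2) ^ 4 \<le> exp (1/4 :: real) ^ 4" by (intro power_mono) auto
    also have "exp (1/4 :: real) ^ 4 = exp 1" by (simp flip: exp_of_nat_mult)
    finally show False using exp_le by (simp add: power_def)
  qed
  finally show ?thesis by simp
qed

text \<open>The spectral norm is at most the Frobenius norm, so in the scale \<open>f\<close> = K^2
  |B|_F both regimes are dominated by one exponential tail; K^24 is the twelfth power of K^2. The
  zero matrix, excluded in the inequality, is treated directly.\<close>

lemma hanson_wright_moment:
  fixes x :: "'a \<Rightarrow> real vec"
  assumes M: "prob_space M" and hw: "hanson_wright M n x K" and K: "K > 0"
    and x: "\<And>\<omega>. \<omega> \<in> space M \<Longrightarrow> x \<omega> \<in> carrier_vec n"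
    and meas: "(\<lambda>\<omega>. x \<omega> \<bullet> (B *\<^sub>v x \<omega>)) \<in> borel_measurable M" and B: "B \<in> carrier_mat n n"
  shows "integrable M (\<lambda>\<omega>. (x \<omega> \<bullet> (B *\<^sub>v x \<omega>) - mat_trace B) ^ 12)"
    and "(\<integral>\<omega>. (x \<omega> \<bullet> (B *\<^sub>v x \<omega>) - mat_trace B) ^ 12 \<partial>M) \<le> exp_tail_moment * K ^ 24 * frobenius_norm B ^ 12"
proof -
  interpret prob_space M by fact
  have "integrable M (\<lambda>\<omega>. (x \<omega> \<bullet> (B *\<^sub>v x \<omega>) - mat_trace B) ^ 12) \<and>
    (\<integral>\<omega>. (x \<omega> \<bullet> (B *\<^sub>v x \<omega>) - mat_trace B) ^ 12 \<partial>M) \<le> exp_tail_moment * K ^ 24 * frobenius_norm B ^ 12"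
  proof (cases "B = 0\<^sub>m n n")
    case True
    have F: "frobenius_norm B = 0" unfolding True frobenius_norm_def by simp
    have "x \<omega> \<bullet> (B *\<^sub>v x \<omega>) - mat_trace B = 0" if "\<omega> \<in> space M" for \<omega>
    proof -
      have "0\<^sub>m n n *\<^sub>v x \<omega> = 0\<^sub>v n"
        using x[OF that] by (intro eq_vecI) auto
      then show ?thesis
        using x[OF that] by (simp add: True mat_trace_def)
    qed
    then have z: "(x \<omega> \<bullet> (B *\<^sub>v x \<omega>) - mat_trace B) ^ 12 = 0" if "\<omega> \<in> space M" for \<omega>
      using that by simp
    have "integrable M (\<lambda>\<omega>. (x \<omega> \<bullet> (B *\<^sub>v x \<omega>) - mat_trace B) ^ 12) \<longleftrightarrow> integrable M (\<lambda>_. 0 :: real)"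
      by (rule Bochner_Integration.integrable_cong[OF refl z])
    moreover have "(\<integral>\<omega>. (x \<omega> \<bullet> (B *\<^sub>v x \<omega>) - mat_trace B) ^ 12 \<partial>M) = (\<integral>_. 0 \<partial>M)"
      by (rule Bochner_Integration.integral_cong[OF refl z])
    ultimately show ?thesis using F by simp
  next
    case False
    have S: "spectral_norm B > 0" "spectral_norm B \<le> frobenius_norm B"
      using spectral_norm_pos[OF B False] spectral_norm_le_frobenius_norm[OF B] by auto
    define f where "f = K\<^sup>2 * frobenius_norm B"
    have f: "f > 0" using K S by (simp add: f_def)
    have tail: "measure M {\<omega> \<in> space M. \<bar>x \<omega> \<bullet> (B *\<^sub>v x \<omega>) - mat_trace B\<bar> \<ge> s} \<le> 3 * exp (- s / f)"
      if s: "s \<ge> 0" for s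
    proof -
      have "measure M {\<omega> \<in> space M. \<bar>x \<omega> \<bullet> (B *\<^sub>v x \<omega>) - mat_trace B\<bar> \<ge> s}
        \<le> 2 * exp (- min (s\<^sup>2 / (K ^ 4 * (frobenius_norm B)\<^sup>2)) (s / (K\<^sup>2 * spectral_norm B)))"
        using hw B False s unfolding hanson_wright_def by blast
      also have "s\<^sup>2 / (K ^ 4 * (frobenius_norm B)\<^sup>2) = (s / f)\<^sup>2"
        by (simp add: f_def power_divide power_mult_distrib)
      also have "2 * exp (- min ((s / f)\<^sup>2) (s / (K\<^sup>2 * spectral_norm B))) \<le> 3 * exp (- (s / f))"
      proof (rule min_sub_exponential)
        show "s / f \<le> s / (K\<^sup>2 * spectral_norm B)"
          unfolding f_def using S K s by (intro divide_left_mono mult_left_mono) auto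
      qed (use s f in simp)
      finally show ?thesis by simp
    qed
    have "f ^ 12 = K ^ 24 * frobenius_norm B ^ 12"
      by (simp add: f_def power_mult_distrib)
    then show ?thesis
      using exponential_tail_moment[OF M _ f tail] meas by (simp add: mult.assoc)
  qed
  then show "integrable M (\<lambda>\<omega>. (x \<omega> \<bullet> (B *\<^sub>v x \<omega>) - mat_trace B) ^ 12)"
    "(\<integral>\<omega>. (x \<omega> \<bullet> (B *\<^sub>v x \<omega>) - mat_trace B) ^ 12 \<partial>M) \<le> exp_tail_moment * K ^ 24 * frobenius_norm B ^ 12"
    by auto
qed

text \<open>Through the matrix b b^T the square of a linear form is a quadratic form, so the
  Hanson-Wright inequality controls linear forms as well.\<close>

lemma outer_product_quadratic:
  fixes b :: "real vec"
  assumes b: "b \<in> carrier_vec n"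
  defines "B \<equiv> mat n n (\<lambda>(i, j). b $ i * b $ j)"
  shows "z \<in> carrier_vec n \<Longrightarrow> z \<bullet> (B *\<^sub>v z) = (b \<bullet> z)\<^sup>2"
    and "mat_trace B = b \<bullet> b" and "frobenius_norm B = b \<bullet> b"
proof -
  show "mat_trace B = b \<bullet> b"
    using b by (simp add: B_def mat_trace_def scalar_prod_def lessThan_atLeast0)
  have "(\<Sum>i<n. \<Sum>j<n. (b $ i * b $ j)\<^sup>2) = (b \<bullet> b)\<^sup>2"
    using b by (simp add: scalar_prod_def lessThan_atLeast0 power2_eq_square sum_product mult_ac)
  then show "frobenius_norm B = b \<bullet> b"
    using scalar_prod_self_nonneg[of b] by (simp add: B_def frobenius_norm_def)
  assume z: "z \<in> carrier_vec n"
  have "B *\<^sub>v z = (b \<bullet> z) \<cdot>\<^sub>v b"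
    using b z by (intro eq_vecI) (auto simp: B_def scalar_prod_def sum_distrib_left sum_distrib_right mult_ac)
  then show "z \<bullet> (B *\<^sub>v z) = (b \<bullet> z)\<^sup>2"
    using b z by (simp add: scalar_prod_smult_distrib[of _ n] comm_scalar_prod[of z n b] power2_eq_square)
qed

subsection \<open>Independent random rows\<close>

text \<open>Here \<open>D\<close> is the law of a single row before multiplication by
  \<open>A\<close>, and independence is built into the product space. Concentration enters as a
  twelfth-moment bound with one constant \<open>c\<close>; the trace condition says r = \<rho> k
  after normalization.\<close>

locale random_rows =
  fixes D :: "(nat \<Rightarrow> real) measure" and n k :: nat and A :: "real mat" and \<rho> c :: real
  assumes D: "prob_space D" and sets_D: "sets D = sets (PiM {..<n} (\<lambda>_. borel))"
    and k: "k \<ge> 1" and A: "A \<in> carrier_mat n n" "A\<^sup>T = A"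
    and contr: "\<And>v. v \<in> carrier_vec n \<Longrightarrow> (A *\<^sub>v v) \<bullet> (A *\<^sub>v v) \<le> v \<bullet> v"
    and trace: "mat_trace (A * A) = \<rho> * real k" and \<rho>: "\<rho> > 1" and c: "c \<ge> 0"
    and cov_int: "\<And>a b. a < n \<Longrightarrow> b < n \<Longrightarrow> integrable D (\<lambda>f. f a * f b)"
    and cov: "\<And>a b. a < n \<Longrightarrow> b < n \<Longrightarrow> (\<integral>f. f a * f b \<partial>D) = (if a = b then 1 else 0)"
    and moment_int: "\<And>B. B \<in> carrier_mat n n \<Longrightarrow> integrable D (\<lambda>f. (vec n f \<bullet> (B *\<^sub>v vec n f) - mat_trace B) ^ 12)"
    and moment: "\<And>B. B \<in> carrier_mat n n \<Longrightarrow>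
      (\<integral>f. (vec n f \<bullet> (B *\<^sub>v vec n f) - mat_trace B) ^ 12 \<partial>D) \<le> c * frobenius_norm B ^ 12"
begin

abbreviation Om :: "(nat \<Rightarrow> nat \<Rightarrow> real) measure" where
  "Om \<equiv> PiM {..<k} (\<lambda>_. D)"

text \<open>With \<open>l = 1 / k\<close> the ridge resolvent is within \<open>O(1 / k)\<close> of the projection in expected trace, while
  on the exceptional event where \<open>q i\<close> is small one still has \<open>1 / q i \<le> k\<close>.\<close>

definition l :: real where "l = 1 / real k"
definition \<delta> :: real where "\<delta> = \<rho> - 1"

definition x :: "(nat \<Rightarrow> nat \<Rightarrow> real) \<Rightarrow> nat \<Rightarrow> real vec" where
  "x w i = A *\<^sub>v vec n (w i)"

definition P :: "(nat \<Rightarrow> nat \<Rightarrow> real) \<Rightarrow> real mat" where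
  "P w = ridge_on n l (x w) {..<k}"

definition Q :: "nat \<Rightarrow> (nat \<Rightarrow> nat \<Rightarrow> real) \<Rightarrow> real mat" where
  "Q i w = ridge_on n l (x w) ({..<k} - {i})"

definition q :: "nat \<Rightarrow> (nat \<Rightarrow> nat \<Rightarrow> real) \<Rightarrow> real" where
  "q i w = l + x w i \<bullet> (Q i w *\<^sub>v x w i)"

text \<open>The conditional mean of \<open>q i\<close> given the other rows, by identity
  covariance.\<close>

definition t :: "nat \<Rightarrow> (nat \<Rightarrow> nat \<Rightarrow> real) \<Rightarrow> real" where
  "t i w = l + mat_trace (A * Q i w * A)"

definition T :: "(nat \<Rightarrow> nat \<Rightarrow> real) \<Rightarrow> real" where
  "T w = l + mat_trace (A * P w * A)"

definition \<tau> :: real where "\<tau> = (\<integral>w. T w \<partial>Om)"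

lemma l_pos: "l > 0" and kl: "real k * l = 1" and l_le: "l \<le> 1"
  using k by (auto simp: l_def)

lemma \<delta>_pos: "\<delta> > 0"
  using \<rho> by (simp add: \<delta>_def)

sublocale Om: prob_space Om
  by (intro prob_space_PiM D)

sublocale D: prob_space D by (rule D)

lemma x_carrier [simp]: "x w i \<in> carrier_vec n"
  using A by (auto simp: x_def)

lemma P_carrier [simp]: "P w \<in> carrier_mat n n" "P w *\<^sub>v v \<in> carrier_vec n"
  and Q_carrier [simp]: "Q i w \<in> carrier_mat n n" "Q i w *\<^sub>v v \<in> carrier_vec n"
  by (auto simp: P_def Q_def)

lemma ridge_trace_axioms: "ridge_trace n l (x w) {..<k} A"
  using l_pos A contr by unfold_locales auto

lemma ridge_trace_leave_one_out: "ridge_trace n l (x w) ({..<k} - {i}) A"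
  using l_pos A contr by unfold_locales auto

lemma ridge_family_axioms: "ridge_family n l (x w) {..<k}"
  using l_pos by unfold_locales auto

lemma x_upd: "x (w(i := y)) i = A *\<^sub>v vec n y"
  by (simp add: x_def)

text \<open>Independence of \<open>Q i\<close> from row i takes this form throughout: overwriting
  coordinate i changes nothing, so \<open>Q i\<close> is a constant when that coordinate is
  integrated out.\<close>

lemma Q_upd: "Q i (w(i := y)) = Q i w"
  unfolding Q_def by (intro ridge_on_cong) (auto simp: x_def)

lemma t_upd: "t i (w(i := y)) = t i w"
  by (simp add: t_def Q_upd)

text \<open>These bounds hold surely. The lower one starts from tr (A A) = \<rho> k and loses at
  most 1 for each of the k rows, which is where \<rho> > 1 makes the denominators of order
  k.\<close>

lemma trace_bounds:
  assumes i: "i < k"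
  shows "t i w \<ge> \<delta> * real k" "t i w \<le> \<rho> * real k + 1" "T w \<ge> \<delta> * real k" "T w \<le> \<rho> * real k + 1"
    "\<bar>t i w - T w\<bar> \<le> 1" "mat_trace (A * Q i w * A) \<le> \<rho> * real k" "0 \<le> mat_trace (A * Q i w * A)"
proof -
  have 1: "mat_trace (A * P w * A) \<ge> \<rho> * real k - real k"
    using ridge_trace_ge[OF ridge_trace_axioms[of w]] trace by (simp add: P_def)
  have 2: "mat_trace (A * Q i w * A) - mat_trace (A * P w * A) \<in> {0..1}"
    using ridge_trace.ridge_trace_diff[OF ridge_trace_axioms] i by (auto simp: P_def Q_def)
  show 3: "mat_trace (A * Q i w * A) \<le> \<rho> * real k" "0 \<le> mat_trace (A * Q i w * A)"
    using ridge_trace.ridge_trace_le[OF ridge_trace_axioms, of "{..<k} - {i}" w] trace by (auto simp: Q_def)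
  show "t i w \<ge> \<delta> * real k" "t i w \<le> \<rho> * real k + 1" "T w \<ge> \<delta> * real k" "T w \<le> \<rho> * real k + 1"
    "\<bar>t i w - T w\<bar> \<le> 1"
    using 1 2 3 l_pos l_le unfolding t_def T_def \<delta>_def by (auto simp: left_diff_distrib)
qed

lemma q_pos: "i < k \<Longrightarrow> q i w \<ge> l" "i < k \<Longrightarrow> q i w > 0"
  using ridge_family.leave_one_out_pos[OF ridge_family_axioms, of i w] by (auto simp: q_def Q_def)

lemma measurable_entry: "i < k \<Longrightarrow> j < n \<Longrightarrow> (\<lambda>w. w i j) \<in> borel_measurable Om"
  and measurable_entry_D: "j < n \<Longrightarrow> (\<lambda>f. f j) \<in> borel_measurable D"
proof -
  show D': "(\<lambda>f. f j) \<in> borel_measurable D" if "j < n"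
    using measurable_component_singleton[of j "{..<n}" "\<lambda>_. borel :: real measure"] that
    by (simp add: measurable_cong_sets[OF sets_D refl])
  show "(\<lambda>w. w i j) \<in> borel_measurable Om" if "i < k" "j < n"
    using measurable_compose[OF measurable_component_singleton[of i "{..<k}" "\<lambda>_. D"] D'] that by simp
qed

lemma vec_measurable_x: "i < k \<Longrightarrow> vec_measurable Om n (\<lambda>w. x w i)"
  unfolding x_def using measurable_entry A
  by (intro vec_measurable_mult_mat_vec[of _ n n] mat_measurable_const) (auto simp: vec_measurable_def)

lemma mat_measurable_P: "mat_measurable Om n n P"
  and mat_measurable_Q: "mat_measurable Om n n (Q i)"
  unfolding P_def Q_def by (intro mat_measurable_ridge_on vec_measurable_x; simp)+

lemma borel_measurable_trace_conj:
  assumes "mat_measurable M n n F"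
  shows "(\<lambda>w. mat_trace (A * F w * A)) \<in> borel_measurable M"
  using assms A by (intro borel_measurable_mat_trace[of _ n] mat_measurable_mult[of _ n n _ n] mat_measurable_const) auto

lemma borel_measurable_qtT [measurable]:
  "T \<in> borel_measurable Om" "t i \<in> borel_measurable Om" "i < k \<Longrightarrow> q i \<in> borel_measurable Om"
proof -
  show "T \<in> borel_measurable Om" "t i \<in> borel_measurable Om"
    unfolding T_def[abs_def] t_def[abs_def]
    using borel_measurable_trace_conj[OF mat_measurable_P] borel_measurable_trace_conj[OF mat_measurable_Q] by auto
  show "q i \<in> borel_measurable Om" if "i < k"
    unfolding q_def[abs_def] using vec_measurable_x[OF that] mat_measurable_Q
    by (intro borel_measurable_add borel_measurable_const borel_measurable_scalar_prod[of _ n]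
        vec_measurable_mult_mat_vec[of _ n n]) auto
qed

lemma T_abs: "\<bar>T w\<bar> \<le> \<rho> * real k + 1"
proof -
  have "0 \<le> \<delta> * real k" using \<delta>_pos by simp
  then show ?thesis using trace_bounds(3,4)[of 0 w] k by auto
qed

lemma T_int: "integrable Om T"
  using T_abs by (intro Om.integrable_const_bound[where B = "\<rho> * real k + 1"] AE_I2) auto

lemma \<tau>_bounds: "\<tau> \<ge> \<delta> * real k" "\<tau> \<le> \<rho> * real k + 1" "\<tau> > 0"
proof -
  have "\<delta> * real k = (\<integral>w. \<delta> * real k \<partial>Om)" by (simp add: Om.prob_space)
  also have "\<dots> \<le> \<tau>"
    unfolding \<tau>_def using trace_bounds(3)[of 0] k by (intro integral_mono T_int) auto
  finally show 1: "\<tau> \<ge> \<delta> * real k" .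
  have "\<tau> \<le> (\<integral>w. \<rho> * real k + 1 \<partial>Om)"
    unfolding \<tau>_def using trace_bounds(4)[of 0] k by (intro integral_mono T_int) auto
  then show "\<tau> \<le> \<rho> * real k + 1" by (simp add: Om.prob_space)
  show "\<tau> > 0" using 1 \<delta>_pos k by (intro less_le_trans[OF _ 1]) simp
qed

lemma T_variance: "(\<integral>w. (T w - \<tau>)\<^sup>2 \<partial>Om) \<le> real k"
  and T_variance_int: "integrable Om (\<lambda>w. (T w - \<tau>)\<^sup>2)"
proof -
  have "(\<integral>w. (T w - \<tau>)\<^sup>2 \<partial>Om) \<le> card {..<k}"
    unfolding \<tau>_def
  proof (rule bounded_differences_variance[OF D])
    fix i w and y :: "nat \<Rightarrow> real" assume i: "i \<in> {..<k}"
    \<comment> \<open>\<open>t i\<close> does not see coordinate i, so both values of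
      \<open>T\<close> lie in the same interval of length 1.\<close>
    have d: "t i w' - T w' \<in> {0..1}" for w'
      using ridge_trace.ridge_trace_diff[OF ridge_trace_axioms, of i w'] i by (auto simp: P_def Q_def t_def T_def)
    show "\<bar>T (w(i := y)) - T w\<bar> \<le> 1"
      using d[of w] d[of "w(i := y)"] by (auto simp: t_upd)
  qed (use T_abs in auto)
  then show "(\<integral>w. (T w - \<tau>)\<^sup>2 \<partial>Om) \<le> real k" by simp
  show "integrable Om (\<lambda>w. (T w - \<tau>)\<^sup>2)"
  proof (intro Om.integrable_const_bound[where B = "(2 * (\<rho> * real k + 1))\<^sup>2"] AE_I2 norm_power2_le)
    show "\<bar>T w - \<tau>\<bar> \<le> 2 * (\<rho> * real k + 1)" for w
      using T_abs[of w] \<tau>_bounds(2,3) unfolding distrib_left by linarith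
  qed simp
qed

lemma mult_A_scalar: "u \<in> carrier_vec n \<Longrightarrow> v \<in> carrier_vec n \<Longrightarrow> u \<bullet> (A *\<^sub>v v) = (A *\<^sub>v u) \<bullet> v"
  using symmetric_scalar_prod[OF A, of u v] A comm_scalar_prod[of "A *\<^sub>v u" n v] by simp

text \<open>Given the other rows, q - t is a centred quadratic form with matrix A Q_i A, whose
  squared Frobenius norm is at most \<rho> k; its sixth power produces k^6.\<close>

lemma quadratic_moment:
  assumes i: "i < k"
  shows "integrable Om (\<lambda>w. (q i w - t i w) ^ 12)"
    and "(\<integral>w. (q i w - t i w) ^ 12 \<partial>Om) \<le> c * \<rho> ^ 6 * real k ^ 6"
proof -
  have 1: "integrable D (\<lambda>y. (q i (w(i := y)) - t i (w(i := y))) ^ 12) \<and>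
     (\<integral>y. (q i (w(i := y)) - t i (w(i := y))) ^ 12 \<partial>D) \<le> c * \<rho> ^ 6 * real k ^ 6" for w
  proof -
    define B where "B = A * Q i w * A"
    have B: "B \<in> carrier_mat n n" using A by (simp add: B_def mult_carrier_mat[of _ n n])
    have "q i (w(i := y)) - t i (w(i := y)) = vec n y \<bullet> (B *\<^sub>v vec n y) - mat_trace B" for y
    proof -
      have "B *\<^sub>v vec n y = A *\<^sub>v (Q i w *\<^sub>v (A *\<^sub>v vec n y))"
        using A unfolding B_def
        by (simp add: assoc_mult_mat_vec[of _ n n _ n] mult_carrier_mat[of _ n n] mult_mat_vec_carrier[of _ n n])
      then show ?thesis
        using mult_A_scalar[of "vec n y" "Q i w *\<^sub>v (A *\<^sub>v vec n y)"]
        by (simp add: q_def t_def Q_upd x_upd B_def)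
    qed
    moreover have "frobenius_norm B ^ 12 \<le> \<rho> ^ 6 * real k ^ 6"
    proof -
      have "(frobenius_norm B)\<^sup>2 \<le> \<rho> * real k"
        using ridge_trace.frobenius_norm_ridge_conj[OF ridge_trace_leave_one_out, of "{..<k} - {i}" i w]
          trace_bounds(6)[OF i, of w] by (simp add: B_def Q_def)
      then have "((frobenius_norm B)\<^sup>2) ^ 6 \<le> (\<rho> * real k) ^ 6" by (intro power_mono) auto
      then show ?thesis by (simp add: power_mult_distrib)
    qed
    then have "c * frobenius_norm B ^ 12 \<le> c * \<rho> ^ 6 * real k ^ 6"
      using c by (simp add: mult.assoc mult_left_mono)
    ultimately show ?thesis
      using moment_int[OF B] moment[OF B] by simp
  qed
  have m: "(\<lambda>w. (q i w - t i w) ^ 12) \<in> borel_measurable Om"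
    using i by measurable
  show "integrable Om (\<lambda>w. (q i w - t i w) ^ 12)" "(\<integral>w. (q i w - t i w) ^ 12 \<partial>Om) \<le> c * \<rho> ^ 6 * real k ^ 6"
    using PiM_integral_coordinate_le[OF D _ _ m, of i "c * \<rho> ^ 6 * real k ^ 6"] i 1 by auto
qed

text \<open>With b = Au the square of the form is Y + |b|^2, where Y has twelfth moment at most c.
  Then 2 Y^2 + 2 |b|^4 <= 2 (1 + Y^12) + 2 gives the constant.\<close>

lemma linear_moment_D:
  assumes u: "u \<in> carrier_vec n" and u1: "u \<bullet> u \<le> 1"
  shows "integrable D (\<lambda>y. (u \<bullet> (A *\<^sub>v vec n y)) ^ 4)"
    and "(\<integral>y. (u \<bullet> (A *\<^sub>v vec n y)) ^ 4 \<partial>D) \<le> 4 + 2 * c"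
proof -
  define b where "b = A *\<^sub>v u"
  define B where "B = mat n n (\<lambda>(i, j). b $ i * b $ j)"
  have b: "b \<in> carrier_vec n" using A u by (simp add: b_def mult_mat_vec_carrier[of _ n n])
  have b1: "b \<bullet> b \<le> 1" using contr[OF u] u1 by (simp add: b_def)
  have B: "B \<in> carrier_mat n n" by (simp add: B_def)
  note out = outer_product_quadratic[OF b, folded B_def]
  define Y where "Y y = vec n y \<bullet> (B *\<^sub>v vec n y) - mat_trace B" for y
  have "frobenius_norm B ^ 12 \<le> 1"
    using b1 scalar_prod_self_nonneg[of b] by (simp add: out power_le_one)
  then have Y: "integrable D (\<lambda>y. Y y ^ 12)" "(\<integral>y. Y y ^ 12 \<partial>D) \<le> c"
    using moment_int[OF B] moment[OF B] c mult_left_le[of "frobenius_norm B ^ 12" c]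
    by (auto simp: Y_def intro: order_trans)
  have bound: "(u \<bullet> (A *\<^sub>v vec n y)) ^ 4 \<le> 4 + 2 * Y y ^ 12" for y
  proof -
    have "u \<bullet> (A *\<^sub>v vec n y) = b \<bullet> vec n y"
      using mult_A_scalar[OF u, of "vec n y"] by (simp add: b_def)
    then have "(u \<bullet> (A *\<^sub>v vec n y))\<^sup>2 = Y y + b \<bullet> b"
      by (simp add: Y_def out)
    then have "(u \<bullet> (A *\<^sub>v vec n y)) ^ 4 = (Y y + b \<bullet> b)\<^sup>2"
      by (metis power_mult num_double numeral_times_numeral power2_eq_square power4_eq_xxxx)
    also have "\<dots> \<le> 2 * (Y y)\<^sup>2 + 2 * (b \<bullet> b)\<^sup>2"
      using sum_squares_bound[of "Y y" "b \<bullet> b"] by (simp add: power2_eq_square algebra_simps)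
    also have "(b \<bullet> b)\<^sup>2 \<le> 1"
      using b1 scalar_prod_self_nonneg[of b] by (simp add: power_le_one)
    also have "(Y y)\<^sup>2 \<le> 1 + Y y ^ 12"
    proof (cases "(Y y)\<^sup>2 \<le> 1")
      case False
      then have "((Y y)\<^sup>2) ^ 1 \<le> ((Y y)\<^sup>2) ^ 6" by (intro power_increasing) auto
      then show ?thesis by simp
    next
      case True
      then show ?thesis by (simp add: add_increasing2)
    qed
    finally show ?thesis by simp
  qed
  have m: "(\<lambda>y. (u \<bullet> (A *\<^sub>v vec n y)) ^ 4) \<in> borel_measurable D"
    using measurable_entry_D A u
    by (intro borel_measurable_power borel_measurable_scalar_prod[of _ n] vec_measurable_mult_mat_vec[of _ n n]
        mat_measurable_const vec_measurable_const) (auto simp: vec_measurable_def)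
  show i: "integrable D (\<lambda>y. (u \<bullet> (A *\<^sub>v vec n y)) ^ 4)"
    by (rule Bochner_Integration.integrable_bound[of _ "\<lambda>y. 4 + 2 * Y y ^ 12"])
      (use Y m bound in \<open>auto intro!: AE_I2\<close>)
  have "(\<integral>y. (u \<bullet> (A *\<^sub>v vec n y)) ^ 4 \<partial>D) \<le> (\<integral>y. 4 + 2 * Y y ^ 12 \<partial>D)"
    using Y i bound by (intro integral_mono) auto
  also have "\<dots> \<le> 4 + 2 * c"
    using Y by (simp add: D.prob_space)
  finally show "(\<integral>y. (u \<bullet> (A *\<^sub>v vec n y)) ^ 4 \<partial>D) \<le> 4 + 2 * c" .
qed

text \<open>Random vectors of norm at most 1 that depend on the rows other than i. The instances are
  a fixed vector and \<open>Q i w *\<^sub>v u\<close>, the two factors that meet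
  \<open>x w i\<close> in the expansion.\<close>

definition test_vec :: "nat \<Rightarrow> ((nat \<Rightarrow> nat \<Rightarrow> real) \<Rightarrow> real vec) \<Rightarrow> bool" where
  "test_vec i U \<longleftrightarrow> vec_measurable Om n U \<and> (\<forall>w. U w \<bullet> U w \<le> 1) \<and> (\<forall>w y. U (w(i := y)) = U w)"

lemma test_vec_const: "u \<in> carrier_vec n \<Longrightarrow> u \<bullet> u \<le> 1 \<Longrightarrow> test_vec i (\<lambda>_. u)"
  by (simp add: test_vec_def vec_measurable_const)

lemma test_vec_Q: "u \<in> carrier_vec n \<Longrightarrow> u \<bullet> u \<le> 1 \<Longrightarrow> test_vec i (\<lambda>w. Q i w *\<^sub>v u)"
  unfolding test_vec_def
proof (intro conjI allI)
  assume u: "u \<in> carrier_vec n" "u \<bullet> u \<le> 1"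
  show "vec_measurable Om n (\<lambda>w. Q i w *\<^sub>v u)"
    by (intro vec_measurable_mult_mat_vec[of _ n n] mat_measurable_Q vec_measurable_const u)
  show "(Q i w *\<^sub>v u) \<bullet> (Q i w *\<^sub>v u) \<le> 1" for w
    using ridge_family.ridge_on_quadratic(3)[OF ridge_family_axioms, of "{..<k} - {i}" u w] u by (auto simp: Q_def)
qed (simp add: Q_upd)

lemma linear_measurable: "i < k \<Longrightarrow> test_vec i U \<Longrightarrow> (\<lambda>w. U w \<bullet> x w i) \<in> borel_measurable Om"
  unfolding test_vec_def by (intro borel_measurable_scalar_prod[of _ n] vec_measurable_x) auto

lemma linear_moment:
  assumes i: "i < k" and U: "test_vec i U"
  shows "integrable Om (\<lambda>w. (U w \<bullet> x w i) ^ 4)"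
    and "(\<integral>w. (U w \<bullet> x w i) ^ 4 \<partial>Om) \<le> 4 + 2 * c"
proof -
  have 1: "integrable D (\<lambda>y. (U (w(i := y)) \<bullet> x (w(i := y)) i) ^ 4) \<and>
     (\<integral>y. (U (w(i := y)) \<bullet> x (w(i := y)) i) ^ 4 \<partial>D) \<le> 4 + 2 * c" for w
    using linear_moment_D[of "U w"] U by (simp add: x_upd test_vec_def vec_measurable_def)
  have m: "(\<lambda>w. (U w \<bullet> x w i) ^ 4) \<in> borel_measurable Om"
    using linear_measurable[OF i U] by simp
  show "integrable Om (\<lambda>w. (U w \<bullet> x w i) ^ 4)" "(\<integral>w. (U w \<bullet> x w i) ^ 4 \<partial>Om) \<le> 4 + 2 * c"
    using PiM_integral_coordinate_le[OF D _ _ m, of i "4 + 2 * c"] i 1 by auto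
qed

end

section \<open>Replacing the random denominators by a deterministic one\<close>

definition ratio_const :: "real \<Rightarrow> real" where
  "ratio_const \<delta> = 1 / \<delta>\<^sup>2 + (1 + 1 / \<delta>) * (1 + (2 / \<delta>) ^ 12)"

lemma ratio_const_pos: "\<delta> > 0 \<Longrightarrow> ratio_const \<delta> > 0"
  unfolding ratio_const_def by (intro add_pos_pos mult_pos_pos) auto

text \<open>Markov's inequality before integration: the indicator of the exceptional event is
  dominated by a normalized twelfth power.\<close>

lemma large_deviation_ge_1:
  fixes k \<delta> q t :: real
  assumes k: "k \<ge> 1" and \<delta>: "\<delta> > 0" and t: "t \<ge> \<delta> * k" and bad: "q < t / 2"
  shows "1 \<le> (2 / \<delta>) ^ 12 * (q - t) ^ 12 / k ^ 12"
proof -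
  have "\<delta> * k / 2 \<le> \<bar>q - t\<bar>" using t bad by linarith
  then have "1 \<le> 2 / \<delta> * \<bar>q - t\<bar> / k" using k \<delta> by (simp add: field_simps)
  then have "1 \<le> (2 / \<delta> * \<bar>q - t\<bar> / k) ^ 12" by (rule one_le_power)
  then show ?thesis by (simp add: power_mult_distrib power_divide)
qed

text \<open>The powers of k are chosen so that each summand has expectation O(k^(-3/2)): fourth
  moments of linear forms are O(1), the mean of (\<tau> - q)^2 is O(k), and the twelfth moment is
  O(k^6). For q >= t / 2 the denominators are of order k^2; otherwise only 1 / q <= k is
  available.\<close>

lemma ratio_pointwise:
  fixes a b q t \<tau> \<delta> k :: real
  assumes k: "k \<ge> 1" and \<delta>: "\<delta> > 0" and q: "q \<ge> 1 / k" and t: "t \<ge> \<delta> * k" and \<tau>: "\<tau> \<ge> \<delta> * k"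
  shows "\<bar>a * b * (1 / q - 1 / \<tau>)\<bar> \<le> ratio_const \<delta> *
    ((a ^ 4 + b ^ 4) / (k * sqrt k) + (\<tau> - q)\<^sup>2 / (k\<^sup>2 * sqrt k) + (q - t) ^ 12 / k ^ 8)"
proof -
  define s where "s = sqrt k"
  define m where "m = \<bar>a * b\<bar>"
  define d where "d = \<bar>\<tau> - q\<bar>"
  define N where "N = a ^ 4 + b ^ 4"
  define F where "F = N / (k * s)"
  define G where "G = d\<^sup>2 / (k\<^sup>2 * s)"
  define H where "H = (q - t) ^ 12 / k ^ 8"
  have s: "s > 0" "s * s = k" "s \<le> k"
    using k by (auto simp: s_def real_le_lsqrt power2_eq_square)
  have k0: "k > 0" using k by simp
  have q0: "q > 0" using q k by (intro less_le_trans[OF _ q]) simp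
  have \<delta>k: "\<delta> * k > 0" using \<delta> k by simp
  have \<tau>0: "\<tau> > 0" using \<tau> \<delta>k by linarith
  have "2 * m\<^sup>2 \<le> N"
    using sum_squares_bound[of "a\<^sup>2" "b\<^sup>2"] by (simp add: N_def m_def power_mult_distrib)
  then have N: "m\<^sup>2 \<le> N" "N \<ge> 0" using zero_le_power2[of m] by linarith+
  have m0: "m \<ge> 0" and d0: "d \<ge> 0" by (auto simp: m_def d_def)
  have nn: "F \<ge> 0" "G \<ge> 0" "H \<ge> 0" using k s N by (auto simp: F_def G_def H_def)
  have C: "1 / \<delta>\<^sup>2 \<le> ratio_const \<delta>" "(1 + 1 / \<delta>) * (1 + (2 / \<delta>) ^ 12) \<le> ratio_const \<delta>"
    unfolding ratio_const_def using \<delta> by (auto intro!: add_nonneg_nonneg)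
  have "m * \<bar>1 / q - 1 / \<tau>\<bar> \<le> ratio_const \<delta> * (F + G + H)"
  proof (cases "q \<ge> t / 2")
    case True
    then have q2: "q \<ge> \<delta> * k / 2" using t by linarith
    have "1 / q - 1 / \<tau> = (\<tau> - q) / (q * \<tau>)"
      using q0 \<tau>0 by (simp add: field_simps)
    then have "\<bar>1 / q - 1 / \<tau>\<bar> = d / (q * \<tau>)"
      using q0 \<tau>0 by (simp add: d_def abs_mult)
    also have "\<dots> \<le> d / ((\<delta> * k / 2) * (\<delta> * k))"
      using q2 \<tau> \<delta>k q0 d0 by (intro frac_le mult_mono) auto
    also have "\<dots> = 2 * d / (\<delta>\<^sup>2 * k\<^sup>2)"
      using \<delta> k0 by (simp add: power2_eq_square field_simps)
    finally have "m * \<bar>1 / q - 1 / \<tau>\<bar> \<le> m * (2 * d / (\<delta>\<^sup>2 * k\<^sup>2))"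
      using m0 by (intro mult_left_mono) auto
    also have "\<dots> = (2 * m * d) / (\<delta>\<^sup>2 * k\<^sup>2)" by simp
    also have "\<dots> \<le> (s * N + d\<^sup>2 / s) / (\<delta>\<^sup>2 * k\<^sup>2)"
    proof (intro divide_right_mono)
      \<comment> \<open>The weight sqrt k balances m, of order 1, against d, of order sqrt
        k.\<close>
      have "2 * (s * m) * d \<le> (s * m)\<^sup>2 + d\<^sup>2" by (rule sum_squares_bound)
      also have "(s * m)\<^sup>2 \<le> s\<^sup>2 * N"
        unfolding power_mult_distrib using N by (intro mult_left_mono) auto
      finally have "s * (2 * m * d) \<le> s * (s * N + d\<^sup>2 / s)"
        using s(1) by (simp add: power2_eq_square distrib_left mult_ac)
      then show "2 * m * d \<le> s * N + d\<^sup>2 / s"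
        using s(1) by (simp only: mult_le_cancel_left_pos)
    qed simp
    also have "\<dots> = 1 / \<delta>\<^sup>2 * (F + G)"
    proof -
      have "s * N / k\<^sup>2 = F"
        using s(1) unfolding F_def s(2)[symmetric] by (simp add: power2_eq_square)
      moreover have "d\<^sup>2 / s / k\<^sup>2 = G"
        unfolding G_def by (simp add: mult.commute)
      ultimately have "(s * N + d\<^sup>2 / s) / k\<^sup>2 = F + G"
        by (simp add: add_divide_distrib)
      then show ?thesis
        by (metis divide_divide_eq_left mult.commute times_divide_eq_right mult_1)
    qed
    also have "\<dots> \<le> ratio_const \<delta> * (F + G + H)"
      using nn C(1) ratio_const_pos[OF \<delta>] by (intro mult_mono) auto
    finally show ?thesis .
  next
    case False
    define e where "e = (2 / \<delta>) ^ 12"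
    have e: "e \<ge> 0" using \<delta> by (simp add: e_def)
    have one: "1 \<le> e * (q - t) ^ 12 / k ^ 12"
      using large_deviation_ge_1[OF k \<delta> t] False by (simp add: e_def)
    have "1 / q \<le> k" using q k q0 by (simp add: field_simps)
    moreover have "1 / \<tau> \<le> 1 / (\<delta> * k)" using \<tau> \<delta>k by (intro frac_le) auto
    moreover have "1 / (\<delta> * k) \<le> k * (1 / \<delta>)"
    proof -
      have "1 / k \<le> k" using k mult_mono[of 1 k 1 k] by (simp add: divide_le_eq)
      then have "1 / \<delta> * (1 / k) \<le> 1 / \<delta> * k" using \<delta> by (intro mult_left_mono) auto
      then show ?thesis by (simp add: mult.commute)
    qed
    moreover have "1 / q > 0" "1 / \<tau> > 0" using q0 \<tau>0 by auto
    ultimately have "\<bar>1 / q - 1 / \<tau>\<bar> \<le> k + k * (1 / \<delta>)" unfolding abs_le_iff by linarith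
    then have "m * \<bar>1 / q - 1 / \<tau>\<bar> \<le> m * (k + k * (1 / \<delta>))"
      using m0 by (intro mult_left_mono) auto
    also have "\<dots> = (1 + 1 / \<delta>) * (k * m)" by (simp add: algebra_simps)
    also have "\<dots> \<le> (1 + 1 / \<delta>) * ((1 + e) * (F + G + H))"
    proof (intro mult_left_mono)
      \<comment> \<open>This weight makes the part with m small enough for \<open>F\<close>; the
        remaining k^4 is paid by the rarity of the event, since it is at most a multiple of
        \<open>H\<close>.\<close>
      have "2 * (m / k) * k\<^sup>2 \<le> (m / k)\<^sup>2 + (k\<^sup>2)\<^sup>2" by (rule sum_squares_bound)
      then have "2 * (k * m) \<le> m\<^sup>2 / k\<^sup>2 + k ^ 4"
        using k0 by (simp add: power_divide power2_eq_square power4_eq_xxxx mult_ac)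
      also have "m\<^sup>2 / k\<^sup>2 \<le> F"
        unfolding F_def
      proof (intro frac_le N)
        show "k * s \<le> k\<^sup>2" using s k by (simp add: power2_eq_square)
      qed (use s k in auto)
      also have "k ^ 4 \<le> e * H"
      proof -
        have "k ^ 4 * 1 \<le> k ^ 4 * (e * (q - t) ^ 12 / k ^ 12)"
          using one k by (intro mult_left_mono) auto
        also have "\<dots> = e * H"
        proof -
          have "p * (y / (p * r)) = y / r" if "p > 0" for p y r :: real
            using that by simp
          from this[of "k ^ 4" "e * (q - t) ^ 12" "k ^ 8"] show ?thesis
            using k0 unfolding H_def by (simp flip: power_add)
        qed
        finally show ?thesis by simp
      qed
      finally have "2 * (k * m) \<le> F + e * H" by simp
      moreover have "0 \<le> k * m" using k0 m0 by simp
      moreover have "(1 + e) * (F + G + H) = F + G + H + (e * F + e * G + e * H)"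
        by (simp add: algebra_simps)
      moreover have "e * F \<ge> 0" "e * G \<ge> 0" using e nn by auto
      ultimately show "k * m \<le> (1 + e) * (F + G + H)" using nn by linarith
    qed (use \<delta> in simp)
    also have "\<dots> \<le> ratio_const \<delta> * (F + G + H)"
      unfolding mult.assoc[symmetric] e_def using nn C(2) by (intro mult_right_mono) auto
    finally show ?thesis .
  qed
  then show ?thesis
    by (simp add: m_def F_def G_def H_def N_def d_def s_def abs_mult)
qed

text \<open>With z = y^2 / k this is k z <= k (1 + z^6). It yields the correct order k for the
  second moment from the twelfth moment without an interpolation inequality.\<close>

lemma square_le_power12:
  fixes y k :: real
  assumes "k \<ge> 1"
  shows "y\<^sup>2 \<le> k + y ^ 12 / k ^ 5"
proof (cases "y\<^sup>2 \<le> k")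
  case True
  then show ?thesis using assms by (simp add: add_increasing2)
next
  case False
  define z where "z = y\<^sup>2 / k"
  have z: "z \<ge> 1" using False assms by (simp add: z_def)
  have "z ^ 1 \<le> z ^ 6" by (rule power_increasing) (use z in auto)
  then have "k * z \<le> k * z ^ 6" using assms by simp
  moreover have "k * z = y\<^sup>2" using assms by (simp add: z_def)
  moreover have "k * z ^ 6 = y ^ 12 / k ^ 5"
    using assms by (simp add: z_def power_divide field_simps eval_nat_numeral)
  ultimately show ?thesis using assms by linarith
qed

context random_rows
begin

lemma Q_bilinear: "v \<in> carrier_vec n \<Longrightarrow> (Q i w *\<^sub>v v) \<bullet> x w i = x w i \<bullet> (Q i w *\<^sub>v v)"
  by (rule comm_scalar_prod[of _ n]) auto

definition \<beta> :: real where "\<beta> = c * \<rho> ^ 6"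

text \<open>Two fourth moments contribute 2 (4 + 2 c). The mean of (\<tau> - q)^2 contributes 3 (3 +
  \<beta>), and the exceptional event one further \<beta>.\<close>

definition ratio_error :: real where
  "ratio_error = ratio_const \<delta> * (2 * (4 + 2 * c) + 9 + 4 * \<beta>)"

lemma \<beta>_nonneg: "\<beta> \<ge> 0"
  using c \<rho> by (simp add: \<beta>_def)

lemma ratio_error_nonneg: "ratio_error \<ge> 0"
  unfolding ratio_error_def using ratio_const_pos[OF \<delta>_pos] c \<beta>_nonneg by simp

text \<open>The rate k^(-3/2) for one row is what leaves 1 / sqrt k after summing over k
  rows.\<close>

lemma ratio_estimate:
  assumes i: "i < k" and U: "test_vec i U" and V: "test_vec i V"
  defines "F \<equiv> \<lambda>w. (U w \<bullet> x w i) * (V w \<bullet> x w i) * (1 / q i w - 1 / \<tau>)"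
  shows "integrable Om F" and "\<bar>\<integral>w. F w \<partial>Om\<bar> \<le> ratio_error / (real k * sqrt (real k))"
proof -
  define K where "K = real k"
  define s where "s = sqrt K"
  have K: "K \<ge> 1" "K > 0" using k by (auto simp: K_def)
  have s: "s > 0" "s * s = K" "s \<le> K"
    using K by (auto simp: s_def real_le_lsqrt power2_eq_square)
  define Y where "Y w = (q i w - t i w) ^ 12" for w
  define a where "a w = (U w \<bullet> x w i) ^ 4" for w
  define b where "b w = (V w \<bullet> x w i) ^ 4" for w
  define Va where "Va w = (T w - \<tau>)\<^sup>2" for w
  define G where "G w = ratio_const \<delta> *
    ((a w + b w) / (K * s) + 3 * (K + Y w / K ^ 5 + 1 + Va w) / (K\<^sup>2 * s) + Y w / K ^ 8)" for w
  have rc: "ratio_const \<delta> > 0" by (rule ratio_const_pos[OF \<delta>_pos])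
  have Y: "integrable Om Y" "(\<integral>w. Y w \<partial>Om) \<le> \<beta> * K ^ 6"
    using quadratic_moment[OF i] by (auto simp: Y_def[abs_def] \<beta>_def K_def)
  have a: "integrable Om a" "(\<integral>w. a w \<partial>Om) \<le> 4 + 2 * c"
    using linear_moment[OF i U] by (auto simp: a_def[abs_def])
  have b: "integrable Om b" "(\<integral>w. b w \<partial>Om) \<le> 4 + 2 * c"
    using linear_moment[OF i V] by (auto simp: b_def[abs_def])
  have Va: "integrable Om Va" "(\<integral>w. Va w \<partial>Om) \<le> K"
    using T_variance_int T_variance by (auto simp: Va_def[abs_def] K_def)
  have pt: "\<bar>F w\<bar> \<le> G w" for w
  proof -
    have "\<bar>F w\<bar> \<le> ratio_const \<delta> * ((a w + b w) / (K * s) + (\<tau> - q i w)\<^sup>2 / (K\<^sup>2 * s) + Y w / K ^ 8)"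
      unfolding F_def a_def b_def Y_def s_def
      using ratio_pointwise[OF K(1) \<delta>_pos, of "q i w" "t i w" \<tau> "U w \<bullet> x w i" "V w \<bullet> x w i"]
        q_pos(1)[OF i, of w] trace_bounds(1)[OF i, of w] \<tau>_bounds(1) by (simp add: K_def l_def)
    also have "\<dots> \<le> G w"
      unfolding G_def
    proof (intro mult_left_mono add_mono divide_right_mono order_refl)
      \<comment> \<open>Three sources of fluctuation: row i given the others (q - t), the effect of
        leaving row i out (t - T), and the randomness of the full trace (T - \<tau>).\<close>
      have le: "(\<tau> - q i w)\<^sup>2 \<le> 3 * ((q i w - t i w)\<^sup>2 + (t i w - T w)\<^sup>2 + (T w - \<tau>)\<^sup>2)"
      proof -
        have "(\<tau> - q i w)\<^sup>2 = ((q i w - t i w) + (t i w - T w) + (T w - \<tau>))\<^sup>2"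
          by (simp add: power2_eq_square algebra_simps)
        also have "\<dots> \<le> 3 * ((q i w - t i w)\<^sup>2 + (t i w - T w)\<^sup>2 + (T w - \<tau>)\<^sup>2)"
        proof -
          have "(p + r + u)\<^sup>2 \<le> 3 * (p\<^sup>2 + r\<^sup>2 + u\<^sup>2)" for p r u :: real
            using sum_squares_bound[of p r] sum_squares_bound[of p u] sum_squares_bound[of r u]
            by (simp add: power2_eq_square algebra_simps)
          then show ?thesis .
        qed
        finally show ?thesis .
      qed
      have "(t i w - T w)\<^sup>2 \<le> 1"
        using trace_bounds(5)[OF i, of w] by (simp add: abs_square_le_1)
      moreover have "(q i w - t i w)\<^sup>2 \<le> K + Y w / K ^ 5"
        unfolding Y_def by (rule square_le_power12[OF K(1)])
      ultimately have "(q i w - t i w)\<^sup>2 + (t i w - T w)\<^sup>2 + (T w - \<tau>)\<^sup>2 \<le> K + Y w / K ^ 5 + 1 + Va w"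
        unfolding Va_def by (intro add_mono order_refl)
      then show "(\<tau> - q i w)\<^sup>2 \<le> 3 * (K + Y w / K ^ 5 + 1 + Va w)"
        by (intro order_trans[OF le] mult_left_mono) auto
    qed (use rc K s in auto)
    finally show ?thesis .
  qed
  have G: "integrable Om G"
    unfolding G_def[abs_def] using a b Y Va by (auto intro!: Bochner_Integration.integrable_add)
  have "(\<lambda>w. F w) \<in> borel_measurable Om"
    unfolding F_def using linear_measurable[OF i U] linear_measurable[OF i V] borel_measurable_qtT(3)[OF i]
    by measurable
  then show Fi: "integrable Om F"
    using order_trans[OF pt abs_ge_self] by (intro Bochner_Integration.integrable_bound[OF G]) auto
  have "\<bar>\<integral>w. F w \<partial>Om\<bar> \<le> (\<integral>w. \<bar>F w\<bar> \<partial>Om)" by (rule integral_abs_bound)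
  also have "\<dots> \<le> (\<integral>w. G w \<partial>Om)" using Fi G pt by (intro integral_mono) auto
  also have "\<dots> = ratio_const \<delta> * (((\<integral>w. a w \<partial>Om) + (\<integral>w. b w \<partial>Om)) / (K * s) +
      3 * (K + (\<integral>w. Y w \<partial>Om) / K ^ 5 + 1 + (\<integral>w. Va w \<partial>Om)) / (K\<^sup>2 * s) + (\<integral>w. Y w \<partial>Om) / K ^ 8)"
    unfolding G_def[abs_def] using a b Y Va by (simp add: Om.prob_space)
  also have "\<dots> \<le> ratio_const \<delta> * ((2 * (4 + 2 * c)) / (K * s) + (9 + 3 * \<beta>) / (K * s) + \<beta> / (K * s))"
  proof (intro mult_left_mono add_mono)
    show "((\<integral>w. a w \<partial>Om) + (\<integral>w. b w \<partial>Om)) / (K * s) \<le> 2 * (4 + 2 * c) / (K * s)"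
      using a b K s by (intro divide_right_mono) auto
    have "(\<integral>w. Y w \<partial>Om) / K ^ 5 \<le> \<beta> * K"
      using Y(2) K by (simp add: divide_le_eq mult.assoc flip: power_Suc)
    then have "K + (\<integral>w. Y w \<partial>Om) / K ^ 5 + 1 + (\<integral>w. Va w \<partial>Om) \<le> K + \<beta> * K + K + K"
      using Va(2) K(1) by (intro add_mono order_refl)
    then have "3 * (K + (\<integral>w. Y w \<partial>Om) / K ^ 5 + 1 + (\<integral>w. Va w \<partial>Om)) \<le> 3 * (K + \<beta> * K + K + K)"
      by (intro mult_left_mono) auto
    also have "\<dots> = (9 + 3 * \<beta>) * K" by (simp add: algebra_simps)
    finally have "3 * (K + (\<integral>w. Y w \<partial>Om) / K ^ 5 + 1 + (\<integral>w. Va w \<partial>Om)) \<le> (9 + 3 * \<beta>) * K" .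
    then have "3 * (K + (\<integral>w. Y w \<partial>Om) / K ^ 5 + 1 + (\<integral>w. Va w \<partial>Om)) / (K\<^sup>2 * s) \<le> (9 + 3 * \<beta>) * K / (K\<^sup>2 * s)"
      using K s by (intro divide_right_mono) auto
    then show "3 * (K + (\<integral>w. Y w \<partial>Om) / K ^ 5 + 1 + (\<integral>w. Va w \<partial>Om)) / (K\<^sup>2 * s) \<le> (9 + 3 * \<beta>) / (K * s)"
      using K by (simp add: power2_eq_square)
    have "(\<integral>w. Y w \<partial>Om) / K ^ 8 \<le> \<beta> * K ^ 6 / K ^ 8"
      using Y K by (intro divide_right_mono) auto
    also have "\<dots> = \<beta> / (K * K)"
      using K by (simp add: eval_nat_numeral)
    also have "\<dots> \<le> \<beta> / (K * s)"
      using s K \<beta>_nonneg by (intro frac_le) auto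
    finally show "(\<integral>w. Y w \<partial>Om) / K ^ 8 \<le> \<beta> / (K * s)" .
  qed (use rc in auto)
  also have "\<dots> = ratio_error / (K * s)"
    unfolding ratio_error_def by (simp add: add_divide_distrib[symmetric] algebra_simps)
  finally show "\<bar>\<integral>w. F w \<partial>Om\<bar> \<le> ratio_error / (real k * sqrt (real k))"
    by (simp add: K_def s_def)
qed

lemma product_integrable:
  assumes i: "i < k" and U: "test_vec i U" and V: "test_vec i V"
  shows "integrable Om (\<lambda>w. (U w \<bullet> x w i) * (V w \<bullet> x w i))"
    and "\<bar>\<integral>w. (U w \<bullet> x w i) * (V w \<bullet> x w i) \<partial>Om\<bar> \<le> 5 + 2 * c"
proof -
  let ?a = "\<lambda>w. U w \<bullet> x w i" and ?b = "\<lambda>w. V w \<bullet> x w i"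
  define G where "G w = 1 + (?a w ^ 4 + ?b w ^ 4) / 2" for w
  have G: "integrable Om G"
    unfolding G_def[abs_def] using linear_moment(1)[OF i U] linear_moment(1)[OF i V] by simp
  have pt: "\<bar>?a w * ?b w\<bar> \<le> G w" for w
  proof -
    have "2 * \<bar>?a w * ?b w\<bar> \<le> (?a w)\<^sup>2 + (?b w)\<^sup>2"
      using sum_squares_bound[of "\<bar>?a w\<bar>" "\<bar>?b w\<bar>"] by (simp add: abs_mult)
    moreover have "z\<^sup>2 \<le> 1 + z ^ 4" for z :: real
    proof -
      have "2 * z\<^sup>2 \<le> z ^ 4 + 1" using sum_squares_bound[of "z\<^sup>2" 1] by simp
      then show ?thesis using zero_le_power2[of z] by linarith
    qed
    from this[of "?a w"] this[of "?b w"] have "(?a w)\<^sup>2 + (?b w)\<^sup>2 \<le> 2 * G w"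
      unfolding G_def by (simp add: field_simps)
    ultimately show ?thesis by linarith
  qed
  show I: "integrable Om (\<lambda>w. ?a w * ?b w)"
    using order_trans[OF pt abs_ge_self] linear_measurable[OF i U] linear_measurable[OF i V]
    by (intro Bochner_Integration.integrable_bound[OF G]) auto
  have "\<bar>\<integral>w. ?a w * ?b w \<partial>Om\<bar> \<le> (\<integral>w. \<bar>?a w * ?b w\<bar> \<partial>Om)" by (rule integral_abs_bound)
  also have "\<dots> \<le> (\<integral>w. G w \<partial>Om)" using I G pt by (intro integral_mono) auto
  also have "\<dots> = 1 + ((\<integral>w. ?a w ^ 4 \<partial>Om) + (\<integral>w. ?b w ^ 4 \<partial>Om)) / 2"
    unfolding G_def[abs_def] using linear_moment(1)[OF i U] linear_moment(1)[OF i V] by (simp add: Om.prob_space)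
  also have "\<dots> \<le> 5 + 2 * c"
    using linear_moment(2)[OF i U] linear_moment(2)[OF i V] by simp
  finally show "\<bar>\<integral>w. ?a w * ?b w \<partial>Om\<bar> \<le> 5 + 2 * c" .
qed

lemma covariance_D:
  assumes u: "u \<in> carrier_vec n" and v: "v \<in> carrier_vec n"
  shows "(\<integral>y. (u \<bullet> (A *\<^sub>v vec n y)) * (v \<bullet> (A *\<^sub>v vec n y)) \<partial>D) = ((A * A) *\<^sub>v u) \<bullet> v"
proof -
  define a where "a = A *\<^sub>v u"
  define b where "b = A *\<^sub>v v"
  have ab: "a \<in> carrier_vec n" "b \<in> carrier_vec n" using A u v by (auto simp: a_def b_def)
  have "(u \<bullet> (A *\<^sub>v vec n y)) * (v \<bullet> (A *\<^sub>v vec n y)) = (\<Sum>i<n. \<Sum>j<n. a $ i * b $ j * (y i * y j))" for y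
    using mult_A_scalar[OF u, of "vec n y"] mult_A_scalar[OF v, of "vec n y"]
    by (simp add: a_def[symmetric] b_def[symmetric] scalar_prod_def lessThan_atLeast0 sum_product mult_ac)
  then have "(\<integral>y. (u \<bullet> (A *\<^sub>v vec n y)) * (v \<bullet> (A *\<^sub>v vec n y)) \<partial>D)
    = (\<integral>y. (\<Sum>i<n. \<Sum>j<n. a $ i * b $ j * (y i * y j)) \<partial>D)" by simp
  also have "\<dots> = (\<Sum>i<n. \<Sum>j<n. a $ i * b $ j * (if i = j then 1 else 0))"
  proof -
    have "(\<integral>y. (\<Sum>i<n. \<Sum>j<n. a $ i * b $ j * (y i * y j)) \<partial>D) = (\<Sum>i<n. \<integral>y. (\<Sum>j<n. a $ i * b $ j * (y i * y j)) \<partial>D)"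
      using cov_int by (intro Bochner_Integration.integral_sum Bochner_Integration.integrable_sum integrable_mult_right) auto
    also have "\<dots> = (\<Sum>i<n. \<Sum>j<n. \<integral>y. a $ i * b $ j * (y i * y j) \<partial>D)"
      using cov_int by (intro sum.cong refl Bochner_Integration.integral_sum integrable_mult_right) auto
    also have "\<dots> = (\<Sum>i<n. \<Sum>j<n. a $ i * b $ j * (if i = j then 1 else 0))"
      using cov by (intro sum.cong refl) (auto simp del: mult_eq_0_iff)
    finally show ?thesis .
  qed
  also have "\<dots> = a \<bullet> b"
    using ab by (simp add: if_distrib sum.delta scalar_prod_def lessThan_atLeast0 cong: if_cong)
  also have "\<dots> = ((A * A) *\<^sub>v u) \<bullet> v"
    using mult_A_scalar[of a v] ab A u v by (simp add: a_def b_def assoc_mult_mat_vec[of _ n n _ n])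
  finally show ?thesis .
qed

end

lemma scalar_prod_abs_le_1:
  fixes u v :: "real vec"
  assumes "u \<in> carrier_vec n" "v \<in> carrier_vec n" "u \<bullet> u \<le> 1" "v \<bullet> v \<le> 1"
  shows "\<bar>u \<bullet> v\<bar> \<le> 1"
proof -
  have "(u \<bullet> v)\<^sup>2 \<le> (u \<bullet> u) * (v \<bullet> v)" by (rule scalar_prod_Cauchy_Schwarz[OF assms(1,2)])
  also have "\<dots> \<le> 1"
    using assms scalar_prod_self_nonneg[of u] scalar_prod_self_nonneg[of v] by (simp add: mult_le_one)
  finally show ?thesis by (simp add: abs_square_le_1)
qed

section \<open>The averaged resolvent equation\<close>

context random_rows
begin

lemma AA_contr:
  assumes "u \<in> carrier_vec n" "u \<bullet> u \<le> 1"
  shows "(A * A) *\<^sub>v u \<in> carrier_vec n" "((A * A) *\<^sub>v u) \<bullet> ((A * A) *\<^sub>v u) \<le> 1"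
proof -
  have Au: "A *\<^sub>v u \<in> carrier_vec n" using A assms by simp
  have "(A * A) *\<^sub>v u = A *\<^sub>v (A *\<^sub>v u)" using A assms by (simp add: assoc_mult_mat_vec[of _ n n _ n])
  then show "(A * A) *\<^sub>v u \<in> carrier_vec n" "((A * A) *\<^sub>v u) \<bullet> ((A * A) *\<^sub>v u) \<le> 1"
    using contr[OF Au] contr[OF assms(1)] assms A by auto
qed

lemma P_form:
  assumes u: "u \<in> carrier_vec n" "u \<bullet> u \<le> 1" and v: "v \<in> carrier_vec n" "v \<bullet> v \<le> 1"
  shows "integrable Om (\<lambda>w. u \<bullet> (P w *\<^sub>v v))" and "integrable Om (\<lambda>w. u \<bullet> (Q i w *\<^sub>v v))"
    and "\<bar>u \<bullet> (P w *\<^sub>v v)\<bar> \<le> 1"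
proof -
  have P: "(P w *\<^sub>v v) \<bullet> (P w *\<^sub>v v) \<le> 1" and Q: "(Q i w *\<^sub>v v) \<bullet> (Q i w *\<^sub>v v) \<le> 1" for w
    using ridge_family.ridge_on_quadratic(3)[OF ridge_family_axioms, of "{..<k}" v w]
      ridge_family.ridge_on_quadratic(3)[OF ridge_family_axioms, of "{..<k} - {i}" v w] v
    by (auto simp: P_def Q_def)
  have b: "\<bar>u \<bullet> (P w *\<^sub>v v)\<bar> \<le> 1" "\<bar>u \<bullet> (Q i w *\<^sub>v v)\<bar> \<le> 1" for w
    using scalar_prod_abs_le_1[OF u(1) _ u(2)] P[of w] Q[of w] by auto
  then show "\<bar>u \<bullet> (P w *\<^sub>v v)\<bar> \<le> 1" by simp
  have m: "(\<lambda>w. u \<bullet> (P w *\<^sub>v v)) \<in> borel_measurable Om" "(\<lambda>w. u \<bullet> (Q i w *\<^sub>v v)) \<in> borel_measurable Om"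
    using u v by (auto intro!: borel_measurable_scalar_prod[of _ n] vec_measurable_mult_mat_vec[of _ n n]
        vec_measurable_const mat_measurable_P mat_measurable_Q)
  show "integrable Om (\<lambda>w. u \<bullet> (P w *\<^sub>v v))" "integrable Om (\<lambda>w. u \<bullet> (Q i w *\<^sub>v v))"
    using b m by (auto intro!: Om.integrable_const_bound[where B = 1])
qed

text \<open>Integrate out row i first. Both sides have the same conditional mean because
  \<open>Q i\<close> is fixed and the row has covariance A A.\<close>

lemma covariance:
  assumes i: "i < k" and u: "u \<in> carrier_vec n" "u \<bullet> u \<le> 1" and v: "v \<in> carrier_vec n" "v \<bullet> v \<le> 1"
  shows "(\<integral>w. (u \<bullet> x w i) * ((Q i w *\<^sub>v v) \<bullet> x w i) \<partial>Om) = (\<integral>w. ((A * A) *\<^sub>v u) \<bullet> (Q i w *\<^sub>v v) \<partial>Om)"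
proof (rule PiM_integral_coordinate_eq[OF D])
  show "integrable Om (\<lambda>w. (u \<bullet> x w i) * ((Q i w *\<^sub>v v) \<bullet> x w i))"
    by (rule product_integrable(1)[OF i test_vec_const[OF u] test_vec_Q[OF v]])
  show "integrable Om (\<lambda>w. ((A * A) *\<^sub>v u) \<bullet> (Q i w *\<^sub>v v))"
    by (rule P_form(2)[OF AA_contr[OF u] v])
  fix w
  show "(\<integral>y. (u \<bullet> x (w(i := y)) i) * ((Q i (w(i := y)) *\<^sub>v v) \<bullet> x (w(i := y)) i) \<partial>D)
      = (\<integral>y. ((A * A) *\<^sub>v u) \<bullet> (Q i (w(i := y)) *\<^sub>v v) \<partial>D)"
    unfolding x_upd Q_upd covariance_D[OF u(1) Q_carrier(2)] by (simp add: D.prob_space)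
qed (use i in auto)

definition resolvent_error :: real where
  "resolvent_error = ratio_error * (1 + 1 / \<delta>) + (5 + 2 * c) / \<delta>\<^sup>2"

text \<open>The same replacement of 1 / q by 1 / \<tau> is made twice: in the expansion of I - P,
  and, at A A u, in the difference between \<open>Q i\<close> and \<open>P\<close>. The bound is
  bilinear, with separate u and v, because it is later tested at a u obtained from v by a
  resolvent.\<close>

lemma resolvent_estimate_form:
  assumes u: "u \<in> carrier_vec n" "u \<bullet> u \<le> 1" and v: "v \<in> carrier_vec n" "v \<bullet> v \<le> 1"
  shows "\<bar>u \<bullet> v - (\<integral>w. u \<bullet> (P w *\<^sub>v v) \<partial>Om) - real k / \<tau> * (\<integral>w. ((A * A) *\<^sub>v u) \<bullet> (P w *\<^sub>v v) \<partial>Om)\<bar>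
    \<le> resolvent_error / sqrt (real k)"
proof -
  define K where "K = real k"
  define s where "s = sqrt K"
  have K: "K \<ge> 1" "K > 0" using k by (auto simp: K_def)
  have s: "s > 0" "s * s = K" "s \<le> K"
    using K by (auto simp: s_def real_le_lsqrt power2_eq_square)
  define u' where "u' = (A * A) *\<^sub>v u"
  have u': "u' \<in> carrier_vec n" "u' \<bullet> u' \<le> 1" using AA_contr[OF u] by (auto simp: u'_def)
  \<comment> \<open>Unprimed quantities belong to the expansion of I - P and primed ones to Q_i - P.
    In each pair \<open>F\<close> is the error from exchanging 1 / q for 1 / \<tau> in the product
    \<open>E\<close>.\<close>
  define E where "E i w = (u \<bullet> x w i) * ((Q i w *\<^sub>v v) \<bullet> x w i)" for i w
  define F where "F i w = E i w * (1 / q i w - 1 / \<tau>)" for i w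
  define E' where "E' i w = ((Q i w *\<^sub>v u') \<bullet> x w i) * ((Q i w *\<^sub>v v) \<bullet> x w i)" for i w
  define F' where "F' i w = E' i w * (1 / q i w - 1 / \<tau>)" for i w
  have E: "integrable Om (E i)" if "i < k" for i
    using product_integrable(1)[OF that test_vec_const[OF u] test_vec_Q[OF v]] by (simp add: E_def[abs_def])
  have E': "integrable Om (E' i)" "\<bar>\<integral>w. E' i w \<partial>Om\<bar> \<le> 5 + 2 * c" if "i < k" for i
    using product_integrable[OF that test_vec_Q[OF u'] test_vec_Q[OF v]] by (auto simp: E'_def[abs_def])
  have F: "integrable Om (F i)" "\<bar>\<integral>w. F i w \<partial>Om\<bar> \<le> ratio_error / (K * s)" if "i < k" for i
    using ratio_estimate[OF that test_vec_const[OF u] test_vec_Q[OF v]]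
    by (auto simp: F_def[abs_def] E_def K_def s_def)
  have F': "integrable Om (F' i)" "\<bar>\<integral>w. F' i w \<partial>Om\<bar> \<le> ratio_error / (K * s)" if "i < k" for i
    using ratio_estimate[OF that test_vec_Q[OF u'] test_vec_Q[OF v]]
    by (auto simp: F'_def[abs_def] E'_def K_def s_def)
  define g where "g = (\<integral>w. u' \<bullet> (P w *\<^sub>v v) \<partial>Om)"
  have expand: "u \<bullet> v - u \<bullet> (P w *\<^sub>v v) = (\<Sum>i<k. F i w + E i w / \<tau>)" for w
    using ridge_family.ridge_on_expansion[OF ridge_family_axioms u(1) v(1), of w]
    by (simp add: P_def[symmetric] Q_def[symmetric] F_def E_def q_def[symmetric] Q_bilinear[OF v(1)] algebra_simps)
  have diff: "u' \<bullet> (Q i w *\<^sub>v v) = u' \<bullet> (P w *\<^sub>v v) + (F' i w + E' i w / \<tau>)" if "i < k" for i w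
    using ridge_family.ridge_on_diff[OF ridge_family_axioms _ u'(1) v(1), of i w] that
    by (simp add: P_def[symmetric] Q_def[symmetric] F'_def E'_def q_def[symmetric] Q_bilinear[OF v(1)] algebra_simps)
  have IE: "(\<integral>w. E i w \<partial>Om) = g + ((\<integral>w. F' i w \<partial>Om) + (\<integral>w. E' i w \<partial>Om) / \<tau>)" if i: "i < k" for i
  proof -
    have "(\<integral>w. E i w \<partial>Om) = (\<integral>w. u' \<bullet> (Q i w *\<^sub>v v) \<partial>Om)"
      using covariance[OF i u v] by (simp add: E_def[abs_def] u'_def)
    also have "\<dots> = (\<integral>w. u' \<bullet> (P w *\<^sub>v v) + (F' i w + E' i w / \<tau>) \<partial>Om)"
      unfolding diff[OF i] ..
    also have "\<dots> = g + ((\<integral>w. F' i w \<partial>Om) + (\<integral>w. E' i w \<partial>Om) / \<tau>)"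
      using P_form(1)[OF u' v] F'(1)[OF i] E'(1)[OF i] by (simp add: g_def)
    finally show ?thesis .
  qed
  have "u \<bullet> v - (\<integral>w. u \<bullet> (P w *\<^sub>v v) \<partial>Om) = (\<integral>w. u \<bullet> v - u \<bullet> (P w *\<^sub>v v) \<partial>Om)"
    using P_form(1)[OF u v] by (simp add: Om.prob_space)
  also have "\<dots> = (\<Sum>i<k. (\<integral>w. F i w \<partial>Om) + (\<integral>w. E i w \<partial>Om) / \<tau>)"
    unfolding expand using F E by (subst Bochner_Integration.integral_sum) auto
  also have "\<dots> = (\<Sum>i<k. g / \<tau> + ((\<integral>w. F i w \<partial>Om) + ((\<integral>w. F' i w \<partial>Om) + (\<integral>w. E' i w \<partial>Om) / \<tau>) / \<tau>))"
    by (intro sum.cong refl) (simp add: IE add_divide_distrib)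
  also have "\<dots> = K / \<tau> * g + (\<Sum>i<k. (\<integral>w. F i w \<partial>Om) + ((\<integral>w. F' i w \<partial>Om) + (\<integral>w. E' i w \<partial>Om) / \<tau>) / \<tau>)"
    unfolding sum.distrib[of "\<lambda>_. g / \<tau>"] by (simp add: K_def)
  finally have eq: "u \<bullet> v - (\<integral>w. u \<bullet> (P w *\<^sub>v v) \<partial>Om) - K / \<tau> * g
    = (\<Sum>i<k. (\<integral>w. F i w \<partial>Om) + ((\<integral>w. F' i w \<partial>Om) + (\<integral>w. E' i w \<partial>Om) / \<tau>) / \<tau>)"
    by simp
  define r where "r = ratio_error / (K * s)"
  have r: "r \<ge> 0" using ratio_error_nonneg K s by (simp add: r_def)
  have dK: "\<delta> * K > 0" "\<delta> * K \<le> \<tau>" using \<tau>_bounds(1) \<delta>_pos K by (auto simp: K_def)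
  have summand: "\<bar>(\<integral>w. F i w \<partial>Om) + ((\<integral>w. F' i w \<partial>Om) + (\<integral>w. E' i w \<partial>Om) / \<tau>) / \<tau>\<bar>
      \<le> r + (r + (5 + 2 * c) / (\<delta> * K)) / (\<delta> * K)" if i: "i < k" for i
  proof -
    have "\<bar>(\<integral>w. E' i w \<partial>Om) / \<tau>\<bar> \<le> (5 + 2 * c) / (\<delta> * K)"
      using E'(2)[OF i] \<tau>_bounds(3) dK c unfolding abs_divide by (intro frac_le) auto
    then have "\<bar>(\<integral>w. F' i w \<partial>Om) + (\<integral>w. E' i w \<partial>Om) / \<tau>\<bar> \<le> r + (5 + 2 * c) / (\<delta> * K)"
      using F'(2)[OF i] unfolding r_def by linarith
    then have "\<bar>((\<integral>w. F' i w \<partial>Om) + (\<integral>w. E' i w \<partial>Om) / \<tau>) / \<tau>\<bar> \<le> (r + (5 + 2 * c) / (\<delta> * K)) / (\<delta> * K)"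
      using \<tau>_bounds(3) dK c r unfolding abs_divide by (intro frac_le) auto
    then show ?thesis using F(2)[OF i] unfolding r_def by linarith
  qed
  have "\<bar>u \<bullet> v - (\<integral>w. u \<bullet> (P w *\<^sub>v v) \<partial>Om) - K / \<tau> * g\<bar> \<le> (\<Sum>i<k. r + (r + (5 + 2 * c) / (\<delta> * K)) / (\<delta> * K))"
    unfolding eq using summand by (intro order_trans[OF sum_abs] sum_mono) auto
  also have "\<dots> = K * (r + (r + (5 + 2 * c) / (\<delta> * K)) / (\<delta> * K))"
    by (simp add: K_def)
  also have "\<dots> = ratio_error / s + ratio_error / \<delta> / (K * s) + (5 + 2 * c) / \<delta>\<^sup>2 / K"
    using K s \<delta>_pos unfolding r_def by (simp add: field_simps power2_eq_square)
  also have "\<dots> \<le> ratio_error / s + ratio_error / \<delta> / s + (5 + 2 * c) / \<delta>\<^sup>2 / s"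
    using K s \<delta>_pos ratio_error_nonneg c by (intro add_mono order_refl divide_left_mono) auto
  also have "\<dots> = resolvent_error / s"
    unfolding resolvent_error_def by (simp add: add_divide_distrib distrib_left)
  finally show ?thesis by (simp add: K_def s_def g_def u'_def)
qed

end

lemma mat_trace_comm:
  fixes A B :: "real mat"
  assumes "A \<in> carrier_mat m n" "B \<in> carrier_mat n m"
  shows "mat_trace (A * B) = mat_trace (B * A)"
proof -
  have "mat_trace (A * B) = (\<Sum>i<m. \<Sum>j<n. A $$ (i, j) * B $$ (j, i))"
    using assms by (auto simp: mat_trace_def scalar_prod_def lessThan_atLeast0 intro!: sum.cong)
  also have "\<dots> = (\<Sum>j<n. \<Sum>i<m. B $$ (j, i) * A $$ (i, j))"
    by (subst sum.swap) (simp add: mult.commute)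
  also have "\<dots> = mat_trace (B * A)"
    using assms by (auto simp: mat_trace_def scalar_prod_def lessThan_atLeast0 intro!: sum.cong)
  finally show ?thesis .
qed

lemma mat_trace_diag_conj:
  fixes U :: "real mat"
  assumes "U \<in> carrier_mat n n" "U\<^sup>T * U = 1\<^sub>m n"
  shows "mat_trace (U * mat_diag n d * U\<^sup>T) = (\<Sum>i<n. d i)"
proof -
  have c: "U * mat_diag n d \<in> carrier_mat n n" "U\<^sup>T \<in> carrier_mat n n"
    using assms by (auto intro: mult_carrier_mat[of _ n n])
  have "mat_trace (U * mat_diag n d * U\<^sup>T) = mat_trace (U\<^sup>T * (U * mat_diag n d))"
    by (rule mat_trace_comm[OF c])
  also have "U\<^sup>T * (U * mat_diag n d) = mat_diag n d"
    using assms c left_mult_one_mat[OF mat_diag_dim[of n d]] by (simp flip: assoc_mult_mat[of _ n n _ n _ n])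
  finally show ?thesis by (simp add: mat_trace_def mat_diag_def)
qed

text \<open>Each eigenvalue is at most the sum of all. This converts control of a trace into control
  in operator norm.\<close>

lemma psd_quadratic_le_trace:
  assumes M: "psd_mat n M" and v: "v \<in> carrier_vec n"
  shows "v \<bullet> (M *\<^sub>v v) \<le> mat_trace M * (v \<bullet> v)"
proof -
  obtain U d where U: "U \<in> carrier_mat n n" "U\<^sup>T * U = 1\<^sub>m n" "U * U\<^sup>T = 1\<^sub>m n"
    "M = U * mat_diag n d * U\<^sup>T" and d: "\<And>i. i < n \<Longrightarrow> d i \<ge> 0"
    using psd_diagonalization[OF M] by metis
  have "v \<bullet> (M *\<^sub>v v) = (\<Sum>i<n. d i * ((U\<^sup>T *\<^sub>v v) $ i)\<^sup>2)"
    unfolding U(4) by (rule psd_mat_diag_conj(3)[OF U(1,2) v])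
  also have "\<dots> \<le> (\<Sum>i<n. (\<Sum>j<n. d j) * ((U\<^sup>T *\<^sub>v v) $ i)\<^sup>2)"
  proof (intro sum_mono mult_right_mono)
    fix i assume "i \<in> {..<n}"
    then show "d i \<le> (\<Sum>j<n. d j)" using d by (intro member_le_sum) auto
  qed simp
  also have "\<dots> = mat_trace M * (v \<bullet> v)"
    using mat_trace_diag_conj[OF U(1,2)] orthogonal_mat_norm[OF U(1,3) v] U(4)
    by (simp flip: sum_distrib_left)
  finally show ?thesis .
qed

subsection \<open>The pseudoinverse and the limit of the ridge resolvent\<close>

text \<open>Invert the nonzero eigenvalues of the Gram matrix G = X^T X to get H, and take H X^T.
  Three of the Penrose equations are computations with H and G; the remaining one, X B X = X, uses
  that G and X have the same kernel.\<close>

lemma pseudoinverse_exists: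
  fixes X :: "real mat"
  assumes X: "X \<in> carrier_mat k n"
  shows "\<exists>B. is_pseudoinverse X B"
proof -
  define G where "G = X\<^sup>T * X"
  have tX: "X\<^sup>T \<in> carrier_mat n k" using X by simp
  have G: "G \<in> carrier_mat n n" using X by (simp add: G_def)
  have "G\<^sup>T = G" using X by (simp add: G_def transpose_mult[of _ n k _ n])
  then obtain U d where U: "U \<in> carrier_mat n n" "U\<^sup>T * U = 1\<^sub>m n" "U * U\<^sup>T = 1\<^sub>m n"
    "G = U * mat_diag n d * U\<^sup>T"
    using real_symmetric_diagonalization[OF G] by blast
  define e where "e i = (if d i = 0 then 0 else 1 / d i)" for i
  define H where "H = U * mat_diag n e * U\<^sup>T"
  note Hc = psd_mat_diag_conj(1,2)[OF U(1,2), where d = e, folded H_def]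
  note conj = orthogonal_conj_cancel[OF U(1,2)]
  have GH: "G * H = U * mat_diag n (\<lambda>i. d i * e i) * U\<^sup>T"
    and HG: "H * G = U * mat_diag n (\<lambda>i. d i * e i) * U\<^sup>T"
    unfolding H_def U(4) conj by (simp_all add: mult.commute)
  have HGH: "H * G * H = H"
  proof -
    have "(\<lambda>i. d i * e i * e i) = e" by (auto simp: e_def)
    then show ?thesis unfolding HG unfolding H_def conj by simp
  qed
  have GHG: "G * H * G = G"
  proof -
    have "(\<lambda>i. d i * e i * d i) = d" by (auto simp: e_def)
    then show ?thesis unfolding GH unfolding U(4) conj by simp
  qed
  have HGs: "transpose_mat (H * G) = H * G"
    unfolding HG by (rule psd_mat_diag_conj(2)[OF U(1,2)])
  define B where "B = H * X\<^sup>T"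
  have B: "B \<in> carrier_mat n k" using Hc tX by (simp add: B_def)
  have BX: "B * X = H * G"
    using Hc(1) tX X by (simp add: B_def G_def assoc_mult_mat[of _ n n _ k _ n])
  have XBX: "X * B * X = X"
  proof -
    \<comment> \<open>G W = 0, and y.(Gy) = |Xy|^2 upgrades this to X W = 0, that is, X H G =
      X.\<close>
    define W where "W = 1\<^sub>m n - H * G"
    have HGc: "H * G \<in> carrier_mat n n" using Hc G by simp
    have W: "W \<in> carrier_mat n n" using HGc by (simp add: W_def minus_carrier_mat)
    have GW: "G * W = 0\<^sub>m n n"
    proof -
      have "G * W = G * 1\<^sub>m n - G * (H * G)"
        unfolding W_def by (rule mult_minus_distrib_mat[OF G one_carrier_mat HGc])
      also have "G * (H * G) = G"
        using assoc_mult_mat[OF G Hc(1) G] GHG by simp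
      finally show ?thesis using G by simp
    qed
    have XWc: "X * W \<in> carrier_mat k n" using X W by simp
    have z: "(X * W) *\<^sub>v v = 0\<^sub>v k" if v: "v \<in> carrier_vec n" for v
    proof -
      define y where "y = W *\<^sub>v v"
      have y: "y \<in> carrier_vec n" using W v by (simp add: y_def)
      have "G *\<^sub>v y = (G * W) *\<^sub>v v" using G W v by (simp add: y_def assoc_mult_mat_vec[of _ n n _ n])
      then have "G *\<^sub>v y = 0\<^sub>v n" unfolding GW using v by (intro eq_vecI) auto
      then have "y \<bullet> (G *\<^sub>v y) = 0" using y by simp
      moreover have "G *\<^sub>v y = X\<^sup>T *\<^sub>v (X *\<^sub>v y)"
        using X tX y by (simp add: G_def assoc_mult_mat_vec[of _ n k _ n])
      moreover have "y \<bullet> (X\<^sup>T *\<^sub>v (X *\<^sub>v y)) = (X *\<^sub>v y) \<bullet> (X *\<^sub>v y)"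
        using transpose_vec_mult_scalar[OF X y, of "X *\<^sub>v y"] X y
          comm_scalar_prod[of y n "X\<^sup>T *\<^sub>v (X *\<^sub>v y)"] by simp
      ultimately have "(X *\<^sub>v y) \<bullet> (X *\<^sub>v y) = 0" by simp
      then have "X *\<^sub>v y = 0\<^sub>v k" using scalar_prod_self_eq_0[of "X *\<^sub>v y" k] X y by simp
      then show ?thesis using X W v by (simp add: y_def assoc_mult_mat_vec[of _ k n _ n])
    qed
    have XW: "X * W = 0\<^sub>m k n"
    proof (rule eq_matI)
      fix i j assume "i < dim_row (0\<^sub>m k n :: real mat)" "j < dim_col (0\<^sub>m k n :: real mat)"
      then have ij: "i < k" "j < n" by auto
      have "(X * W) $$ (i, j) = ((X * W) *\<^sub>v unit_vec n j) $ i"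
        using ij by (simp only: mat_mult_unit_vec[OF XWc ij(2)] index_col carrier_matD[OF XWc])
      then show "(X * W) $$ (i, j) = 0\<^sub>m k n $$ (i, j)"
        using ij by (simp only: z[OF unit_vec_carrier] index_zero_vec index_zero_mat)
    qed (use XWc in auto)
    have "X * W = X - X * (H * G)"
      unfolding W_def using X HGc by (simp add: mult_minus_distrib_mat[of _ k n _ n])
    then have X0: "X - X * (H * G) = 0\<^sub>m k n" using XW by simp
    have XHG: "X * (H * G) \<in> carrier_mat k n" using X HGc by simp
    have "X $$ (i, j) - (X * (H * G)) $$ (i, j) = 0" if ij: "i < k" "j < n" for i j
    proof -
      have "X $$ (i, j) - (X * (H * G)) $$ (i, j) = (X - X * (H * G)) $$ (i, j)"
        by (rule index_minus_mat(1)[symmetric]) (use ij carrier_matD[OF XHG] in auto)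
      then show ?thesis unfolding X0 using ij by simp
    qed
    then have "X * (H * G) = X" using X XHG by (intro eq_matI) auto
    then show ?thesis using X B by (simp add: assoc_mult_mat[of _ k n _ k _ n] BX)
  qed
  have BXB: "B * X * B = B"
  proof -
    have "B * X * B = (H * G) * (H * X\<^sup>T)" by (subst BX) (simp only: B_def)
    also have "\<dots> = (H * G * H) * X\<^sup>T"
      by (rule assoc_mult_mat[OF mult_carrier_mat[OF Hc(1) G] Hc(1) tX, symmetric])
    also have "\<dots> = B" by (simp only: HGH B_def)
    finally show ?thesis .
  qed
  have XB: "transpose_mat (X * B) = X * B"
    using X Hc tX B
    by (simp add: B_def transpose_mult[of _ k n _ k] transpose_mult[of _ n n _ k] assoc_mult_mat[of _ k n _ n _ k])
  show ?thesis
    unfolding is_pseudoinverse_def using X B XBX BXB XB HGs by (intro exI[of _ B]) (simp add: BX)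
qed

text \<open>Symmetry of the products forces XB = XC and BX = CX; then B = BXB = CXB = CXC =
  C.\<close>

lemma pseudoinverse_unique:
  fixes X :: "real mat"
  assumes X: "X \<in> carrier_mat k n" and B: "is_pseudoinverse X B" and C: "is_pseudoinverse X C"
  shows "B = C"
proof -
  have Bc: "B \<in> carrier_mat n k" and Cc: "C \<in> carrier_mat n k"
    using X B C by (auto simp: is_pseudoinverse_def)
  have b: "X * B * X = X" "B * X * B = B" "transpose_mat (X * B) = X * B" "transpose_mat (B * X) = B * X"
    and c: "X * C * X = X" "C * X * C = C" "transpose_mat (X * C) = X * C" "transpose_mat (C * X) = C * X"
    using B C by (auto simp: is_pseudoinverse_def)
  have XB: "X * B \<in> carrier_mat k k" "X * C \<in> carrier_mat k k" using X Bc Cc by auto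
  have BX: "B * X \<in> carrier_mat n n" "C * X \<in> carrier_mat n n" using X Bc Cc by auto
  have h1: "(X * C) * (X * B) = X * B" and h2: "(X * B) * (X * C) = X * C"
    using assoc_mult_mat[OF XB(2) X Bc] assoc_mult_mat[OF XB(1) X Cc] b(1) c(1) by simp_all
  have h3: "(B * X) * (C * X) = B * X" and h4: "(C * X) * (B * X) = C * X"
    using assoc_mult_mat[OF Bc X BX(2)] assoc_mult_mat[OF X Cc X]
      assoc_mult_mat[OF Cc X BX(1)] assoc_mult_mat[OF X Bc X] b(1) c(1) by simp_all
  have 1: "X * B = X * C"
    using transpose_mult[OF XB(2,1)] unfolding h1 b(3) c(3) h2 .
  have 2: "B * X = C * X"
    using transpose_mult[OF BX] unfolding h3 b(4) c(4) h4 .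
  have "B = (C * X) * B" using b(2) unfolding 2 by simp
  also have "\<dots> = C * (X * B)" by (rule assoc_mult_mat[OF Cc X Bc])
  also have "\<dots> = C * (X * C)" by (simp only: 1)
  also have "\<dots> = (C * X) * C" by (rule assoc_mult_mat[OF Cc X Cc, symmetric])
  finally show ?thesis by (simp only: c(2))
qed

lemma is_pseudoinverse_pseudoinverse:
  assumes "X \<in> carrier_mat k n"
  shows "is_pseudoinverse X (pseudoinverse X)"
proof -
  obtain B where B: "is_pseudoinverse X B" using pseudoinverse_exists[OF assms] by blast
  show ?thesis
    unfolding pseudoinverse_def
    by (rule theI[of "is_pseudoinverse X", OF B]) (rule pseudoinverse_unique[OF assms _ B])
qed


lemma minus_minus_vec:
  fixes v w :: "real vec"
  assumes "v \<in> carrier_vec n" "w \<in> carrier_vec n"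
  shows "v - (v - w) = w"
  using assms by (intro eq_vecI) auto

text \<open>On the range of \<open>proj_perp n X\<close> the ridge resolvent of the (rescaled) rows agrees with the projection,
  and on the row space it is \<open>O(\<surd>l)\<close>.\<close>

locale row_projection =
  fixes X :: "real mat" and k n :: nat
  assumes X: "X \<in> carrier_mat k n"
begin

abbreviation N :: "real mat" where "N \<equiv> proj_perp n X"

definition B :: "real mat" where "B = pseudoinverse X"

lemma B: "B \<in> carrier_mat n k" "X * B * X = X" "B * X * B = B"
  "transpose_mat (X * B) = X * B" "transpose_mat (B * X) = B * X"
  using is_pseudoinverse_pseudoinverse[OF X] X by (auto simp: is_pseudoinverse_def B_def)

lemma BX: "B * X \<in> carrier_mat n n" "X * B \<in> carrier_mat k k"
  using B X by auto

lemma N_def': "N = 1\<^sub>m n - B * X"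
  by (simp add: proj_perp_def B_def)

lemma N_carrier [simp]: "N \<in> carrier_mat n n"
  using BX by (simp add: N_def' minus_carrier_mat)

lemma N_dim [simp]: "dim_row N = n" "dim_col N = n"
  using carrier_matD[OF N_carrier] by auto

lemma N_mult_carrier [simp]: "v \<in> carrier_vec n \<Longrightarrow> N *\<^sub>v v \<in> carrier_vec n"
  by (rule mult_mat_vec_carrier[OF N_carrier])

lemma N_mult: "v \<in> carrier_vec n \<Longrightarrow> N *\<^sub>v v = v - (B * X) *\<^sub>v v"
  using BX by (simp add: N_def' minus_mult_distrib_mat_vec[of _ n n])

lemma N_symmetric: "N\<^sup>T = N"
  using BX B by (simp add: N_def' transpose_minus[of _ n n])

lemma row_N: 
  assumes i: "i < k" and v: "v \<in> carrier_vec n"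
  shows "row X i \<bullet> (N *\<^sub>v v) = 0"
proof -
  have "X *\<^sub>v ((B * X) *\<^sub>v v) = (X * (B * X)) *\<^sub>v v"
    by (rule assoc_mult_mat_vec[OF X BX(1) v, symmetric])
  also have "X * (B * X) = X" using assoc_mult_mat[OF X B(1) X] B(2) by simp
  finally have "X *\<^sub>v (N *\<^sub>v v) = X *\<^sub>v v - X *\<^sub>v v"
    using X BX v by (simp add: N_mult mult_minus_distrib_mat_vec[of _ k n])
  then have "(X *\<^sub>v (N *\<^sub>v v)) $ i = 0" using i X v by simp
  then show ?thesis using i X by simp
qed

lemma row_space:
  assumes v: "v \<in> carrier_vec n"
  obtains y where "y \<in> carrier_vec k" "v - N *\<^sub>v v = X\<^sup>T *\<^sub>v y"
proof -
  have "v - N *\<^sub>v v = (B * X) *\<^sub>v v"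
    unfolding N_mult[OF v] by (rule minus_minus_vec[OF v mult_mat_vec_carrier[OF BX(1) v]])
  also have "B * X = X\<^sup>T * B\<^sup>T"
    using transpose_mult[OF B(1) X] B(5) by simp
  also have "(X\<^sup>T * B\<^sup>T) *\<^sub>v v = X\<^sup>T *\<^sub>v (B\<^sup>T *\<^sub>v v)"
    using B(1) X v by (intro assoc_mult_mat_vec[of _ n k _ n]) auto
  finally show thesis using that[of "B\<^sup>T *\<^sub>v v"] B v by simp
qed

text \<open>By cyclicity the complementary trace is that of the k by k symmetric idempotent XB,
  whose diagonal entries satisfy C_ii >= C_ii^2 and hence are at most 1. It is an inequality because
  the rows may be dependent.\<close>

lemma N_trace: "mat_trace N \<ge> real n - real k"
proof -
  have "mat_trace (B * X) = mat_trace (X * B)" using mat_trace_comm[OF X B(1)] by simp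
  also have "\<dots> \<le> (\<Sum>i<k. 1)"
  proof -
    define C where "C = X * B"
    have C: "C \<in> carrier_mat k k" "C\<^sup>T = C" using BX B by (auto simp: C_def)
    have CC: "C * C = C"
      using assoc_mult_mat[OF BX(2) X B(1)] B(2) by (simp add: C_def)
    have "C $$ (i, i) \<le> 1" if i: "i < k" for i
    proof -
      have sym: "C $$ (j, i) = C $$ (i, j)" if "j < k" for j
        using C i that by (metis carrier_matD index_transpose_mat(1))
      have "C $$ (i, i) = (C * C) $$ (i, i)" unfolding CC ..
      also have "\<dots> = (\<Sum>j<k. (C $$ (i, j))\<^sup>2)"
        using C i sym by (auto simp: scalar_prod_def power2_eq_square lessThan_atLeast0 intro!: sum.cong)
      also have "\<dots> \<ge> (C $$ (i, i))\<^sup>2"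
        using i by (intro member_le_sum) auto
      finally have "C $$ (i, i) * C $$ (i, i) \<le> C $$ (i, i)" by (simp only: power2_eq_square)
      moreover have "1 * C $$ (i, i) < C $$ (i, i) * C $$ (i, i)" if "1 < C $$ (i, i)"
        using that by (intro mult_strict_right_mono) auto
      ultimately show ?thesis by linarith
    qed
    then have "(\<Sum>i<k. C $$ (i, i)) \<le> (\<Sum>i<k. 1)"
      by (intro sum_mono) simp
    then show ?thesis
      unfolding C_def[symmetric] mat_trace_def carrier_matD(1)[OF C(1)] .
  qed
  finally show ?thesis
    using carrier_matD[OF B(1)] carrier_matD[OF X]
    by (simp add: N_def' mat_trace_def sum_subtractf)
qed

context
  fixes l \<kappa> :: real and x :: "nat \<Rightarrow> real vec"
  assumes l: "l > 0" and \<kappa>: "\<kappa> \<noteq> 0" and x: "\<And>i. i < k \<Longrightarrow> x i = \<kappa> \<cdot>\<^sub>v row X i"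
begin

abbreviation R :: "real mat" where "R \<equiv> ridge_on n l x {..<k}"

lemma x_carrier: "i < k \<Longrightarrow> x i \<in> carrier_vec n"
  using X x by simp

lemma fam: "ridge_family n l x {..<k}"
  using l x_carrier by unfold_locales auto

lemma x_N: "i < k \<Longrightarrow> v \<in> carrier_vec n \<Longrightarrow> x i \<bullet> (N *\<^sub>v v) = 0"
  using X x row_N by (simp add: smult_scalar_prod_distrib[of _ n])

lemma R_N:
  assumes u: "u \<in> carrier_vec n" and v: "v \<in> carrier_vec n"
  shows "(N *\<^sub>v u) \<bullet> (R *\<^sub>v v) = (N *\<^sub>v u) \<bullet> v"
proof -
  have "l * ((N *\<^sub>v u) \<bullet> (R *\<^sub>v v)) = l * ((N *\<^sub>v u) \<bullet> v)"
    using ridge_family.ridge_on_resolvent[OF fam N_mult_carrier[OF u] v] x_N[OF _ u] by simp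
  then show ?thesis using l by simp
qed

text \<open>The range of N is orthogonal to the rows and is fixed by R, so mixed terms vanish: R - N
  = (I - N) R (I - N).\<close>

lemma R_decomposition:
  assumes u: "u \<in> carrier_vec n" and v: "v \<in> carrier_vec n"
  shows "u \<bullet> (R *\<^sub>v v) = u \<bullet> (N *\<^sub>v v) + (u - N *\<^sub>v u) \<bullet> (R *\<^sub>v (v - N *\<^sub>v v))"
proof -
  let ?a = "N *\<^sub>v u" and ?b = "u - N *\<^sub>v u" and ?c = "N *\<^sub>v v" and ?d = "v - N *\<^sub>v v"
  have b: "?b \<in> carrier_vec n" and d: "?d \<in> carrier_vec n" and a: "?a \<in> carrier_vec n" and c: "?c \<in> carrier_vec n"
    using u v by auto
  have Rv: "R *\<^sub>v v \<in> carrier_vec n" by simp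
  have "?b \<bullet> (R *\<^sub>v ?c) = ?c \<bullet> ?b"
    using R_N[OF v b] ridge_on_commute[OF b c] by simp
  moreover have "R *\<^sub>v v = R *\<^sub>v ?c + R *\<^sub>v ?d"
  proof -
    have "v = ?c + ?d" using v c by (intro eq_vecI) auto
    then show ?thesis using c d mult_add_distrib_mat_vec[OF ridge_on_carrier c d] by metis
  qed
  moreover have "u \<bullet> (R *\<^sub>v v) = ?a \<bullet> (R *\<^sub>v v) + ?b \<bullet> (R *\<^sub>v v)"
    using u a Rv by (simp add: minus_scalar_prod_distrib[of _ n])
  ultimately have "u \<bullet> (R *\<^sub>v v) = ?a \<bullet> v + ?c \<bullet> ?b + ?b \<bullet> (R *\<^sub>v ?d)"
    using R_N[OF u v] b by (simp add: scalar_prod_add_distrib[of _ n])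
  moreover have "?a \<bullet> v + ?c \<bullet> ?b = u \<bullet> ?c"
  proof -
    have "?a \<bullet> v = u \<bullet> ?c"
      using symmetric_scalar_prod[OF N_carrier N_symmetric u v] comm_scalar_prod[OF a v] by simp
    moreover have "?c \<bullet> ?b = 0"
    proof -
      have "B * X * (B * X) = B * X" using assoc_mult_mat[OF BX(1) B(1) X] B(3) by simp
      then have idem: "(B * X) *\<^sub>v ((B * X) *\<^sub>v u) = (B * X) *\<^sub>v u"
        using assoc_mult_mat_vec[OF BX(1) BX(1) u] by simp
      have bu: "?b = (B * X) *\<^sub>v u"
        unfolding N_mult[OF u] by (rule minus_minus_vec[OF u mult_mat_vec_carrier[OF BX(1) u]])
      have "(B * X) *\<^sub>v u \<in> carrier_vec n" using mult_mat_vec_carrier[OF BX(1) u] .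
      then have "N *\<^sub>v ?b = 0\<^sub>v n" unfolding bu by (simp add: N_mult idem)
      then have "v \<bullet> (N *\<^sub>v ?b) = 0" using v by simp
      then show ?thesis
        using symmetric_scalar_prod[OF N_carrier N_symmetric v b] comm_scalar_prod[OF b c] by simp
    qed
    ultimately show ?thesis by simp
  qed
  ultimately show ?thesis by simp
qed

text \<open>The decomposition makes R - N positive semi-definite, so its operator norm is at most
  its trace, and tr N >= n - k.\<close>

lemma R_ge_N:
  assumes v: "v \<in> carrier_vec n"
  shows "v \<bullet> (N *\<^sub>v v) \<le> v \<bullet> (R *\<^sub>v v)"
    and "v \<bullet> (R *\<^sub>v v) - v \<bullet> (N *\<^sub>v v) \<le> (mat_trace R - (real n - real k)) * (v \<bullet> v)"
proof -
  have ge: "v \<bullet> (N *\<^sub>v v) \<le> v \<bullet> (R *\<^sub>v v)" if v: "v \<in> carrier_vec n" for v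
    using R_decomposition[OF v v] ridge_family.ridge_on_quadratic(2)[OF fam order_refl, of "v - N *\<^sub>v v"] v
    by simp
  then show "v \<bullet> (N *\<^sub>v v) \<le> v \<bullet> (R *\<^sub>v v)" using v .
  have RN: "v \<bullet> ((R - N) *\<^sub>v v) = v \<bullet> (R *\<^sub>v v) - v \<bullet> (N *\<^sub>v v)" if "v \<in> carrier_vec n" for v
    using that by (simp add: minus_mult_distrib_mat_vec[of _ n n] scalar_prod_minus_distrib[of _ n])
  have "transpose_mat (R - N) = R - N"
    using N_symmetric ridge_symmetric[of n l "map x (sorted_list_of_set {..<k})"]
    by (simp add: transpose_minus[of _ n n] ridge_on_def)
  then have "psd_mat n (R - N)"
    using ge RN by (simp add: psd_mat_def minus_carrier_mat)
  then have "v \<bullet> ((R - N) *\<^sub>v v) \<le> mat_trace (R - N) * (v \<bullet> v)"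
    by (rule psd_quadratic_le_trace[OF _ v])
  also have "mat_trace (R - N) = mat_trace R - mat_trace N"
    using N_carrier by (simp add: mat_trace_def sum_subtractf)
  also have "(mat_trace R - mat_trace N) * (v \<bullet> v) \<le> (mat_trace R - (real n - real k)) * (v \<bullet> v)"
    using N_trace scalar_prod_self_nonneg[of v] by (intro mult_right_mono) auto
  finally show "v \<bullet> (R *\<^sub>v v) - v \<bullet> (N *\<^sub>v v) \<le> (mat_trace R - (real n - real k)) * (v \<bullet> v)"
    by (simp add: RN[OF v])
qed

end

text \<open>Outside the range of N one factor is X^T y, and the resolvent identity bounds the square
  of each row form by l |d|^2, which tends to 0 with l. The limit supplies both the measurability of
  the projection and its bound by 1.\<close>

lemma ridge_tendsto_N:
  assumes u: "u \<in> carrier_vec n" and v: "v \<in> carrier_vec n"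
  shows "(\<lambda>m. u \<bullet> (ridge_on n (1 / real (Suc m)) (row X) {..<k} *\<^sub>v v)) \<longlonglongrightarrow> u \<bullet> (N *\<^sub>v v)"
proof -
  define b where "b = u - N *\<^sub>v u"
  define d where "d = v - N *\<^sub>v v"
  obtain y where y: "y \<in> carrier_vec k" "b = X\<^sup>T *\<^sub>v y"
    unfolding b_def by (rule row_space[OF u])
  have bd: "b \<in> carrier_vec n" "d \<in> carrier_vec n" using u v by (auto simp: b_def d_def)
  define R where "R m = ridge_on n (1 / real (Suc m)) (row X) {..<k}" for m
  have row1: "row X i = 1 \<cdot>\<^sub>v row X i" for i by simp
  have fam: "ridge_family n (1 / real (Suc m)) (row X) {..<k}" for m
    using X by unfold_locales auto
  have dec: "u \<bullet> (R m *\<^sub>v v) = u \<bullet> (N *\<^sub>v v) + b \<bullet> (R m *\<^sub>v d)" for m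
    unfolding R_def b_def d_def using R_decomposition[of "1 / real (Suc m)" 1 "row X", OF _ _ _ u v] by simp
  have small: "\<bar>row X i \<bullet> (R m *\<^sub>v d)\<bar> \<le> sqrt (1 / real (Suc m) * (d \<bullet> d))" if i: "i < k" for i m
  proof -
    define z where "z = R m *\<^sub>v d"
    have z: "z \<in> carrier_vec n" by (simp add: z_def R_def)
    have "1 / real (Suc m) * (z \<bullet> z) + (\<Sum>i<k. (row X i \<bullet> z) * (row X i \<bullet> z)) = 1 / real (Suc m) * (z \<bullet> d)"
      using ridge_family.ridge_on_resolvent[OF fam z bd(2), of m] by (simp add: z_def R_def)
    moreover have "(row X i \<bullet> z) * (row X i \<bullet> z) \<le> (\<Sum>i<k. (row X i \<bullet> z) * (row X i \<bullet> z))"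
      using i by (intro member_le_sum) auto
    moreover have "0 \<le> 1 / real (Suc m) * (z \<bullet> z)" using scalar_prod_self_nonneg[of z] by simp
    ultimately have "(row X i \<bullet> z) * (row X i \<bullet> z) \<le> 1 / real (Suc m) * (z \<bullet> d)" by linarith
    also have "\<dots> \<le> 1 / real (Suc m) * (d \<bullet> d)"
      using ridge_family.ridge_on_quadratic(1)[OF fam order_refl bd(2), of m] comm_scalar_prod[OF z bd(2)]
      by (intro mult_left_mono) (auto simp: z_def R_def)
    finally show ?thesis
      by (intro real_le_rsqrt) (simp add: z_def power2_eq_square)
  qed
  have bound: "\<bar>b \<bullet> (R m *\<^sub>v d)\<bar> \<le> (\<Sum>i<k. \<bar>y $ i\<bar>) * sqrt (1 / real (Suc m) * (d \<bullet> d))" for m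
  proof -
    have z: "R m *\<^sub>v d \<in> carrier_vec n" by (simp add: R_def)
    have "b \<bullet> (R m *\<^sub>v d) = y \<bullet> (X *\<^sub>v (R m *\<^sub>v d))"
      unfolding y(2) by (rule transpose_vec_mult_scalar[OF X z y(1)])
    also have "\<dots> = (\<Sum>i<k. y $ i * (row X i \<bullet> (R m *\<^sub>v d)))"
      using X y by (simp add: scalar_prod_def[of y] lessThan_atLeast0)
    finally have eq: "b \<bullet> (R m *\<^sub>v d) = (\<Sum>i<k. y $ i * (row X i \<bullet> (R m *\<^sub>v d)))" .
    have "\<bar>\<Sum>i<k. y $ i * (row X i \<bullet> (R m *\<^sub>v d))\<bar> \<le> (\<Sum>i<k. \<bar>y $ i * (row X i \<bullet> (R m *\<^sub>v d))\<bar>)"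
      by (rule sum_abs)
    also have "\<dots> \<le> (\<Sum>i<k. \<bar>y $ i\<bar> * sqrt (1 / real (Suc m) * (d \<bullet> d)))"
      unfolding abs_mult using small by (intro sum_mono mult_left_mono) auto
    also have "\<dots> = (\<Sum>i<k. \<bar>y $ i\<bar>) * sqrt (1 / real (Suc m) * (d \<bullet> d))"
      by (rule sum_distrib_right[symmetric])
    finally show ?thesis unfolding eq .
  qed
  define Y where "Y = (\<Sum>i<k. \<bar>y $ i\<bar>)"
  define e where "e m = Y * sqrt (1 / real (Suc m) * (d \<bullet> d))" for m
  have "(\<lambda>m. 1 / real (Suc m)) \<longlonglongrightarrow> 0"
    by (rule LIMSEQ_Suc[OF lim_1_over_n])
  then have "e \<longlonglongrightarrow> Y * sqrt (0 * (d \<bullet> d))"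
    unfolding e_def[abs_def] by (intro tendsto_mult tendsto_const tendsto_real_sqrt)
  then have e0: "e \<longlonglongrightarrow> 0" by simp
  have "\<forall>\<^sub>F m in sequentially. norm (b \<bullet> (R m *\<^sub>v d)) \<le> e m"
    using bound by (simp only: real_norm_def e_def Y_def eventually_True)
  then have "(\<lambda>m. b \<bullet> (R m *\<^sub>v d)) \<longlonglongrightarrow> 0"
    by (rule Lim_null_comparison[OF _ e0])
  then have "(\<lambda>m. u \<bullet> (N *\<^sub>v v) + b \<bullet> (R m *\<^sub>v d)) \<longlonglongrightarrow> u \<bullet> (N *\<^sub>v v) + 0"
    by (rule tendsto_add[OF tendsto_const])
  then show ?thesis unfolding R_def[symmetric] dec by (simp only: add_0_right)
qed

end

text \<open>The pseudoinverse is given by a definite description and is discontinuous where the rank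
  drops. As a pointwise limit of ridge resolvents the projection is nevertheless measurable.\<close>

lemma mat_measurable_proj_perp:
  assumes F: "mat_measurable M k n F"
  shows "mat_measurable M n n (\<lambda>w. proj_perp n (F w))"
proof -
  have Fc: "F w \<in> carrier_mat k n" for w using F by (simp add: mat_measurable_def)
  have "(\<lambda>w. proj_perp n (F w) $$ (i, j)) \<in> borel_measurable M" if ij: "i < n" "j < n" for i j
  proof (rule borel_measurable_LIMSEQ_real)
    fix w
    interpret row_projection "F w" k n using Fc by unfold_locales
    have entry: "(proj_perp n (F w)) $$ (i, j) = unit_vec n i \<bullet> (proj_perp n (F w) *\<^sub>v unit_vec n j)"
      using ij mat_mult_unit_vec[OF N_carrier, of j] by simp
    show "(\<lambda>m. unit_vec n i \<bullet> (ridge_on n (1 / real (Suc m)) (row (F w)) {..<k} *\<^sub>v unit_vec n j))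
        \<longlonglongrightarrow> proj_perp n (F w) $$ (i, j)"
      unfolding entry by (rule ridge_tendsto_N) simp_all
  next
    fix m
    have "mat_measurable M n n (\<lambda>w. ridge_on n (1 / real (Suc m)) (row (F w)) {..<k})"
      by (rule mat_measurable_ridge_on, simp, rule vec_measurable_row[OF F], simp)
    then show "(\<lambda>w. unit_vec n i \<bullet> (ridge_on n (1 / real (Suc m)) (row (F w)) {..<k} *\<^sub>v unit_vec n j)) \<in> borel_measurable M"
      by (rule borel_measurable_scalar_prod[OF vec_measurable_const[OF unit_vec_carrier]
            vec_measurable_mult_mat_vec[OF _ vec_measurable_const[OF unit_vec_carrier]]])
  qed
  moreover have "proj_perp n (F w) \<in> carrier_mat n n" for w
    using row_projection.N_carrier[of "F w" k n] Fc by (simp add: row_projection_def)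
  ultimately show ?thesis by (simp add: mat_measurable_def)
qed

subsection \<open>Comparison with the deterministic equivalent\<close>

lemma diag_conj_affine:
  fixes U :: "real mat"
  assumes U: "U \<in> carrier_mat n n" "U * U\<^sup>T = 1\<^sub>m n"
  shows "g \<cdot>\<^sub>m (U * mat_diag n d * U\<^sup>T) + 1\<^sub>m n = U * mat_diag n (\<lambda>i. 1 + g * d i) * U\<^sup>T"
proof -
  have tU: "U\<^sup>T \<in> carrier_mat n n" using U by simp
  have UD: "U * mat_diag n f \<in> carrier_mat n n" for f by (rule mult_carrier_mat[OF U(1) mat_diag_dim])
  have "mat_diag n (\<lambda>i. 1 + g * d i) = g \<cdot>\<^sub>m mat_diag n d + 1\<^sub>m n"
    by (intro eq_matI) (auto simp: mat_diag_def)
  then have "U * mat_diag n (\<lambda>i. 1 + g * d i) = g \<cdot>\<^sub>m (U * mat_diag n d) + U"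
    using mult_add_distrib_mat[OF U(1) smult_carrier_mat[OF mat_diag_dim] one_carrier_mat, of g d]
      mult_smult_distrib[OF U(1) mat_diag_dim, of g d] U(1) by simp
  then show ?thesis
    using add_mult_distrib_mat[OF smult_carrier_mat[OF UD] U(1) tU, of g d]
      mult_smult_assoc_mat[OF UD tU, of g d] U(2) by simp
qed

lemma mat_inverse_eqI:
  fixes A B :: "real mat"
  assumes A: "A \<in> carrier_mat n n" and B: "B \<in> carrier_mat n n" and AB: "A * B = 1\<^sub>m n" and BA: "B * A = 1\<^sub>m n"
  shows "mat_inverse A = Some B"
proof (cases "mat_inverse A")
  case None
  have "A \<in> Units (ring_mat TYPE(real) n ())"
    using A B AB BA unfolding Units_def ring_mat_def by auto
  then show ?thesis using mat_inverse(1)[OF A None, of "()"] by blast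
next
  case (Some C)
  then have C: "A * C = 1\<^sub>m n" "C * A = 1\<^sub>m n" "C \<in> carrier_mat n n"
    using mat_inverse(2)[OF A Some] by auto
  have "C = C * (A * B)" using C AB by simp
  also have "\<dots> = (C * A) * B" by (rule assoc_mult_mat[OF C(3) A B, symmetric])
  finally show ?thesis using Some C B by simp
qed

text \<open>The map from g to the sum of g d_i / (1 + g d_i) has slope at least (sum of d_i) / (1 +
  G)^2 on the interval up to G, so nearby values have nearby arguments. The difference is computed
  exactly instead of through a derivative.\<close>

lemma perturbed_fixed_point:
  fixes d :: "nat \<Rightarrow> real" and g h :: real
  assumes d: "\<And>i. i < n \<Longrightarrow> 0 \<le> d i" "\<And>i. i < n \<Longrightarrow> d i \<le> 1" and g: "g > 0" "g \<le> G" and h: "h > 0" "h \<le> G"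
  shows "\<bar>g - h\<bar> * (\<Sum>i<n. d i) \<le> (1 + G)\<^sup>2 * \<bar>(\<Sum>i<n. g * d i / (1 + g * d i)) - (\<Sum>i<n. h * d i / (1 + h * d i))\<bar>"
proof -
  have pos: "1 + g * d i > 0" "1 + h * d i > 0" "1 + g * d i \<le> 1 + G" "1 + h * d i \<le> 1 + G" if "i < n" for i
    using d[OF that] g h mult_mono[of g G "d i" 1] mult_mono[of h G "d i" 1]
    by (auto intro: add_pos_nonneg)
  have "(\<Sum>i<n. g * d i / (1 + g * d i)) - (\<Sum>i<n. h * d i / (1 + h * d i))
      = (\<Sum>i<n. (g - h) * (d i / ((1 + g * d i) * (1 + h * d i))))"
    unfolding sum_subtractf[symmetric]
  proof (intro sum.cong refl)
    fix i assume "i \<in> {..<n}"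
    then have "1 + g * d i \<noteq> 0" "1 + h * d i \<noteq> 0" using pos[of i] by auto
    then show "g * d i / (1 + g * d i) - h * d i / (1 + h * d i) = (g - h) * (d i / ((1 + g * d i) * (1 + h * d i)))"
      by (simp add: diff_frac_eq) (simp add: algebra_simps)
  qed
  also have "\<bar>\<dots>\<bar> = \<bar>g - h\<bar> * (\<Sum>i<n. d i / ((1 + g * d i) * (1 + h * d i)))"
  proof -
    have "0 \<le> (\<Sum>i<n. d i / ((1 + g * d i) * (1 + h * d i)))"
      using d pos by (intro sum_nonneg divide_nonneg_pos mult_pos_pos) auto
    then show ?thesis by (simp only: sum_distrib_left[symmetric] abs_mult abs_of_nonneg)
  qed
  finally have eq: "\<bar>(\<Sum>i<n. g * d i / (1 + g * d i)) - (\<Sum>i<n. h * d i / (1 + h * d i))\<bar>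
    = \<bar>g - h\<bar> * (\<Sum>i<n. d i / ((1 + g * d i) * (1 + h * d i)))" .
  have "(\<Sum>i<n. d i / (1 + G)\<^sup>2) \<le> (\<Sum>i<n. d i / ((1 + g * d i) * (1 + h * d i)))"
  proof (intro sum_mono)
    fix i assume "i \<in> {..<n}"
    then have i: "i < n" by simp
    show "d i / (1 + G)\<^sup>2 \<le> d i / ((1 + g * d i) * (1 + h * d i))"
      unfolding power2_eq_square using d[OF i] pos[OF i] by (intro frac_le mult_mono mult_pos_pos) auto
  qed
  then have "(\<Sum>i<n. d i) \<le> (1 + G)\<^sup>2 * (\<Sum>i<n. d i / ((1 + g * d i) * (1 + h * d i)))"
    using g by (simp add: sum_divide_distrib[symmetric] divide_le_eq mult.commute)
  from mult_left_mono[OF this abs_ge_zero, of "g - h"] show ?thesis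
    unfolding eq by (simp only: mult.left_commute[of "(1 + G)\<^sup>2"])
qed

text \<open>With h = k / \<tau> the estimate says that \<open>Eb\<close> is close to (I + h S)^-1.
  Its trace against S shows that h nearly satisfies the equation which g satisfies exactly, and
  \<open>perturbed_fixed_point\<close> bounds g - h. Everything is diagonal in the eigenbasis of
  S.\<close>

lemma deterministic_equivalent:
  fixes A Eb :: "real mat" and k :: nat and \<rho> \<tau> \<epsilon> g :: real
  assumes A: "A \<in> carrier_mat n n" "A\<^sup>T = A"
    and contr: "\<And>v. v \<in> carrier_vec n \<Longrightarrow> (A *\<^sub>v v) \<bullet> (A *\<^sub>v v) \<le> v \<bullet> v"
    and tr: "mat_trace (A * A) = \<rho> * real k" and \<rho>: "\<rho> > 1" and k: "k \<ge> 1"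
    and Eb: "Eb \<in> carrier_mat n n"
    and g: "g > 0" and Pb_trace: "mat_trace (proj_perp_equiv n (A * A) g) = real n - real k"
    and \<tau>: "\<tau> \<ge> (\<rho> - 1) * real k" and \<tau>_tr: "\<bar>\<tau> - mat_trace (A * Eb * A)\<bar> \<le> 1" and \<epsilon>: "\<epsilon> \<ge> 0"
    and est: "\<And>u v. u \<in> carrier_vec n \<Longrightarrow> u \<bullet> u \<le> 1 \<Longrightarrow> v \<in> carrier_vec n \<Longrightarrow> v \<bullet> v \<le> 1 \<Longrightarrow>
      \<bar>u \<bullet> v - u \<bullet> (Eb *\<^sub>v v) - real k / \<tau> * (((A * A) *\<^sub>v u) \<bullet> (Eb *\<^sub>v v))\<bar> \<le> \<epsilon>"
  defines "Pb \<equiv> proj_perp_equiv n (A * A) g"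
  shows "Pb \<in> carrier_mat n n" and "Pb\<^sup>T = Pb"
    and "v \<in> carrier_vec n \<Longrightarrow> (\<rho> - 1) / \<rho> * (v \<bullet> v) \<le> v \<bullet> (Pb *\<^sub>v v)"
    and "v \<in> carrier_vec n \<Longrightarrow> v \<bullet> v = 1 \<Longrightarrow> \<bar>v \<bullet> (Eb *\<^sub>v v) - v \<bullet> (Pb *\<^sub>v v)\<bar>
       \<le> \<epsilon> + (1 + 1 / (\<rho> - 1))\<^sup>2 * ((1 / real k + \<epsilon> * \<rho>) / ((\<rho> - 1) * \<rho>))"
proof -
  define \<delta> where "\<delta> = \<rho> - 1"
  define K where "K = real k"
  define h where "h = K / \<tau>"
  define S where "S = A * A"
  have \<delta>: "\<delta> > 0" and K: "K \<ge> 1" "K > 0" using \<rho> k by (auto simp: \<delta>_def K_def)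
  have \<tau>0: "\<tau> > 0" using \<tau> mult_pos_pos[OF \<delta> K(2)] by (simp add: \<delta>_def K_def)
  have h: "h > 0" using \<tau>0 K by (simp add: h_def)
  have h_le: "h \<le> 1 / \<delta>" using \<tau> \<tau>0 \<delta> K by (simp add: h_def \<delta>_def K_def field_simps)
  have S: "S \<in> carrier_mat n n" using A by (simp add: S_def)
  have Sform: "x \<bullet> (S *\<^sub>v x) = (A *\<^sub>v x) \<bullet> (A *\<^sub>v x)" if x: "x \<in> carrier_vec n" for x
    using symmetric_scalar_prod[OF A x, of "A *\<^sub>v x"] A x
    by (simp add: S_def assoc_mult_mat_vec[of _ n n _ n])
  have "psd_mat n S"
    using S A Sform scalar_prod_self_nonneg by (auto simp: psd_mat_def S_def transpose_mult[of _ n n _ n])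
  then obtain U d where U: "U \<in> carrier_mat n n" "U\<^sup>T * U = 1\<^sub>m n" "U * U\<^sup>T = 1\<^sub>m n"
    and SU: "S = U * mat_diag n d * U\<^sup>T" and d0: "\<And>i. i < n \<Longrightarrow> d i \<ge> 0"
    and d1': "\<And>i s. i < n \<Longrightarrow> (\<And>x. x \<in> carrier_vec n \<Longrightarrow> x \<bullet> (S *\<^sub>v x) \<le> s * (x \<bullet> x)) \<Longrightarrow> d i \<le> s"
    by (rule psd_diagonalization) blast
  have d1: "d i \<le> 1" if "i < n" for i
    using d1'[OF that, of 1] Sform contr by simp
  define R where "R c = U * mat_diag n (\<lambda>i. 1 / (1 + c * d i)) * U\<^sup>T" for c
  note Rc = psd_mat_diag_conj(1,2)[OF U(1,2), where d = "\<lambda>i. 1 / (1 + _ * d i)", folded R_def]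
  have pos: "1 + c * d i > 0" if "c > 0" "i < n" for c i
    using that d0[of i] by (intro add_pos_nonneg) auto
  have Rform: "x \<bullet> (R c *\<^sub>v x) = (\<Sum>i<n. 1 / (1 + c * d i) * ((U\<^sup>T *\<^sub>v x) $ i)\<^sup>2)"
    if "x \<in> carrier_vec n" for x c
    unfolding R_def by (rule psd_mat_diag_conj(3)[OF U(1,2) that])
  have xx: "(\<Sum>i<n. ((U\<^sup>T *\<^sub>v x) $ i)\<^sup>2) = x \<bullet> x" if "x \<in> carrier_vec n" for x
    by (rule orthogonal_mat_norm[OF U(1,3) that])
  have one: "U * mat_diag n f * U\<^sup>T = 1\<^sub>m n" if "\<And>i. i < n \<Longrightarrow> f i = 1" for f
  proof -
    have "mat_diag n f = 1\<^sub>m n" using that by (intro eq_matI) (auto simp: mat_diag_def)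
    then show ?thesis using U by simp
  qed
  have inv: "(c \<cdot>\<^sub>m S + 1\<^sub>m n) * R c = 1\<^sub>m n" "R c * (c \<cdot>\<^sub>m S + 1\<^sub>m n) = 1\<^sub>m n" if c: "c > 0" for c
    unfolding SU diag_conj_affine[OF U(1,3)] unfolding R_def orthogonal_conj_cancel[OF U(1,2)]
    using pos[OF c] by (auto intro!: one simp: less_imp_neq[symmetric])
  have Pb: "Pb = R g"
    unfolding Pb_def proj_perp_equiv_def S_def[symmetric]
    using mat_inverse_eqI[OF _ Rc(1) inv(1)[OF g] inv(2)[OF g]] S by simp
  show "Pb \<in> carrier_mat n n" "Pb\<^sup>T = Pb" unfolding Pb by (rule Rc)+
  have trS: "(\<Sum>i<n. d i) = \<rho> * K"
    using tr mat_trace_diag_conj[OF U(1,2), of d] SU by (simp add: S_def K_def)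
  have trR: "mat_trace (R c) = (\<Sum>i<n. 1 / (1 + c * d i))" for c
    unfolding R_def by (rule mat_trace_diag_conj[OF U(1,2)])
  have Fg: "(\<Sum>i<n. g * d i / (1 + g * d i)) = K"
  proof -
    have "(\<Sum>i<n. g * d i / (1 + g * d i)) = (\<Sum>i<n. 1 - 1 / (1 + g * d i))"
      using pos[OF g] by (intro sum.cong refl) (simp add: field_simps less_imp_neq[symmetric])
    also have "\<dots> = real n - mat_trace (R g)" by (simp add: sum_subtractf trR)
    finally show ?thesis using Pb_trace Pb by (simp add: Pb_def K_def)
  qed
  \<comment> \<open>Subtracting the equation for g from g tr S leaves the sum of (g d)^2 / (1 + g
    d), which is at most g k because d <= 1. Hence g \<rho> k - k <= g k.\<close>
  have g_le: "g \<le> 1 / \<delta>"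
  proof -
    have "(\<Sum>i<n. g * d i) - K = (\<Sum>i<n. g * d i * (g * d i) / (1 + g * d i))"
      unfolding Fg[symmetric] sum_subtractf[symmetric]
      using pos[OF g] by (intro sum.cong refl) (simp add: field_simps less_imp_neq[symmetric])
    also have "\<dots> \<le> (\<Sum>i<n. g * (g * d i / (1 + g * d i)))"
    proof (intro sum_mono)
      fix i assume "i \<in> {..<n}"
      then have i: "i < n" by simp
      have "g * d i * (g * d i) \<le> g * (g * d i)"
        using g d0[OF i] d1[OF i] mult_left_le[of "d i" g] by (intro mult_right_mono) auto
      then show "g * d i * (g * d i) / (1 + g * d i) \<le> g * (g * d i / (1 + g * d i))"
        using pos[OF g i] by (simp add: divide_right_mono)
    qed
    also have "\<dots> = g * K" by (simp only: sum_distrib_left[symmetric] Fg)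
    finally have "g * (\<rho> * K) - K \<le> g * K" by (simp only: sum_distrib_left[symmetric] trS)
    then have "(g * \<delta>) * K \<le> 1 * K" by (simp add: \<delta>_def algebra_simps)
    then have "g * \<delta> \<le> 1" using K by (simp only: mult_le_cancel_right_pos)
    then show ?thesis using \<delta> by (simp add: field_simps)
  qed
  have approx: "\<bar>w \<bullet> (R h *\<^sub>v w) - w \<bullet> (Eb *\<^sub>v w)\<bar> \<le> \<epsilon> * (w \<bullet> w)" if w: "w \<in> carrier_vec n" for w
  proof -
    have unit: "\<bar>w \<bullet> (R h *\<^sub>v w) - w \<bullet> (Eb *\<^sub>v w)\<bar> \<le> \<epsilon>" if w: "w \<in> carrier_vec n" and w1: "w \<bullet> w = 1" for w
    proof -
      \<comment> \<open>Since (h S + I) u = w, the last two terms of the bilinear estimate combine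
        into w.(Eb w), while u.w is the form of \<open>R h\<close>.\<close>
      define u where "u = R h *\<^sub>v w"
      have u: "u \<in> carrier_vec n" using mult_mat_vec_carrier[OF Rc(1) w] by (simp add: u_def)
      have "u \<bullet> u = w \<bullet> (R h *\<^sub>v u)"
        using symmetric_scalar_prod[OF Rc(1,2) w u, of h] by (simp add: u_def)
      also have "R h *\<^sub>v u = (R h * R h) *\<^sub>v w"
        unfolding u_def by (rule assoc_mult_mat_vec[OF Rc(1) Rc(1) w, symmetric])
      also have "w \<bullet> ((R h * R h) *\<^sub>v w) = (\<Sum>i<n. (1 / (1 + h * d i) * (1 / (1 + h * d i))) * ((U\<^sup>T *\<^sub>v w) $ i)\<^sup>2)"
        unfolding R_def orthogonal_conj_cancel[OF U(1,2)] by (rule psd_mat_diag_conj(3)[OF U(1,2) w])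
      also have "\<dots> \<le> (\<Sum>i<n. 1 * ((U\<^sup>T *\<^sub>v w) $ i)\<^sup>2)"
      proof (intro sum_mono mult_right_mono)
        fix i assume "i \<in> {..<n}"
        then have "1 + h * d i \<ge> 1" using h d0[of i] by simp
        then show "1 / (1 + h * d i) * (1 / (1 + h * d i)) \<le> 1"
          by (intro mult_le_one) auto
      qed simp
      finally have u1: "u \<bullet> u \<le> 1" using xx[OF w] w1 by simp
      have Su: "S *\<^sub>v u \<in> carrier_vec n" using S u by simp
      have "w = ((h \<cdot>\<^sub>m S + 1\<^sub>m n) * R h) *\<^sub>v w" using inv(1)[OF h] w by simp
      also have "\<dots> = (h \<cdot>\<^sub>m S + 1\<^sub>m n) *\<^sub>v u"
        unfolding u_def using S by (intro assoc_mult_mat_vec[OF _ Rc(1) w]) auto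
      also have "\<dots> = h \<cdot>\<^sub>v (S *\<^sub>v u) + u"
      proof -
        have "(h \<cdot>\<^sub>m S) *\<^sub>v u = h \<cdot>\<^sub>v (S *\<^sub>v u)"
          using S u by (intro eq_vecI) (auto simp: smult_scalar_prod_distrib[of _ n])
        then show ?thesis using S u by (simp add: add_mult_distrib_mat_vec[of _ n n])
      qed
      finally have weq: "w = h \<cdot>\<^sub>v (S *\<^sub>v u) + u" .
      define z where "z = Eb *\<^sub>v w"
      have z: "z \<in> carrier_vec n" using Eb w by (simp add: z_def)
      have "w \<bullet> z = h * ((S *\<^sub>v u) \<bullet> z) + u \<bullet> z"
        unfolding weq using Su u z by (simp add: add_scalar_prod_distrib[of _ n])
      then have "u \<bullet> w - w \<bullet> z = u \<bullet> w - u \<bullet> z - h * ((S *\<^sub>v u) \<bullet> z)" by simp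
      moreover have "\<bar>u \<bullet> w - u \<bullet> z - h * ((S *\<^sub>v u) \<bullet> z)\<bar> \<le> \<epsilon>"
        using est[OF u u1 w] w1 by (simp add: z_def h_def K_def S_def)
      moreover have "u \<bullet> w = w \<bullet> (R h *\<^sub>v w)" using comm_scalar_prod[OF u w] by (simp add: u_def)
      ultimately show ?thesis by (simp add: z_def)
    qed
    show ?thesis by (rule quadratic_bound_of_unit[OF Rc(1) Eb w unit])
  qed
  have colc: "col A j \<in> carrier_vec n" if "j < n" for j using A that by auto
  have trAA: "(\<Sum>j<n. col A j \<bullet> col A j) = \<rho> * K"
  proof -
    have "mat_trace (A * 1\<^sub>m n * A) = (\<Sum>j<n. col A j \<bullet> (1\<^sub>m n *\<^sub>v col A j))"
      by (rule mat_trace_conj[OF A one_carrier_mat])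
    then show ?thesis using tr A colc by (simp add: K_def)
  qed
  have trARA: "mat_trace (A * R h * A) = (\<Sum>i<n. d i / (1 + h * d i))"
  proof -
    have AR: "A * R h \<in> carrier_mat n n" by (rule mult_carrier_mat[OF A(1) Rc(1)])
    have "mat_trace (A * R h * A) = mat_trace (A * (A * R h))" by (rule mat_trace_comm[OF AR A(1)])
    also have "A * (A * R h) = S * R h" unfolding S_def by (rule assoc_mult_mat[OF A(1) A(1) Rc(1), symmetric])
    also have "mat_trace (S * R h) = (\<Sum>i<n. d i * (1 / (1 + h * d i)))"
      unfolding SU R_def orthogonal_conj_cancel[OF U(1,2)] by (rule mat_trace_diag_conj[OF U(1,2)])
    finally show ?thesis by simp
  qed
  \<comment> \<open>The squared lengths of the columns of \<open>A\<close> sum to \<rho> k, so the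
    trace error is \<epsilon> \<rho> k, whatever n is.\<close>
  have "\<bar>mat_trace (A * R h * A) - mat_trace (A * Eb * A)\<bar>
      = \<bar>\<Sum>j<n. col A j \<bullet> (R h *\<^sub>v col A j) - col A j \<bullet> (Eb *\<^sub>v col A j)\<bar>"
    unfolding mat_trace_conj[OF A Rc(1)] mat_trace_conj[OF A Eb] sum_subtractf ..
  also have "\<dots> \<le> (\<Sum>j<n. \<epsilon> * (col A j \<bullet> col A j))"
    using approx colc by (intro order_trans[OF sum_abs] sum_mono) auto
  also have "\<dots> = \<epsilon> * (\<rho> * K)" by (simp only: sum_distrib_left[symmetric] trAA)
  finally have "\<bar>\<tau> - (\<Sum>i<n. d i / (1 + h * d i))\<bar> \<le> 1 + \<epsilon> * (\<rho> * K)"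
    using \<tau>_tr trARA by linarith
  \<comment> \<open>As h \<tau> = k, multiplying by h turns the comparison with \<tau> into the
    defining equation of g, evaluated at h with an error.\<close>
  then have "h * \<bar>\<tau> - (\<Sum>i<n. d i / (1 + h * d i))\<bar> \<le> 1 / \<delta> * (1 + \<epsilon> * (\<rho> * K))"
    using h h_le \<delta> by (intro mult_mono) auto
  moreover have "h * \<bar>\<tau> - (\<Sum>i<n. d i / (1 + h * d i))\<bar> = \<bar>h * \<tau> - h * (\<Sum>i<n. d i / (1 + h * d i))\<bar>"
    using h by (simp add: abs_mult flip: right_diff_distrib)
  moreover have "h * \<tau> = K" using \<tau>0 by (simp add: h_def)
  moreover have "h * (\<Sum>i<n. d i / (1 + h * d i)) = (\<Sum>i<n. h * d i / (1 + h * d i))"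
    by (simp add: sum_distrib_left)
  ultimately have Fh: "\<bar>(\<Sum>i<n. g * d i / (1 + g * d i)) - (\<Sum>i<n. h * d i / (1 + h * d i))\<bar> \<le> 1 / \<delta> * (1 + \<epsilon> * (\<rho> * K))"
    using Fg by simp
  have "\<bar>g - h\<bar> * (\<rho> * K) \<le> (1 + 1 / \<delta>)\<^sup>2 * (1 / \<delta> * (1 + \<epsilon> * (\<rho> * K)))"
    using perturbed_fixed_point[of n d g "1 / \<delta>" h, OF d0 d1 g g_le h h_le] mult_left_mono[OF Fh, of "(1 + 1 / \<delta>)\<^sup>2"]
    unfolding trS by simp
  then have "\<bar>g - h\<bar> \<le> (1 + 1 / \<delta>)\<^sup>2 * (1 / \<delta> * (1 + \<epsilon> * (\<rho> * K))) / (\<rho> * K)"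
    using \<rho> K by (subst pos_le_divide_eq) auto
  also have "\<dots> = (1 + 1 / \<delta>)\<^sup>2 * ((1 / K + \<epsilon> * \<rho>) / (\<delta> * \<rho>))"
    using K \<rho> \<delta> by (simp add: field_simps)
  finally have gh: "\<bar>g - h\<bar> \<le> (1 + 1 / \<delta>)\<^sup>2 * ((1 / K + \<epsilon> * \<rho>) / (\<delta> * \<rho>))" .
  show "(\<rho> - 1) / \<rho> * (v \<bullet> v) \<le> v \<bullet> (Pb *\<^sub>v v)" if v: "v \<in> carrier_vec n"
  proof -
    have "(\<rho> - 1) / \<rho> * (v \<bullet> v) = (\<Sum>i<n. (\<rho> - 1) / \<rho> * ((U\<^sup>T *\<^sub>v v) $ i)\<^sup>2)"
      by (simp only: sum_distrib_left[symmetric] xx[OF v])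
    also have "\<dots> \<le> (\<Sum>i<n. 1 / (1 + g * d i) * ((U\<^sup>T *\<^sub>v v) $ i)\<^sup>2)"
    proof (intro sum_mono mult_right_mono)
      fix i assume "i \<in> {..<n}"
      then have i: "i < n" by simp
      \<comment> \<open>This bounds 1 + g d by 1 + 1 / (\<rho> - 1) = \<rho> / (\<rho> - 1), whose
        reciprocal is the claimed lower bound.\<close>
      have "g * d i \<le> 1 / \<delta> * 1" using g g_le \<delta> d0[OF i] d1[OF i] by (intro mult_mono) auto
      then have "1 + g * d i \<le> \<rho> / (\<rho> - 1)" using \<delta> by (simp add: \<delta>_def field_simps)
      then have "1 / (\<rho> / (\<rho> - 1)) \<le> 1 / (1 + g * d i)" using pos[OF g i] \<rho> by (intro divide_left_mono mult_pos_pos divide_pos_pos) auto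
      then show "(\<rho> - 1) / \<rho> \<le> 1 / (1 + g * d i)" by simp
    qed simp
    also have "\<dots> = v \<bullet> (Pb *\<^sub>v v)" unfolding Pb by (rule Rform[OF v, symmetric])
    finally show ?thesis .
  qed
  show "\<bar>v \<bullet> (Eb *\<^sub>v v) - v \<bullet> (Pb *\<^sub>v v)\<bar> \<le> \<epsilon> + (1 + 1 / (\<rho> - 1))\<^sup>2 * ((1 / real k + \<epsilon> * \<rho>) / ((\<rho> - 1) * \<rho>))"
    if v: "v \<in> carrier_vec n" and v1: "v \<bullet> v = 1"
  proof -
    have "\<bar>v \<bullet> (R g *\<^sub>v v) - v \<bullet> (R h *\<^sub>v v)\<bar>
        = \<bar>\<Sum>i<n. (1 / (1 + g * d i) - 1 / (1 + h * d i)) * ((U\<^sup>T *\<^sub>v v) $ i)\<^sup>2\<bar>"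
      unfolding Rform[OF v] sum_subtractf[symmetric] left_diff_distrib ..
    also have "\<dots> \<le> (\<Sum>i<n. \<bar>g - h\<bar> * ((U\<^sup>T *\<^sub>v v) $ i)\<^sup>2)"
    proof (intro order_trans[OF sum_abs] sum_mono)
      fix i assume "i \<in> {..<n}"
      then have i: "i < n" by simp
      have ge1: "1 + g * d i \<ge> 1" "1 + h * d i \<ge> 1" using g h d0[OF i] by auto
      then have p: "(1 + g * d i) * (1 + h * d i) \<ge> 1"
        using mult_mono[OF ge1] by simp
      have "1 / (1 + g * d i) - 1 / (1 + h * d i) = (h - g) * d i / ((1 + g * d i) * (1 + h * d i))"
        using ge1 by (simp add: diff_frac_eq left_diff_distrib)
      also have "\<bar>\<dots>\<bar> = \<bar>g - h\<bar> * d i / ((1 + g * d i) * (1 + h * d i))"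
        using ge1 d0[OF i] by (simp add: abs_mult abs_minus_commute)
      also have "\<dots> \<le> \<bar>g - h\<bar> * 1 / 1"
        using p d0[OF i] d1[OF i] by (intro frac_le mult_left_mono) auto
      finally show "\<bar>(1 / (1 + g * d i) - 1 / (1 + h * d i)) * ((U\<^sup>T *\<^sub>v v) $ i)\<^sup>2\<bar>
          \<le> \<bar>g - h\<bar> * ((U\<^sup>T *\<^sub>v v) $ i)\<^sup>2"
        unfolding abs_mult by (simp add: mult_right_mono)
    qed
    also have "\<dots> = \<bar>g - h\<bar>" by (simp only: sum_distrib_left[symmetric] xx[OF v] v1 mult_1_right)
    finally have "\<bar>v \<bullet> (R g *\<^sub>v v) - v \<bullet> (R h *\<^sub>v v)\<bar> \<le> \<bar>g - h\<bar>" .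
    then show ?thesis
      using approx[OF v] gh unfolding v1 Pb K_def[symmetric] \<delta>_def[symmetric] by linarith
  qed
qed

lemma expectation_mat_form:
  assumes F: "\<And>w. F w \<in> carrier_mat m n"
    and int: "\<And>i j. i < m \<Longrightarrow> j < n \<Longrightarrow> integrable M (\<lambda>w. F w $$ (i, j))"
    and u: "u \<in> carrier_vec m" and v: "v \<in> carrier_vec n"
  shows "integrable M (\<lambda>w. u \<bullet> (F w *\<^sub>v v))"
    and "u \<bullet> (expectation_mat M m n F *\<^sub>v v) = (\<integral>w. u \<bullet> (F w *\<^sub>v v) \<partial>M)"
proof -
  have form: "u \<bullet> (C *\<^sub>v v) = (\<Sum>i<m. \<Sum>j<n. u $ i * v $ j * C $$ (i, j))" if "C \<in> carrier_mat m n" for C :: "real mat"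
    using that u v by (auto simp: scalar_prod_def lessThan_atLeast0 sum_distrib_left mult_ac intro!: sum.cong)
  note F' = form[OF F]
  have I: "integrable M (\<lambda>w. \<Sum>j<n. u $ i * v $ j * F w $$ (i, j))" if "i < m" for i
    using that int by (intro Bochner_Integration.integrable_sum integrable_mult_right) auto
  show "integrable M (\<lambda>w. u \<bullet> (F w *\<^sub>v v))"
    unfolding F' by (rule Bochner_Integration.integrable_sum, rule I, simp)
  have E: "expectation_mat M m n F \<in> carrier_mat m n" by (simp add: expectation_mat_def)
  have "(\<integral>w. u \<bullet> (F w *\<^sub>v v) \<partial>M) = (\<Sum>i<m. \<integral>w. (\<Sum>j<n. u $ i * v $ j * F w $$ (i, j)) \<partial>M)"
    unfolding F' using I by (intro Bochner_Integration.integral_sum) auto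
  also have "\<dots> = (\<Sum>i<m. \<Sum>j<n. u $ i * v $ j * (\<integral>w. F w $$ (i, j) \<partial>M))"
  proof (intro sum.cong refl)
    fix i assume i: "i \<in> {..<m}"
    have "(\<integral>w. (\<Sum>j<n. u $ i * v $ j * F w $$ (i, j)) \<partial>M) = (\<Sum>j<n. \<integral>w. u $ i * v $ j * F w $$ (i, j) \<partial>M)"
      using i int by (intro Bochner_Integration.integral_sum integrable_mult_right) auto
    then show "(\<integral>w. (\<Sum>j<n. u $ i * v $ j * F w $$ (i, j)) \<partial>M) = (\<Sum>j<n. u $ i * v $ j * (\<integral>w. F w $$ (i, j) \<partial>M))"
      by simp
  qed
  also have "\<dots> = u \<bullet> (expectation_mat M m n F *\<^sub>v v)"
    unfolding form[OF E] by (intro sum.cong refl) (simp add: expectation_mat_def)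
  finally show "u \<bullet> (expectation_mat M m n F *\<^sub>v v) = (\<integral>w. u \<bullet> (F w *\<^sub>v v) \<partial>M)" ..
qed

lemma expectation_mat_carrier [simp]: "expectation_mat M m n F \<in> carrier_mat m n"
  by (simp add: expectation_mat_def)

lemma mat_entry_form:
  fixes C :: "real mat"
  assumes "C \<in> carrier_mat n n" "i < n" "j < n"
  shows "C $$ (i, j) = unit_vec n i \<bullet> (C *\<^sub>v unit_vec n j)"
  using assms mat_mult_unit_vec[OF assms(1), of j] by simp

lemma (in row_projection) N_form_abs_le_1:
  assumes u: "u \<in> carrier_vec n" "u \<bullet> u \<le> 1" and v: "v \<in> carrier_vec n" "v \<bullet> v \<le> 1"
  shows "\<bar>u \<bullet> (N *\<^sub>v v)\<bar> \<le> 1"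
proof (rule LIMSEQ_le_const2[OF tendsto_rabs[OF ridge_tendsto_N[OF u(1) v(1)]]])
  have "\<bar>u \<bullet> (ridge_on n (1 / real (Suc m)) (row X) {..<k} *\<^sub>v v)\<bar> \<le> 1" for m
  proof -
    interpret ridge_family n "1 / real (Suc m)" "row X" "{..<k}"
      using X by unfold_locales auto
    have "(ridge_on n (1 / real (Suc m)) (row X) {..<k} *\<^sub>v v) \<bullet> (ridge_on n (1 / real (Suc m)) (row X) {..<k} *\<^sub>v v) \<le> 1"
      using ridge_on_quadratic(3)[OF order_refl v(1)] v(2) by linarith
    then show ?thesis
      by (intro scalar_prod_abs_le_1[OF u(1) ridge_on_mult_carrier u(2)])
  qed
  then show "\<exists>N. \<forall>m\<ge>N. \<bar>u \<bullet> (ridge_on n (1 / real (Suc m)) (row X) {..<k} *\<^sub>v v)\<bar> \<le> 1" by blast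
qed

section \<open>From the ridge resolvent to the projection in expectation\<close>

context random_rows
begin

text \<open>The first summand comes from q >= t / 2 >= \<delta> k / 2, the second from the
  exceptional event, where 1 / q <= k is weighed against the twelfth moment.\<close>

definition inverse_const :: real where
  "inverse_const = 2 / \<delta> + (2 / \<delta>) ^ 12 * \<beta>"

lemma inverse_q:
  assumes i: "i < k"
  shows "integrable Om (\<lambda>w. 1 / q i w)" and "(\<integral>w. 1 / q i w \<partial>Om) \<le> inverse_const / real k"
proof -
  define K where "K = real k"
  have K: "K \<ge> 1" "K > 0" using k by (auto simp: K_def)
  define e where "e = (2 / \<delta>) ^ 12"
  have e: "e \<ge> 0" using \<delta>_pos by (simp add: e_def)
  define Y where "Y w = (q i w - t i w) ^ 12" for w
  have Y: "integrable Om Y" "(\<integral>w. Y w \<partial>Om) \<le> \<beta> * K ^ 6"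
    using quadratic_moment[OF i] by (auto simp: Y_def[abs_def] \<beta>_def K_def)
  define G where "G w = 2 / (\<delta> * K) + e / K ^ 11 * Y w" for w
  have G: "integrable Om G" unfolding G_def[abs_def] using Y by simp
  have dK: "\<delta> * K > 0" using \<delta>_pos K by simp
  have pt: "\<bar>1 / q i w\<bar> \<le> G w" for w
  proof -
    have q: "q i w > 0" "q i w \<ge> 1 / K" and tt: "t i w \<ge> \<delta> * K"
      using q_pos[OF i, of w] trace_bounds(1)[OF i, of w] by (auto simp: l_def K_def)
    have Y0: "e / K ^ 11 * Y w \<ge> 0" using e K by (simp add: Y_def)
    show ?thesis
    proof (cases "q i w < t i w / 2")
      case True
      have "1 / q i w \<le> K" using q K by (simp add: field_simps)
      also have "K \<le> K * (e * Y w / K ^ 12)"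
        using mult_left_mono[OF large_deviation_ge_1[OF K(1) \<delta>_pos tt True], of K] K
        by (simp only: e_def Y_def mult_1_right less_imp_le)
      also have "\<dots> = e / K ^ 11 * Y w" using K by (simp add: eval_nat_numeral)
      finally show ?thesis using q dK by (simp add: G_def add_increasing)
    next
      case False
      then have "\<delta> * K / 2 \<le> q i w" using tt by simp
      then have "1 / q i w \<le> 1 / (\<delta> * K / 2)" using dK q by (intro frac_le) auto
      then show ?thesis using q Y0 by (simp add: G_def)
    qed
  qed
  have "(\<lambda>w. 1 / q i w) \<in> borel_measurable Om" using borel_measurable_qtT(3)[OF i] by simp
  then show I: "integrable Om (\<lambda>w. 1 / q i w)"
    using order_trans[OF pt abs_ge_self] by (intro Bochner_Integration.integrable_bound[OF G]) auto
  have "(\<integral>w. 1 / q i w \<partial>Om) \<le> (\<integral>w. G w \<partial>Om)"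
    by (intro integral_mono I G order_trans[OF abs_ge_self pt])
  also have "\<dots> = 2 / (\<delta> * K) + e / K ^ 11 * (\<integral>w. Y w \<partial>Om)"
    unfolding G_def[abs_def] using Y by (simp add: Om.prob_space)
  also have "\<dots> \<le> 2 / (\<delta> * K) + e / K ^ 11 * (\<beta> * K ^ 6)"
    using Y e K by (intro add_left_mono mult_left_mono) auto
  also have "e / K ^ 11 * (\<beta> * K ^ 6) = e * \<beta> / K ^ 5"
    using K by (simp add: eval_nat_numeral)
  also have "\<dots> \<le> e * \<beta> / K"
    using K e \<beta>_nonneg self_le_power[of K 5] by (intro frac_le) auto
  finally show "(\<integral>w. 1 / q i w \<partial>Om) \<le> inverse_const / real k"
    by (simp add: inverse_const_def e_def K_def add_divide_distrib)
qed

text \<open>Take the trace of the expansion of I - P: row i contributes (x_i.Q_i x_i) / q_i = 1 - l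
  / q_i.\<close>

lemma trace_P: "mat_trace (P w) - (real n - real k) = l * (\<Sum>i<k. 1 / q i w)"
proof -
  have "real n - mat_trace (P w) = (\<Sum>j<n. 1 - P w $$ (j, j))"
    by (simp add: sum_subtractf mat_trace_def carrier_matD(1)[OF P_carrier(1)])
  also have "\<dots> = (\<Sum>j<n. \<Sum>i<k. x w i $ j * (Q i w *\<^sub>v x w i) $ j / q i w)"
  proof (intro sum.cong refl)
    fix j assume "j \<in> {..<n}"
    then have j: "j < n" by simp
    let ?e = "unit_vec n j :: real vec"
    have "1 - P w $$ (j, j) = ?e \<bullet> ?e - ?e \<bullet> (P w *\<^sub>v ?e)"
      using j mat_entry_form[OF P_carrier(1) j j] by simp
    also have "\<dots> = (\<Sum>i<k. (?e \<bullet> x w i) * (x w i \<bullet> (Q i w *\<^sub>v ?e)) / q i w)"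
      using ridge_family.ridge_on_expansion[OF ridge_family_axioms, of ?e ?e w]
      by (simp only: P_def Q_def q_def unit_vec_carrier)
    also have "\<dots> = (\<Sum>i<k. x w i $ j * (Q i w *\<^sub>v x w i) $ j / q i w)"
    proof (intro sum.cong refl)
      fix i
      have "x w i \<bullet> (Q i w *\<^sub>v ?e) = ?e \<bullet> (Q i w *\<^sub>v x w i)"
        unfolding Q_def by (rule ridge_on_commute) auto
      also have "\<dots> = (Q i w *\<^sub>v x w i) $ j"
        by (rule scalar_prod_left_unit[OF Q_carrier(2) j])
      finally show "(?e \<bullet> x w i) * (x w i \<bullet> (Q i w *\<^sub>v ?e)) / q i w = x w i $ j * (Q i w *\<^sub>v x w i) $ j / q i w"
        by (simp only: scalar_prod_left_unit[OF x_carrier j])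
    qed
    finally show "1 - P w $$ (j, j) = (\<Sum>i<k. x w i $ j * (Q i w *\<^sub>v x w i) $ j / q i w)" .
  qed
  also have "\<dots> = (\<Sum>i<k. (x w i \<bullet> (Q i w *\<^sub>v x w i)) / q i w)"
  proof (subst sum.swap, intro sum.cong refl)
    fix i
    have "x w i \<bullet> (Q i w *\<^sub>v x w i) = (\<Sum>j<n. x w i $ j * (Q i w *\<^sub>v x w i) $ j)"
      unfolding scalar_prod_def carrier_vecD[OF Q_carrier(2)] lessThan_atLeast0 ..
    then show "(\<Sum>j<n. x w i $ j * (Q i w *\<^sub>v x w i) $ j / q i w) = (x w i \<bullet> (Q i w *\<^sub>v x w i)) / q i w"
      by (simp only: sum_divide_distrib)
  qed
  also have "\<dots> = (\<Sum>i<k. 1 - l * (1 / q i w))"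
  proof (intro sum.cong refl)
    fix i assume "i \<in> {..<k}"
    then have "q i w > 0" using q_pos(2) by simp
    moreover have "x w i \<bullet> (Q i w *\<^sub>v x w i) = q i w - l" by (simp add: q_def)
    ultimately show "(x w i \<bullet> (Q i w *\<^sub>v x w i)) / q i w = 1 - l * (1 / q i w)"
      by (simp add: diff_divide_distrib)
  qed
  also have "\<dots> = real k - l * (\<Sum>i<k. 1 / q i w)"
    by (simp add: sum_subtractf sum_distrib_left)
  finally show ?thesis by simp
qed

definition EP :: "real mat" where "EP = expectation_mat Om n n P"

lemma P_entry_integrable: "i < n \<Longrightarrow> j < n \<Longrightarrow> integrable Om (\<lambda>w. P w $$ (i, j))"
  using P_form(1)[of "unit_vec n i" "unit_vec n j"] by (simp add: mat_entry_form[OF P_carrier(1)])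

lemma EP_form:
  assumes "u \<in> carrier_vec n" "v \<in> carrier_vec n"
  shows "integrable Om (\<lambda>w. u \<bullet> (P w *\<^sub>v v))" and "u \<bullet> (EP *\<^sub>v v) = (\<integral>w. u \<bullet> (P w *\<^sub>v v) \<partial>Om)"
  unfolding EP_def
  by (rule expectation_mat_form[OF P_carrier(1) _ assms], rule P_entry_integrable; assumption)+

lemma \<tau>_EP: "\<tau> = l + mat_trace (A * EP * A)"
proof -
  have EPc: "EP \<in> carrier_mat n n" by (simp add: EP_def)
  have colc: "j < n \<Longrightarrow> col A j \<in> carrier_vec n" for j using A by auto
  have "\<tau> = (\<integral>w. l + (\<Sum>j<n. col A j \<bullet> (P w *\<^sub>v col A j)) \<partial>Om)"
    unfolding \<tau>_def T_def mat_trace_conj[OF A P_carrier(1)] ..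
  also have "\<dots> = l + (\<integral>w. (\<Sum>j<n. col A j \<bullet> (P w *\<^sub>v col A j)) \<partial>Om)"
    using EP_form(1) colc by (subst Bochner_Integration.integral_add) (auto simp: Om.prob_space)
  also have "(\<integral>w. (\<Sum>j<n. col A j \<bullet> (P w *\<^sub>v col A j)) \<partial>Om) = (\<Sum>j<n. \<integral>w. col A j \<bullet> (P w *\<^sub>v col A j) \<partial>Om)"
    using EP_form(1) colc by (intro Bochner_Integration.integral_sum) auto
  also have "\<dots> = (\<Sum>j<n. col A j \<bullet> (EP *\<^sub>v col A j))"
    using EP_form(2) colc by (intro sum.cong refl) auto
  also have "\<dots> = mat_trace (A * EP * A)"
    by (rule mat_trace_conj[OF A EPc, symmetric])
  finally show ?thesis .
qed

definition additive_const :: real where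
  "additive_const = inverse_const + (resolvent_error +
     (1 + 1 / (\<rho> - 1))\<^sup>2 * ((1 + resolvent_error * \<rho>) / ((\<rho> - 1) * \<rho>)))"

text \<open>The rows of \<open>X\<close> may differ from the normalized rows \<open>x w i\<close> by
  a common factor \<kappa>, which leaves the projection unchanged. The additive error is the ridge
  bias plus the distance from \<open>EP\<close> to the deterministic equivalent.\<close>

lemma expected_projection_estimate:
  assumes g: "g > 0" "mat_trace (proj_perp_equiv n (A * A) g) = real n - real k"
    and X: "mat_measurable Om k n X" and \<kappa>: "\<kappa> \<noteq> 0" and xX: "\<And>w i. i < k \<Longrightarrow> x w i = \<kappa> \<cdot>\<^sub>v row (X w) i"
  defines "Pb \<equiv> proj_perp_equiv n (A * A) g"
    and "EN \<equiv> expectation_mat Om n n (\<lambda>w. proj_perp n (X w))"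
  shows "Pb \<in> carrier_mat n n" and "Pb\<^sup>T = Pb" and "EN\<^sup>T = EN"
    and "v \<in> carrier_vec n \<Longrightarrow> (\<rho> - 1) / \<rho> * (v \<bullet> v) \<le> v \<bullet> (Pb *\<^sub>v v)"
    and "v \<in> carrier_vec n \<Longrightarrow> v \<bullet> v = 1 \<Longrightarrow> \<bar>v \<bullet> (EN *\<^sub>v v) - v \<bullet> (Pb *\<^sub>v v)\<bar> \<le> additive_const / sqrt (real k)"
proof -
  define K where "K = real k"
  define s where "s = sqrt K"
  have K: "K \<ge> 1" "K > 0" using k by (auto simp: K_def)
  have s: "s > 0" "s * s = K" "s \<le> K"
    using K by (auto simp: s_def real_le_lsqrt power2_eq_square)
  have rp: "row_projection (X w) k n" for w
    using X by (simp add: mat_measurable_def row_projection_def)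
  have EPc: "EP \<in> carrier_mat n n" by (simp add: EP_def)
  have re0: "resolvent_error \<ge> 0"
    unfolding resolvent_error_def using ratio_error_nonneg \<delta>_pos c by simp
  have est: "\<bar>u \<bullet> v - u \<bullet> (EP *\<^sub>v v) - real k / \<tau> * (((A * A) *\<^sub>v u) \<bullet> (EP *\<^sub>v v))\<bar> \<le> resolvent_error / s"
    if "u \<in> carrier_vec n" "u \<bullet> u \<le> 1" "v \<in> carrier_vec n" "v \<bullet> v \<le> 1" for u v
    using resolvent_estimate_form[OF that] EP_form(2)[OF that(1,3)] EP_form(2)[OF AA_contr(1)[OF that(1,2)] that(3)]
    by (simp only: s_def K_def)
  have \<tau>_tr: "\<bar>\<tau> - mat_trace (A * EP * A)\<bar> \<le> 1" using \<tau>_EP l_pos l_le by simp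
  have e0: "resolvent_error / s \<ge> 0" using re0 s by simp
  note det = deterministic_equivalent[OF A _ trace \<rho> k EPc g \<tau>_bounds(1)[unfolded \<delta>_def] \<tau>_tr e0, folded Pb_def]
  show "Pb \<in> carrier_mat n n"
    by (rule det(1)) (assumption | rule contr est)+
  show "Pb\<^sup>T = Pb"
    by (rule det(2)) (assumption | rule contr est)+
  show "(\<rho> - 1) / \<rho> * (v \<bullet> v) \<le> v \<bullet> (Pb *\<^sub>v v)" if v: "v \<in> carrier_vec n"
    by (rule det(3)) (assumption | rule contr est v)+
  have Nc: "proj_perp n (X w) \<in> carrier_mat n n" for w
    by (rule row_projection.N_carrier[OF rp])
  have Ni: "integrable Om (\<lambda>w. proj_perp n (X w) $$ (i, j))" if ij: "i < n" "j < n" for i j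
  proof (intro Om.integrable_const_bound[where B = 1] AE_I2)
    show "norm (proj_perp n (X w) $$ (i, j)) \<le> 1" for w
      unfolding mat_entry_form[OF Nc ij] real_norm_def
      using row_projection.N_form_abs_le_1[OF rp, of "unit_vec n i" "unit_vec n j"] ij by simp
    show "(\<lambda>w. proj_perp n (X w) $$ (i, j)) \<in> borel_measurable Om"
      using mat_measurable_proj_perp[OF X] ij by (simp add: mat_measurable_def)
  qed
  have EN_form: "integrable Om (\<lambda>w. u \<bullet> (proj_perp n (X w) *\<^sub>v v))"
    "u \<bullet> (EN *\<^sub>v v) = (\<integral>w. u \<bullet> (proj_perp n (X w) *\<^sub>v v) \<partial>Om)"
    if uv: "u \<in> carrier_vec n" "v \<in> carrier_vec n" for u v
    unfolding EN_def by (rule expectation_mat_form[OF Nc _ uv], rule Ni; assumption)+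
  have ENc: "EN \<in> carrier_mat n n" by (simp add: EN_def)
  show "EN\<^sup>T = EN"
  proof (rule eq_matI)
    fix i j assume "i < dim_row EN" "j < dim_col EN"
    then have ij: "i < n" "j < n" using ENc by auto
    have "proj_perp n (X w) $$ (j, i) = proj_perp n (X w) $$ (i, j)" for w
      using row_projection.N_symmetric[OF rp, of w] Nc[of w] ij by (metis carrier_matD index_transpose_mat(1))
    then show "EN\<^sup>T $$ (i, j) = EN $$ (i, j)"
      using ij ENc by (simp add: EN_def expectation_mat_def)
  qed (use ENc in auto)
  show "\<bar>v \<bullet> (EN *\<^sub>v v) - v \<bullet> (Pb *\<^sub>v v)\<bar> \<le> additive_const / sqrt (real k)"
    if v: "v \<in> carrier_vec n" and v1: "v \<bullet> v = 1"
  proof -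
    have ridge: "0 \<le> v \<bullet> (P w *\<^sub>v v) - v \<bullet> (proj_perp n (X w) *\<^sub>v v)"
      "v \<bullet> (P w *\<^sub>v v) - v \<bullet> (proj_perp n (X w) *\<^sub>v v) \<le> l * (\<Sum>i<k. 1 / q i w)" for w
    proof -
      have "v \<bullet> (proj_perp n (X w) *\<^sub>v v) \<le> v \<bullet> (P w *\<^sub>v v)"
        unfolding P_def by (rule row_projection.R_ge_N(1)[OF rp l_pos \<kappa> _ v]) (rule xX)
      then show "0 \<le> v \<bullet> (P w *\<^sub>v v) - v \<bullet> (proj_perp n (X w) *\<^sub>v v)" by simp
      have "v \<bullet> (P w *\<^sub>v v) - v \<bullet> (proj_perp n (X w) *\<^sub>v v) \<le> (mat_trace (P w) - (real n - real k)) * (v \<bullet> v)"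
        unfolding P_def by (rule row_projection.R_ge_N(2)[OF rp l_pos \<kappa> _ v]) (rule xX)
      then show "v \<bullet> (P w *\<^sub>v v) - v \<bullet> (proj_perp n (X w) *\<^sub>v v) \<le> l * (\<Sum>i<k. 1 / q i w)"
        unfolding trace_P v1 by simp
    qed
    have I: "integrable Om (\<lambda>w. l * (\<Sum>i<k. 1 / q i w))"
      using inverse_q(1) by auto
    have D': "v \<bullet> (EP *\<^sub>v v) - v \<bullet> (EN *\<^sub>v v) = (\<integral>w. v \<bullet> (P w *\<^sub>v v) - v \<bullet> (proj_perp n (X w) *\<^sub>v v) \<partial>Om)"
      using EP_form[OF v v] EN_form[OF v v] by simp
    have "0 \<le> v \<bullet> (EP *\<^sub>v v) - v \<bullet> (EN *\<^sub>v v)"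
      unfolding D' using ridge(1) by (rule Bochner_Integration.integral_nonneg)
    moreover have "v \<bullet> (EP *\<^sub>v v) - v \<bullet> (EN *\<^sub>v v) \<le> (\<integral>w. l * (\<Sum>i<k. 1 / q i w) \<partial>Om)"
      unfolding D' using ridge(2) EP_form(1)[OF v v] EN_form(1)[OF v v] by (intro integral_mono I) auto
    moreover have "(\<integral>w. l * (\<Sum>i<k. 1 / q i w) \<partial>Om) = l * (\<Sum>i<k. \<integral>w. 1 / q i w \<partial>Om)"
      using inverse_q(1) by (subst integral_mult_right_zero, subst Bochner_Integration.integral_sum) auto
    moreover have "l * (\<Sum>i<k. \<integral>w. 1 / q i w \<partial>Om) \<le> l * (\<Sum>i<k. inverse_const / K)"
      using inverse_q(2) l_pos by (intro mult_left_mono sum_mono) (auto simp: K_def)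
    moreover have "l * (\<Sum>i<k. inverse_const / K) = inverse_const / K"
      using K by (simp add: l_def K_def)
    moreover have "inverse_const / K \<le> inverse_const / s"
      using s K \<delta>_pos \<beta>_nonneg unfolding inverse_const_def by (intro divide_left_mono) auto
    ultimately have 1: "\<bar>v \<bullet> (EP *\<^sub>v v) - v \<bullet> (EN *\<^sub>v v)\<bar> \<le> inverse_const / s" by linarith
    have "\<bar>v \<bullet> (EP *\<^sub>v v) - v \<bullet> (Pb *\<^sub>v v)\<bar> \<le> resolvent_error / s
      + (1 + 1 / (\<rho> - 1))\<^sup>2 * ((1 / real k + resolvent_error / s * \<rho>) / ((\<rho> - 1) * \<rho>))"
      by (rule det(4)) (assumption | rule contr est v v1)+
    \<comment> \<open>The term 1 / k is relaxed to 1 / sqrt k so that all errors share one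
      rate.\<close>
    also have "\<dots> \<le> resolvent_error / s
      + (1 + 1 / (\<rho> - 1))\<^sup>2 * ((1 / s + resolvent_error / s * \<rho>) / ((\<rho> - 1) * \<rho>))"
      using s K \<rho> by (intro add_left_mono mult_left_mono divide_right_mono add_right_mono) (auto simp: K_def frac_le)
    also have "\<dots> = (resolvent_error + (1 + 1 / (\<rho> - 1))\<^sup>2 * ((1 + resolvent_error * \<rho>) / ((\<rho> - 1) * \<rho>))) / s"
      by (simp add: add_divide_distrib distrib_left ac_simps)
    finally show ?thesis
      using 1 unfolding additive_const_def add_divide_distrib[of inverse_const] s_def[symmetric] K_def[symmetric]
      by linarith
  qed
qed

end

lemma transpose_mat_smult: "transpose_mat (c \<cdot>\<^sub>m A) = c \<cdot>\<^sub>m A\<^sup>T"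
  by (intro eq_matI) auto

text \<open>Since |v|^2 is at most v.(Pb v) / d, an additive error b |v|^2 is a multiplicative error
  b / d.\<close>

lemma loewner_sandwich:
  fixes EN Pb :: "real mat"
  assumes EN: "EN \<in> carrier_mat n n" "EN\<^sup>T = EN" and Pb: "Pb \<in> carrier_mat n n" "Pb\<^sup>T = Pb"
    and low: "\<And>v. v \<in> carrier_vec n \<Longrightarrow> d * (v \<bullet> v) \<le> v \<bullet> (Pb *\<^sub>v v)" and d: "d > 0"
    and close: "\<And>v. v \<in> carrier_vec n \<Longrightarrow> v \<bullet> v = 1 \<Longrightarrow> \<bar>v \<bullet> (EN *\<^sub>v v) - v \<bullet> (Pb *\<^sub>v v)\<bar> \<le> b"
    and e: "b / d \<le> e" and b: "b \<ge> 0"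
  shows "loewner_le n ((1 - e) \<cdot>\<^sub>m Pb) EN \<and> loewner_le n EN ((1 + e) \<cdot>\<^sub>m Pb)"
proof -
  have main: "\<bar>v \<bullet> (EN *\<^sub>v v) - v \<bullet> (Pb *\<^sub>v v)\<bar> \<le> e * (v \<bullet> (Pb *\<^sub>v v))" if v: "v \<in> carrier_vec n" for v
  proof -
    have "\<bar>v \<bullet> (EN *\<^sub>v v) - v \<bullet> (Pb *\<^sub>v v)\<bar> \<le> b * (v \<bullet> v)"
      by (rule quadratic_bound_of_unit[OF EN(1) Pb(1) v close])
    also have "\<dots> = b / d * (d * (v \<bullet> v))" using d by simp
    also have "\<dots> \<le> b / d * (v \<bullet> (Pb *\<^sub>v v))"
      using low[OF v] b d by (intro mult_left_mono) auto
    also have "\<dots> \<le> e * (v \<bullet> (Pb *\<^sub>v v))"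
    proof (rule mult_right_mono[OF e])
      have "0 \<le> d * (v \<bullet> v)" using d scalar_prod_self_nonneg[of v] by simp
      then show "0 \<le> v \<bullet> (Pb *\<^sub>v v)" using low[OF v] by linarith
    qed
    finally show ?thesis .
  qed
  have smv: "v \<bullet> ((c \<cdot>\<^sub>m Pb) *\<^sub>v v) = c * (v \<bullet> (Pb *\<^sub>v v))" if v: "v \<in> carrier_vec n" for c v
  proof -
    have "(c \<cdot>\<^sub>m Pb) *\<^sub>v v = c \<cdot>\<^sub>v (Pb *\<^sub>v v)"
      using Pb v by (intro eq_vecI) (auto simp: smult_scalar_prod_distrib[of _ n])
    then show ?thesis using v mult_mat_vec_carrier[OF Pb(1) v] by (simp add: scalar_prod_smult_distrib[of _ n])
  qed
  have st: "transpose_mat (c \<cdot>\<^sub>m Pb) = c \<cdot>\<^sub>m Pb" for c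
    using Pb by (simp add: transpose_mat_smult)
  have cP: "c \<cdot>\<^sub>m Pb \<in> carrier_mat n n" for c using Pb by simp
  have dform: "v \<bullet> ((F - G) *\<^sub>v v) = v \<bullet> (F *\<^sub>v v) - v \<bullet> (G *\<^sub>v v)"
    if "v \<in> carrier_vec n" "F \<in> carrier_mat n n" "G \<in> carrier_mat n n" for v and F G :: "real mat"
    using that mult_mat_vec_carrier[OF that(2,1)] mult_mat_vec_carrier[OF that(3,1)]
    by (simp add: minus_mult_distrib_mat_vec[of _ n n] scalar_prod_minus_distrib[of _ n])
  have "psd_mat n (EN - (1 - e) \<cdot>\<^sub>m Pb)"
    unfolding psd_mat_def
  proof (intro conjI ballI)
    show "EN - (1 - e) \<cdot>\<^sub>m Pb \<in> carrier_mat n n" using cP by (rule minus_carrier_mat)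
    show "transpose_mat (EN - (1 - e) \<cdot>\<^sub>m Pb) = EN - (1 - e) \<cdot>\<^sub>m Pb"
      by (simp add: transpose_minus[OF EN(1) cP] EN st)
    fix v :: "real vec" assume v: "v \<in> carrier_vec n"
    show "0 \<le> v \<bullet> ((EN - (1 - e) \<cdot>\<^sub>m Pb) *\<^sub>v v)"
      unfolding dform[OF v EN(1) cP] smv[OF v] using main[OF v] by (simp add: algebra_simps abs_le_iff)
  qed
  moreover have "psd_mat n ((1 + e) \<cdot>\<^sub>m Pb - EN)"
    unfolding psd_mat_def
  proof (intro conjI ballI)
    show "(1 + e) \<cdot>\<^sub>m Pb - EN \<in> carrier_mat n n" using EN(1) by (rule minus_carrier_mat)
    show "transpose_mat ((1 + e) \<cdot>\<^sub>m Pb - EN) = (1 + e) \<cdot>\<^sub>m Pb - EN"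
      by (simp add: transpose_minus[OF cP EN(1)] EN st)
    fix v :: "real vec" assume v: "v \<in> carrier_vec n"
    show "0 \<le> v \<bullet> (((1 + e) \<cdot>\<^sub>m Pb - EN) *\<^sub>v v)"
      unfolding dform[OF v cP EN(1)] smv[OF v] using main[OF v] by (simp add: algebra_simps abs_le_iff)
  qed
  ultimately show ?thesis using EN(1) cP by (simp add: loewner_le_def)
qed

lemma exp_tail_moment_nonneg: "exp_tail_moment \<ge> 0"
  unfolding exp_tail_moment_def by (intro suminf_nonneg exp_tail_summable) auto

subsection \<open>The law of a matrix with independent rows\<close>

definition mat_of_fun :: "nat \<Rightarrow> nat \<Rightarrow> (nat \<Rightarrow> nat \<Rightarrow> real) \<Rightarrow> real mat" where
  "mat_of_fun k n w = mat k n (\<lambda>(i, j). w i j)"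

text \<open>\<open>row_fun\<close> is used with the identity as its random matrix, so that composing
  with \<open>Z\<close> gives exactly the rows of \<open>Z\<close>. The restrictions make the result
  a point of the product space.\<close>

definition fun_of_mat :: "nat \<Rightarrow> nat \<Rightarrow> real mat \<Rightarrow> nat \<Rightarrow> nat \<Rightarrow> real" where
  "fun_of_mat k n C = (\<lambda>i\<in>{..<k}. row_fun n (\<lambda>C. C) i C)"

abbreviation rows_space :: "nat \<Rightarrow> nat \<Rightarrow> (nat \<Rightarrow> nat \<Rightarrow> real) measure" where
  "rows_space k n \<equiv> PiM {..<k} (\<lambda>_. PiM {..<n} (\<lambda>_. borel))"

lemma mat_of_fun_of_mat: "C \<in> carrier_mat k n \<Longrightarrow> mat_of_fun k n (fun_of_mat k n C) = C"
  by (intro eq_matI) (auto simp: mat_of_fun_def fun_of_mat_def row_fun_def)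

lemma mat_measurable_mat_of_fun: "mat_measurable (rows_space k n) k n (mat_of_fun k n)"
proof -
  have "(\<lambda>w. w i j) \<in> borel_measurable (rows_space k n)" if "i < k" "j < n" for i j
    using measurable_compose[OF measurable_component_singleton[of i "{..<k}" "\<lambda>_. PiM {..<n} (\<lambda>_. borel)"]
        measurable_component_singleton[of j "{..<n}" "\<lambda>_. borel"]] that by simp
  then show ?thesis by (simp add: mat_measurable_def mat_of_fun_def)
qed

lemma iid_rowsD:
  assumes "iid_rows M k n Z"
  shows "\<omega> \<in> space M \<Longrightarrow> Z \<omega> \<in> carrier_mat k n"
    and "prob_space.indep_vars M (\<lambda>_. PiM {..<n} (\<lambda>_. borel)) (row_fun n Z) {..<k}"
    and "i < k \<Longrightarrow> i' < k \<Longrightarrow> distr M (PiM {..<n} (\<lambda>_. borel)) (row_fun n Z i)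
      = distr M (PiM {..<n} (\<lambda>_. borel)) (row_fun n Z i')"
proof -
  note iid = assms[unfolded iid_rows_def]
  show "\<omega> \<in> space M \<Longrightarrow> Z \<omega> \<in> carrier_mat k n"
    by (rule iid[THEN conjunct1, rule_format])
  show "prob_space.indep_vars M (\<lambda>_. PiM {..<n} (\<lambda>_. borel)) (row_fun n Z) {..<k}"
    by (rule iid[THEN conjunct2, THEN conjunct1])
  show "i < k \<Longrightarrow> i' < k \<Longrightarrow> distr M (PiM {..<n} (\<lambda>_. borel)) (row_fun n Z i)
      = distr M (PiM {..<n} (\<lambda>_. borel)) (row_fun n Z i')"
    by (rule iid[THEN conjunct2, THEN conjunct2, rule_format])
qed

context
  fixes M :: "'a measure" and Z :: "'a \<Rightarrow> real mat" and k n :: nat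
  assumes M: "prob_space M" and iid: "iid_rows M k n Z" and k: "k \<ge> 1"
begin

interpretation prob_space M by (rule M)

lemma Z_carrier: "\<omega> \<in> space M \<Longrightarrow> Z \<omega> \<in> carrier_mat k n"
  by (rule iid_rowsD(1)[OF iid])

lemma row_fun_measurable: "i < k \<Longrightarrow> row_fun n Z i \<in> measurable M (PiM {..<n} (\<lambda>_. borel))"
  using iid_rowsD(2)[OF iid] by (simp add: indep_vars_def)

lemma fun_of_mat_Z: "fun_of_mat k n (Z \<omega>) = (\<lambda>i\<in>{..<k}. row_fun n Z i \<omega>)"
  by (simp add: fun_of_mat_def row_fun_def)

lemma fun_of_mat_measurable: "(\<lambda>\<omega>. fun_of_mat k n (Z \<omega>)) \<in> measurable M (rows_space k n)"
  unfolding fun_of_mat_Z using row_fun_measurable by (intro measurable_restrict) auto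

abbreviation D :: "(nat \<Rightarrow> real) measure" where "D \<equiv> distr M (PiM {..<n} (\<lambda>_. borel)) (row_fun n Z 0)"

text \<open>Independence says that the joint law is the product of the row laws, and identical
  distribution makes each factor the law of row 0.\<close>

lemma rows_law: "distr M (rows_space k n) (\<lambda>\<omega>. fun_of_mat k n (Z \<omega>)) = PiM {..<k} (\<lambda>_. D)"
proof -
  have "0 \<in> {..<k}" using k by simp
  then have ne: "{..<k} \<noteq> {}" by blast
  note ind = iid_rowsD(2)[OF iid] and eq = iid_rowsD(3)[OF iid]
  have rv: "row_fun n Z i \<in> measurable M (PiM {..<n} (\<lambda>_. borel))" if "i \<in> {..<k}" for i
    using row_fun_measurable[of i] that by simp
  have "distr M (rows_space k n) (\<lambda>\<omega>. \<lambda>i\<in>{..<k}. row_fun n Z i \<omega>)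
      = PiM {..<k} (\<lambda>i. distr M (PiM {..<n} (\<lambda>_. borel)) (row_fun n Z i))"
    by (rule iffD1[OF indep_vars_iff_distr_eq_PiM'[OF ne rv] ind])
  also have "\<dots> = PiM {..<k} (\<lambda>_. D)"
  proof (rule PiM_cong[OF refl])
    fix i assume "i \<in> {..<k}"
    moreover have "0 < k" using k by simp
    ultimately show "distr M (PiM {..<n} (\<lambda>_. borel)) (row_fun n Z i) = D"
      using eq[of i 0] by blast
  qed
  finally show ?thesis unfolding fun_of_mat_Z .
qed

lemma row_Z:
  assumes "\<omega> \<in> space M" "i < k"
  shows "row (Z \<omega>) i = vec n (row_fun n Z i \<omega>)"
  using carrier_matD[OF Z_carrier[OF assms(1)]] assms(2) by (intro eq_vecI) (auto simp: row_fun_def)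

text \<open>Agreement is asked on the sample space because \<open>Z\<close> is unconstrained outside
  it.\<close>

lemma integral_law:
  assumes f: "f \<in> borel_measurable (rows_space k n)" and g: "\<And>\<omega>. \<omega> \<in> space M \<Longrightarrow> g \<omega> = f (fun_of_mat k n (Z \<omega>))"
  shows "(\<integral>\<omega>. g \<omega> \<partial>M) = (\<integral>w. f w \<partial>PiM {..<k} (\<lambda>_. D) :: real)"
proof -
  have "(\<integral>\<omega>. g \<omega> \<partial>M) = (\<integral>\<omega>. f (fun_of_mat k n (Z \<omega>)) \<partial>M)"
    by (rule Bochner_Integration.integral_cong[OF refl g])
  also have "\<dots> = (\<integral>w. f w \<partial>distr M (rows_space k n) (\<lambda>\<omega>. fun_of_mat k n (Z \<omega>)))"
    by (rule integral_distr[OF fun_of_mat_measurable f, symmetric])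
  finally show ?thesis unfolding rows_law .
qed

end

text \<open>The additive constant is divided by the lower bound (\<rho> - 1) / \<rho> of the
  deterministic equivalent, and sqrt \<rho> converts 1 / sqrt k into 1 / sqrt r. Adding 1 makes the
  result positive. As an exported constant, \<open>additive_const\<close> has just \<rho> and the
  moment constant as arguments, so n, k and the law do not enter.\<close>

definition projection_const :: "real \<Rightarrow> real \<Rightarrow> real" where
  "projection_const \<rho> K =
     \<bar>random_rows.additive_const \<rho> (exp_tail_moment * K ^ 24)\<bar> * sqrt \<rho> * (\<rho> / (\<rho> - 1)) + 1"

lemma projection_const_pos: "\<rho> > 1 \<Longrightarrow> projection_const \<rho> K > 0"
  unfolding projection_const_def by (intro add_nonneg_pos mult_nonneg_nonneg) auto

text \<open>Normalizes the covariance to spectral norm 1, so that \<open>A\<close> is a contraction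
  and tr (A A) is the effective rank r.\<close>

lemma psd_sqrt_scaled:
  assumes S: "psd_mat n S" "S \<noteq> 0\<^sub>m n n"
  defines "s \<equiv> spectral_norm S"
  defines "A \<equiv> (1 / sqrt s) \<cdot>\<^sub>m psd_sqrt S"
  shows "s > 0" and "A \<in> carrier_mat n n" and "A\<^sup>T = A" and "A * A = (1 / s) \<cdot>\<^sub>m S"
    and "v \<in> carrier_vec n \<Longrightarrow> (A *\<^sub>v v) \<bullet> (A *\<^sub>v v) \<le> v \<bullet> v"
    and "mat_trace (A * A) = mat_trace S / s"
proof -
  have Sc: "S \<in> carrier_mat n n" using S by (simp add: psd_mat_def)
  have B: "psd_sqrt S \<in> carrier_mat n n" "transpose_mat (psd_sqrt S) = psd_sqrt S" "psd_sqrt S * psd_sqrt S = S"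
    using psd_sqrt[OF S(1)] by (auto simp: psd_mat_def)
  show s: "s > 0" unfolding s_def by (rule spectral_norm_pos[OF Sc S(2)])
  show A: "A \<in> carrier_mat n n" "A\<^sup>T = A"
    using B by (auto simp: A_def transpose_mat_smult)
  have "A * A = (1 / sqrt s) \<cdot>\<^sub>m ((1 / sqrt s) \<cdot>\<^sub>m (psd_sqrt S * psd_sqrt S))"
    unfolding A_def using B(1) by (simp add: mult_smult_assoc_mat[of _ n n _ n] mult_smult_distrib[of _ n n _ n])
  then show AA: "A * A = (1 / s) \<cdot>\<^sub>m S"
    using s B(3) by (auto intro!: eq_matI simp: mult.assoc[symmetric])
  show "mat_trace (A * A) = mat_trace S / s"
    unfolding AA using Sc by (simp add: mat_trace_def sum_divide_distrib)
  assume v: "v \<in> carrier_vec n"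
  have Av: "A *\<^sub>v v \<in> carrier_vec n" using A v by simp
  have "(A *\<^sub>v v) \<bullet> (A *\<^sub>v v) = v \<bullet> ((A * A) *\<^sub>v v)"
    using symmetric_scalar_prod[OF A v Av] A v by (simp add: assoc_mult_mat_vec[of _ n n _ n])
  also have "(A * A) *\<^sub>v v = (1 / s) \<cdot>\<^sub>v (S *\<^sub>v v)"
    unfolding AA using Sc v by (intro eq_vecI) (auto simp: smult_scalar_prod_distrib[of _ n])
  also have "v \<bullet> \<dots> = (v \<bullet> (S *\<^sub>v v)) / s"
    using v mult_mat_vec_carrier[OF Sc v] by (simp add: scalar_prod_smult_distrib[of _ n])
  also have "\<dots> \<le> v \<bullet> v"
    using psd_mat_quadratic_le_spectral_norm[OF Sc v] s by (simp add: s_def pos_divide_le_eq mult.commute)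
  finally show "(A *\<^sub>v v) \<bullet> (A *\<^sub>v v) \<le> v \<bullet> v" .
qed

lemma iid_rows_random_rows:
  assumes M: "prob_space M" and iid: "iid_rows M k n Z" and k: "k \<ge> 1" and K: "K > 0" and \<rho>: "\<rho> > 1"
    and rows: "\<forall>i<k. zero_mean_identity_cov M n (\<lambda>\<omega>. row (Z \<omega>) i) \<and> hanson_wright M n (\<lambda>\<omega>. row (Z \<omega>) i) K"
    and A: "A \<in> carrier_mat n n" "A\<^sup>T = A"
    and contr: "\<And>v. v \<in> carrier_vec n \<Longrightarrow> (A *\<^sub>v v) \<bullet> (A *\<^sub>v v) \<le> v \<bullet> v"
    and trace: "mat_trace (A * A) = \<rho> * real k"
  shows "random_rows (distr M (PiM {..<n} (\<lambda>_. borel)) (row_fun n Z 0)) n k A \<rho> (exp_tail_moment * K ^ 24)"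
proof -
  interpret prob_space M by (rule M)
  have k0: "0 < k" using k by simp
  note rf = row_fun_measurable[OF M iid k k0]
  note rZ = row_Z[OF M iid k _ k0]
  let ?D = "distr M (PiM {..<n} (\<lambda>_. borel)) (row_fun n Z 0)"
  have cov: "zero_mean_identity_cov M n (\<lambda>\<omega>. row (Z \<omega>) 0)" and hw: "hanson_wright M n (\<lambda>\<omega>. row (Z \<omega>) 0) K"
    using rows k0 by auto
  have comp: "(\<lambda>f. f a) \<in> borel_measurable (PiM {..<n} (\<lambda>_. borel :: real measure))" if "a < n" for a
    using that by simp
  have vm: "vec_measurable (PiM {..<n} (\<lambda>_. borel)) n (vec n)"
    using comp by (simp add: vec_measurable_def)
  have pm: "(\<lambda>f. f a * f b) \<in> borel_measurable (PiM {..<n} (\<lambda>_. borel :: real measure))" if "a < n" "b < n" for a b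
    using comp[OF that(1)] comp[OF that(2)] by simp
  have ent: "row_fun n Z 0 \<omega> a * row_fun n Z 0 \<omega> b = row (Z \<omega>) 0 $ a * row (Z \<omega>) 0 $ b"
    if "\<omega> \<in> space M" "a < n" "b < n" for \<omega> a b
    using rZ[OF that(1)] that by simp
  show ?thesis
  proof (rule random_rows.intro)
    show "prob_space ?D" by (rule prob_space_distr[OF rf])
    show "sets ?D = sets (PiM {..<n} (\<lambda>_. borel))" by simp
    show "0 \<le> exp_tail_moment * K ^ 24" using exp_tail_moment_nonneg by simp
    fix a b assume ab: "a < n" "b < n"
    have "integrable M (\<lambda>\<omega>. row_fun n Z 0 \<omega> a * row_fun n Z 0 \<omega> b) \<longleftrightarrow> integrable M (\<lambda>\<omega>. row (Z \<omega>) 0 $ a * row (Z \<omega>) 0 $ b)"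
      by (rule Bochner_Integration.integrable_cong[OF refl ent[OF _ ab]])
    then show "integrable ?D (\<lambda>f. f a * f b)"
      using cov ab by (simp add: integrable_distr_eq[OF rf pm[OF ab]] zero_mean_identity_cov_def)
    have "(\<integral>\<omega>. row_fun n Z 0 \<omega> a * row_fun n Z 0 \<omega> b \<partial>M) = (\<integral>\<omega>. row (Z \<omega>) 0 $ a * row (Z \<omega>) 0 $ b \<partial>M)"
      by (rule Bochner_Integration.integral_cong[OF refl ent[OF _ ab]])
    then show "(\<integral>f. f a * f b \<partial>?D) = (if a = b then 1 else 0)"
      using cov ab by (simp add: integral_distr[OF rf pm[OF ab]] zero_mean_identity_cov_def)
  next
    fix B :: "real mat" assume B: "B \<in> carrier_mat n n"
    have qm: "(\<lambda>f. vec n f \<bullet> (B *\<^sub>v vec n f)) \<in> borel_measurable (PiM {..<n} (\<lambda>_. borel))"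
      by (rule borel_measurable_scalar_prod[OF vm vec_measurable_mult_mat_vec[OF mat_measurable_const[OF B] vm]])
    then have qm12: "(\<lambda>f. (vec n f \<bullet> (B *\<^sub>v vec n f) - mat_trace B) ^ 12) \<in> borel_measurable (PiM {..<n} (\<lambda>_. borel))"
      by simp
    have "(\<lambda>\<omega>. row (Z \<omega>) 0 \<bullet> (B *\<^sub>v row (Z \<omega>) 0)) \<in> borel_measurable M \<longleftrightarrow>
        (\<lambda>\<omega>. vec n (row_fun n Z 0 \<omega>) \<bullet> (B *\<^sub>v vec n (row_fun n Z 0 \<omega>))) \<in> borel_measurable M"
      by (rule measurable_cong) (simp only: rZ)
    then have m: "(\<lambda>\<omega>. row (Z \<omega>) 0 \<bullet> (B *\<^sub>v row (Z \<omega>) 0)) \<in> borel_measurable M"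
      using measurable_compose[OF rf qm] by simp
    have c: "row (Z \<omega>) 0 \<in> carrier_vec n" if "\<omega> \<in> space M" for \<omega>
      using rZ[OF that] by simp
    note mom = hanson_wright_moment[OF M hw K c m B]
    have e: "(vec n (row_fun n Z 0 \<omega>) \<bullet> (B *\<^sub>v vec n (row_fun n Z 0 \<omega>)) - mat_trace B) ^ 12
       = (row (Z \<omega>) 0 \<bullet> (B *\<^sub>v row (Z \<omega>) 0) - mat_trace B) ^ 12" if "\<omega> \<in> space M" for \<omega>
      by (simp only: rZ[OF that])
    have "integrable M (\<lambda>\<omega>. (vec n (row_fun n Z 0 \<omega>) \<bullet> (B *\<^sub>v vec n (row_fun n Z 0 \<omega>)) - mat_trace B) ^ 12)
        \<longleftrightarrow> integrable M (\<lambda>\<omega>. (row (Z \<omega>) 0 \<bullet> (B *\<^sub>v row (Z \<omega>) 0) - mat_trace B) ^ 12)"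
      by (rule Bochner_Integration.integrable_cong[OF refl e])
    then show "integrable ?D (\<lambda>f. (vec n f \<bullet> (B *\<^sub>v vec n f) - mat_trace B) ^ 12)"
      by (simp only: integrable_distr_eq[OF rf qm12] mom(1))
    have "(\<integral>\<omega>. (vec n (row_fun n Z 0 \<omega>) \<bullet> (B *\<^sub>v vec n (row_fun n Z 0 \<omega>)) - mat_trace B) ^ 12 \<partial>M)
        = (\<integral>\<omega>. (row (Z \<omega>) 0 \<bullet> (B *\<^sub>v row (Z \<omega>) 0) - mat_trace B) ^ 12 \<partial>M)"
      by (rule Bochner_Integration.integral_cong[OF refl e])
    then show "(\<integral>f. (vec n f \<bullet> (B *\<^sub>v vec n f) - mat_trace B) ^ 12 \<partial>?D) \<le> exp_tail_moment * K ^ 24 * frobenius_norm B ^ 12"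
      by (simp only: integral_distr[OF rf qm12] mom(2))
  qed (use A contr trace \<rho> k in auto)
qed

lemma expected_projection_bound_const:
  assumes M: "prob_space M" and \<rho>: "\<rho> > 1" and K: "K > 0"
  shows "expected_projection_bound \<rho> K (projection_const \<rho> K) M"
  unfolding expected_projection_bound_def Let_def
proof (intro allI impI)
  fix n k :: nat and S Z g
  assume k: "k \<ge> 1" and S: "psd_mat n S" "S \<noteq> 0\<^sub>m n n" and iid: "iid_rows M k n Z"
    and rows: "\<forall>i<k. zero_mean_identity_cov M n (\<lambda>\<omega>. row (Z \<omega>) i) \<and> hanson_wright M n (\<lambda>\<omega>. row (Z \<omega>) i) K"
    and g: "g > 0" and tr: "mat_trace (proj_perp_equiv n S g) = real n - real k"
    and r: "mat_trace S / spectral_norm S / real k = \<rho>"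
  define s where "s = spectral_norm S"
  define B where "B = psd_sqrt S"
  define A where "A = (1 / sqrt s) \<cdot>\<^sub>m B"
  have Sc: "S \<in> carrier_mat n n" using S by (simp add: psd_mat_def)
  have B: "B \<in> carrier_mat n n" "B\<^sup>T = B"
    using psd_sqrt[OF S(1)] by (auto simp: psd_mat_def B_def)
  note PS = psd_sqrt_scaled[OF S, folded s_def B_def, folded A_def]
  have rk: "mat_trace S / s = \<rho> * real k" using r k by (auto simp: s_def)
  have trace: "mat_trace (A * A) = \<rho> * real k" using PS(6) rk by simp
  define D where "D = distr M (PiM {..<n} (\<lambda>_. borel)) (row_fun n Z 0)"
  interpret random_rows D n k A \<rho> "exp_tail_moment * K ^ 24"
    unfolding D_def by (rule iid_rows_random_rows[OF M iid k K \<rho> rows PS(2,3,5) trace]) assumption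
  have setsOm: "sets Om = sets (rows_space k n)"
    by (intro sets_PiM_cong refl sets_D)
  define X where "X w = mat_of_fun k n w * B" for w
  have Xm: "mat_measurable (rows_space k n) k n X"
    unfolding X_def by (rule mat_measurable_mult[OF mat_measurable_mat_of_fun mat_measurable_const[OF B(1)]])
  then have XOm: "mat_measurable Om k n X"
    by (simp add: mat_measurable_def measurable_cong_sets[OF setsOm refl])
  have xX: "x w i = (1 / sqrt s) \<cdot>\<^sub>v row (X w) i" if i: "i < k" for w i
  proof (rule eq_vecI)
    have Xc: "X w \<in> carrier_mat k n" using Xm by (simp add: mat_measurable_def)
    show "dim_vec (x w i) = dim_vec ((1 / sqrt s) \<cdot>\<^sub>v row (X w) i)"
      using Xc PS(2) by (simp add: x_def)
    fix j assume "j < dim_vec ((1 / sqrt s) \<cdot>\<^sub>v row (X w) i)"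
    then have j: "j < n" using Xc by simp
    have "row B j = col B j" using B j by (metis carrier_matD(2) row_transpose)
    moreover have "row (mat_of_fun k n w) i = vec n (w i)" using i by (intro eq_vecI) (auto simp: mat_of_fun_def)
    moreover have "x w i $ j = 1 / sqrt s * (row B j \<bullet> vec n (w i))"
      unfolding x_def unfolding A_def using B j by (simp add: smult_scalar_prod_distrib[of _ n])
    moreover have "row (X w) i $ j = row (mat_of_fun k n w) i \<bullet> col B j"
      using B i j by (simp add: X_def mat_of_fun_def)
    ultimately show "x w i $ j = ((1 / sqrt s) \<cdot>\<^sub>v row (X w) i) $ j"
      using Xc i j B comm_scalar_prod[of "col B j" n "vec n (w i)"] by simp
  qed
  \<comment> \<open>The rescaling of the covariance is compensated in g, so the deterministic
    equivalent stays the same.\<close>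
  have gS: "(g * s) \<cdot>\<^sub>m (A * A) = g \<cdot>\<^sub>m S"
    unfolding PS(4) using PS(1) Sc by (intro eq_matI) auto
  have Pb: "proj_perp_equiv n (A * A) (g * s) = proj_perp_equiv n S g"
    by (simp add: proj_perp_equiv_def gS)
  have EN: "expectation_mat Om n n (\<lambda>w. proj_perp n (X w)) = expectation_mat M n n (\<lambda>\<omega>. proj_perp n (Z \<omega> * B))"
  proof (rule eq_matI)
    fix i j assume "i < dim_row (expectation_mat M n n (\<lambda>\<omega>. proj_perp n (Z \<omega> * B)))"
      "j < dim_col (expectation_mat M n n (\<lambda>\<omega>. proj_perp n (Z \<omega> * B)))"
    then have ij: "i < n" "j < n" by (auto simp: expectation_mat_def)
    have "(\<integral>\<omega>. proj_perp n (Z \<omega> * B) $$ (i, j) \<partial>M) = (\<integral>w. proj_perp n (X w) $$ (i, j) \<partial>Om)"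
      unfolding D_def
    proof (rule integral_law[OF M iid k])
      show "(\<lambda>w. proj_perp n (X w) $$ (i, j)) \<in> borel_measurable (rows_space k n)"
        using mat_measurable_proj_perp[OF Xm] ij by (simp add: mat_measurable_def)
      show "proj_perp n (Z \<omega> * B) $$ (i, j) = proj_perp n (X (fun_of_mat k n (Z \<omega>))) $$ (i, j)" if "\<omega> \<in> space M" for \<omega>
        by (simp only: X_def mat_of_fun_of_mat[OF Z_carrier[OF M iid k that]])
    qed
    then show "expectation_mat Om n n (\<lambda>w. proj_perp n (X w)) $$ (i, j)
      = expectation_mat M n n (\<lambda>\<omega>. proj_perp n (Z \<omega> * B)) $$ (i, j)"
      using ij by (simp add: expectation_mat_def)
  qed (simp_all add: expectation_mat_def)
  have g': "g * s > 0" "mat_trace (proj_perp_equiv n (A * A) (g * s)) = real n - real k"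
    using g PS(1) tr Pb by auto
  have \<kappa>: "1 / sqrt s \<noteq> 0" using PS(1) by simp
  note main = expected_projection_estimate[OF g' XOm \<kappa> xX, unfolded Pb EN]
  define a where "a = additive_const"
  have rr: "mat_trace S / spectral_norm S = \<rho> * real k" using rk by (simp add: s_def)
  show "loewner_le n ((1 - projection_const \<rho> K / sqrt (mat_trace S / spectral_norm S)) \<cdot>\<^sub>m proj_perp_equiv n S g)
          (expectation_mat M n n (\<lambda>\<omega>. proj_perp n (Z \<omega> * psd_sqrt S))) \<and>
        loewner_le n (expectation_mat M n n (\<lambda>\<omega>. proj_perp n (Z \<omega> * psd_sqrt S)))
          ((1 + projection_const \<rho> K / sqrt (mat_trace S / spectral_norm S)) \<cdot>\<^sub>m proj_perp_equiv n S g)"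
    unfolding rr B_def[symmetric]
  proof (rule loewner_sandwich[where d = "(\<rho> - 1) / \<rho>" and b = "\<bar>a\<bar> / sqrt (real k)"])
    show "\<bar>v \<bullet> (expectation_mat M n n (\<lambda>\<omega>. proj_perp n (Z \<omega> * B)) *\<^sub>v v) - v \<bullet> (proj_perp_equiv n S g *\<^sub>v v)\<bar> \<le> \<bar>a\<bar> / sqrt (real k)"
      if "v \<in> carrier_vec n" "v \<bullet> v = 1" for v
    proof -
      have "additive_const / sqrt (real k) \<le> \<bar>a\<bar> / sqrt (real k)" by (simp add: a_def divide_right_mono)
      then show ?thesis using main(5)[OF _ that] by force
    qed
    have "\<bar>a\<bar> / sqrt (real k) / ((\<rho> - 1) / \<rho>) = \<bar>a\<bar> * sqrt \<rho> * (\<rho> / (\<rho> - 1)) / sqrt (\<rho> * real k)"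
      using \<rho> k by (simp add: real_sqrt_mult)
    also have "\<dots> \<le> projection_const \<rho> K / sqrt (\<rho> * real k)"
      using \<rho> unfolding projection_const_def a_def by (intro divide_right_mono) auto
    finally show "\<bar>a\<bar> / sqrt (real k) / ((\<rho> - 1) / \<rho>) \<le> projection_const \<rho> K / sqrt (\<rho> * real k)" .
  qed (use main(1-4) \<rho> in auto)
qed

text \<open>Pulls the product sigma-algebra back to k by n matrices. The law of \<open>Z\<close>
  thereby becomes a measure on the type of matrices itself, the type for which the uniform constant
  is chosen.\<close>

definition mat_algebra :: "nat \<Rightarrow> nat \<Rightarrow> real mat measure" where
  "mat_algebra k n = vimage_algebra (carrier_mat k n) (fun_of_mat k n) (rows_space k n)"

lemma space_mat_algebra: "space (mat_algebra k n) = carrier_mat k n"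
  by (simp add: mat_algebra_def)

lemma fun_of_mat_in_space: "C \<in> carrier_mat k n \<Longrightarrow> fun_of_mat k n C \<in> space (rows_space k n)"
  by (auto simp: fun_of_mat_def row_fun_def space_PiM PiE_def extensional_def)

lemma measurable_fun_of_mat: "fun_of_mat k n \<in> measurable (mat_algebra k n) (rows_space k n)"
  unfolding mat_algebra_def by (rule measurable_vimage_algebra1) (auto intro: fun_of_mat_in_space)

lemma borel_measurable_mat_algebra:
  assumes f: "f \<in> borel_measurable (rows_space k n)"
    and eq: "\<And>C. C \<in> carrier_mat k n \<Longrightarrow> g C = f (fun_of_mat k n C)"
  shows "g \<in> borel_measurable (mat_algebra k n)"
proof -
  have "g \<in> borel_measurable (mat_algebra k n) \<longleftrightarrow> (\<lambda>C. f (fun_of_mat k n C)) \<in> borel_measurable (mat_algebra k n)"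
    by (rule measurable_cong) (simp add: eq space_mat_algebra)
  then show ?thesis using measurable_compose[OF measurable_fun_of_mat f] by simp
qed

lemma row_entry_measurable:
  assumes "i < k" "a < n"
  shows "(\<lambda>C. row C i $ a) \<in> borel_measurable (mat_algebra k n)"
proof (rule borel_measurable_mat_algebra[of "\<lambda>w. row (mat_of_fun k n w) i $ a"])
  show "(\<lambda>w. row (mat_of_fun k n w) i $ a) \<in> borel_measurable (rows_space k n)"
    using vec_measurable_row[OF mat_measurable_mat_of_fun assms(1)] assms(2) by (simp add: vec_measurable_def)
qed (simp only: mat_of_fun_of_mat)

lemma row_quadratic_measurable:
  assumes "i < k" "B \<in> carrier_mat n n"
  shows "(\<lambda>C. row C i \<bullet> (B *\<^sub>v row C i)) \<in> borel_measurable (mat_algebra k n)"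
proof (rule borel_measurable_mat_algebra[of "\<lambda>w. row (mat_of_fun k n w) i \<bullet> (B *\<^sub>v row (mat_of_fun k n w) i)"])
  note r = vec_measurable_row[OF mat_measurable_mat_of_fun assms(1), of n]
  show "(\<lambda>w. row (mat_of_fun k n w) i \<bullet> (B *\<^sub>v row (mat_of_fun k n w) i)) \<in> borel_measurable (rows_space k n)"
    by (rule borel_measurable_scalar_prod[OF r vec_measurable_mult_mat_vec[OF mat_measurable_const[OF assms(2)] r]])
qed (simp only: mat_of_fun_of_mat)

lemma proj_perp_entry_measurable:
  assumes "B \<in> carrier_mat n n" "i < n" "j < n"
  shows "(\<lambda>C. proj_perp n (C * B) $$ (i, j)) \<in> borel_measurable (mat_algebra k n)"
proof (rule borel_measurable_mat_algebra[of "\<lambda>w. proj_perp n (mat_of_fun k n w * B) $$ (i, j)"])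
  show "(\<lambda>w. proj_perp n (mat_of_fun k n w * B) $$ (i, j)) \<in> borel_measurable (rows_space k n)"
    using mat_measurable_proj_perp[OF mat_measurable_mult[OF mat_measurable_mat_of_fun mat_measurable_const[OF assms(1)]]]
      assms(2,3) by (simp add: mat_measurable_def)
qed (simp only: mat_of_fun_of_mat)

context
  fixes M :: "'a measure" and Z :: "'a \<Rightarrow> real mat" and k n :: nat
  assumes M: "prob_space M" and iid: "iid_rows M k n Z" and k: "k \<ge> 1"
begin

interpretation prob_space M by (rule M)

abbreviation L :: "real mat measure" where "L \<equiv> distr M (mat_algebra k n) Z"

lemma Z_measurable: "Z \<in> measurable M (mat_algebra k n)"
  unfolding mat_algebra_def
  by (rule measurable_vimage_algebra2) (use Z_carrier[OF M iid k] fun_of_mat_measurable[OF M iid k] in auto)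

lemma space_L: "space L = carrier_mat k n"
  by (simp add: space_mat_algebra)

lemma row_fun_id_measurable: "i < k \<Longrightarrow> row_fun n (\<lambda>C. C) i \<in> measurable (mat_algebra k n) (PiM {..<n} (\<lambda>_. borel))"
  using measurable_compose[OF measurable_fun_of_mat measurable_component_singleton[of i "{..<k}" "\<lambda>_. PiM {..<n} (\<lambda>_. borel)"]]
  by (simp add: fun_of_mat_def)

lemma distr_row_fun_L: 
  assumes "i < k"
  shows "distr L (PiM {..<n} (\<lambda>_. borel)) (row_fun n (\<lambda>C. C) i) = distr M (PiM {..<n} (\<lambda>_. borel)) (row_fun n Z i)"
proof -
  have "row_fun n (\<lambda>C. C) i \<circ> Z = row_fun n Z i" by (intro ext) (simp add: row_fun_def)
  then show ?thesis by (simp only: distr_distr[OF row_fun_id_measurable[OF assms] Z_measurable])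
qed

text \<open>Independence and equality of distribution depend on the joint law of the rows alone, and
  this law is the same for \<open>Z\<close> under \<open>M\<close> as for the identity under
  \<open>L\<close>.\<close>

lemma iid_rows_L: "iid_rows L k n (\<lambda>C. C)"
  unfolding iid_rows_def
proof (intro conjI ballI allI impI)
  show "C \<in> carrier_mat k n" if "C \<in> space L" for C using that by (simp only: space_L)
  interpret L: prob_space L by (rule prob_space_distr[OF Z_measurable])
  have "0 \<in> {..<k}" using k by simp
  then have ne: "{..<k} \<noteq> {}" by blast
  have rv: "row_fun n (\<lambda>C. C) i \<in> measurable L (PiM {..<n} (\<lambda>_. borel))" if "i \<in> {..<k}" for i
    using row_fun_id_measurable[of i] that by simp
  have rvM: "row_fun n Z i \<in> measurable M (PiM {..<n} (\<lambda>_. borel))" if "i \<in> {..<k}" for i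
    using row_fun_measurable[OF M iid k, of i] that by simp
  have "distr L (rows_space k n) (\<lambda>C. \<lambda>i\<in>{..<k}. row_fun n (\<lambda>C. C) i C) = distr M (rows_space k n) (fun_of_mat k n \<circ> Z)"
    unfolding fun_of_mat_def[symmetric] by (rule distr_distr[OF measurable_fun_of_mat Z_measurable])
  also have "fun_of_mat k n \<circ> Z = (\<lambda>\<omega>. \<lambda>i\<in>{..<k}. row_fun n Z i \<omega>)"
    using fun_of_mat_Z[OF M iid k] by (intro ext) simp
  also have "distr M (rows_space k n) \<dots> = PiM {..<k} (\<lambda>i. distr M (PiM {..<n} (\<lambda>_. borel)) (row_fun n Z i))"
    by (rule iffD1[OF indep_vars_iff_distr_eq_PiM'[OF ne rvM] iid_rowsD(2)[OF iid]])
  also have "\<dots> = PiM {..<k} (\<lambda>i. distr L (PiM {..<n} (\<lambda>_. borel)) (row_fun n (\<lambda>C. C) i))"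
    by (rule PiM_cong[OF refl]) (simp only: lessThan_iff distr_row_fun_L)
  finally have law: "distr L (rows_space k n) (\<lambda>C. \<lambda>i\<in>{..<k}. row_fun n (\<lambda>C. C) i C)
      = PiM {..<k} (\<lambda>i. distr L (PiM {..<n} (\<lambda>_. borel)) (row_fun n (\<lambda>C. C) i))" .
  show "prob_space.indep_vars L (\<lambda>_. PiM {..<n} (\<lambda>_. borel)) (row_fun n (\<lambda>C. C)) {..<k}"
    by (rule iffD2[OF L.indep_vars_iff_distr_eq_PiM'[OF ne rv]]) (assumption | rule law)+
  fix i i' assume "i < k" "i' < k"
  then show "distr L (PiM {..<n} (\<lambda>_. borel)) (row_fun n (\<lambda>C. C) i) = distr L (PiM {..<n} (\<lambda>_. borel)) (row_fun n (\<lambda>C. C) i')"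
    unfolding distr_row_fun_L[OF \<open>i < k\<close>] distr_row_fun_L[OF \<open>i' < k\<close>] by (rule iid_rowsD(3)[OF iid])
qed

lemma zero_mean_identity_cov_L:
  assumes i: "i < k" and z: "zero_mean_identity_cov M n (\<lambda>\<omega>. row (Z \<omega>) i)"
  shows "zero_mean_identity_cov L n (\<lambda>C. row C i)"
  unfolding zero_mean_identity_cov_def
proof (intro conjI allI impI)
  fix a assume a: "a < n"
  show "integrable L (\<lambda>C. row C i $ a)" "(\<integral>C. row C i $ a \<partial>L) = 0"
    unfolding integrable_distr_eq[OF Z_measurable row_entry_measurable[OF i a]]
      integral_distr[OF Z_measurable row_entry_measurable[OF i a]]
    using z a by (simp_all add: zero_mean_identity_cov_def)
next
  fix a b assume ab: "a < n" "b < n"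
  have m: "(\<lambda>C. row C i $ a * row C i $ b) \<in> borel_measurable (mat_algebra k n)"
    by (rule borel_measurable_times[OF row_entry_measurable[OF i ab(1)] row_entry_measurable[OF i ab(2)]])
  show "integrable L (\<lambda>C. row C i $ a * row C i $ b)" "(\<integral>C. row C i $ a * row C i $ b \<partial>L) = (if a = b then 1 else 0)"
    unfolding integrable_distr_eq[OF Z_measurable m] integral_distr[OF Z_measurable m]
    using z ab by (simp_all add: zero_mean_identity_cov_def)
qed

lemma hanson_wright_L:
  assumes i: "i < k" and h: "hanson_wright M n (\<lambda>\<omega>. row (Z \<omega>) i) K"
  shows "hanson_wright L n (\<lambda>C. row C i) K"
  unfolding hanson_wright_def
proof (intro ballI impI allI)
  fix B :: "real mat" and t :: real assume B: "B \<in> carrier_mat n n" "B \<noteq> 0\<^sub>m n n" and t: "0 \<le> t"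
  let ?f = "\<lambda>C. \<bar>row C i \<bullet> (B *\<^sub>v row C i) - mat_trace B\<bar>"
  have "?f \<in> borel_measurable (mat_algebra k n)"
    using row_quadratic_measurable[OF i B(1)] by simp
  then have S: "{C \<in> space (mat_algebra k n). t \<le> ?f C} \<in> sets (mat_algebra k n)"
    by measurable
  have "measure L {C \<in> space L. t \<le> ?f C} = measure M (Z -` {C \<in> space (mat_algebra k n). t \<le> ?f C} \<inter> space M)"
    unfolding space_distr by (rule measure_distr[OF Z_measurable S])
  also have "Z -` {C \<in> space (mat_algebra k n). t \<le> ?f C} \<inter> space M = {\<omega> \<in> space M. t \<le> ?f (Z \<omega>)}"
    using measurable_space[OF Z_measurable] by auto
  also have "measure M \<dots> \<le> 2 * exp (- min (t\<^sup>2 / (K ^ 4 * (frobenius_norm B)\<^sup>2)) (t / (K\<^sup>2 * spectral_norm B)))"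
    using h B t unfolding hanson_wright_def by blast
  finally show "measure L {C \<in> space L. t \<le> ?f C} \<le> 2 * exp (- min (t\<^sup>2 / (K ^ 4 * (frobenius_norm B)\<^sup>2)) (t / (K\<^sup>2 * spectral_norm B)))" .
qed

lemma expectation_proj_perp_L:
  assumes "B \<in> carrier_mat n n"
  shows "expectation_mat L n n (\<lambda>C. proj_perp n (C * B)) = expectation_mat M n n (\<lambda>\<omega>. proj_perp n (Z \<omega> * B))"
  using integral_distr[OF Z_measurable proj_perp_entry_measurable[OF assms]]
  by (intro eq_matI) (simp_all add: expectation_mat_def)

end

text \<open>Replace \<open>Z\<close> on \<open>M\<close> by the identity on its law. Moments, tails
  and the expected projection are preserved by change of variables, so the bound returns to
  \<open>M\<close> with the same \<open>C\<close>, for any constant with the uniform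
  property.\<close>

lemma expected_projection_bound_transfer:
  fixes M :: "'a measure"
  assumes C: "uniform_projection_constant \<rho> K C" and M: "prob_space M"
  shows "expected_projection_bound \<rho> K C M"
  unfolding expected_projection_bound_def
proof (intro allI impI)
  fix n k :: nat and S Z g
  assume n: "n \<ge> 1" and k: "k \<ge> 1" and S: "psd_mat n S" "S \<noteq> 0\<^sub>m n n" and iid: "iid_rows M k n Z"
    and rows: "\<forall>i<k. zero_mean_identity_cov M n (\<lambda>\<omega>. row (Z \<omega>) i) \<and> hanson_wright M n (\<lambda>\<omega>. row (Z \<omega>) i) K"
    and g: "g > 0" and tr: "mat_trace (proj_perp_equiv n S g) = real n - real k"
  let ?L = "distr M (mat_algebra k n) Z"
  have L: "expected_projection_bound \<rho> K C ?L"
    using C prob_space.prob_space_distr[OF M Z_measurable[OF M iid k]] unfolding uniform_projection_constant_def by blast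
  have rowsL: "\<forall>i<k. zero_mean_identity_cov ?L n (\<lambda>C. row C i) \<and> hanson_wright ?L n (\<lambda>C. row C i) K"
    using rows zero_mean_identity_cov_L[OF M iid k] hanson_wright_L[OF M iid k] by blast
  have B: "psd_sqrt S \<in> carrier_mat n n" using psd_sqrt(1)[OF S(1)] by (simp add: psd_mat_def)
  show "let r = mat_trace S / spectral_norm S;
            EP = expectation_mat M n n (\<lambda>\<omega>. proj_perp n (Z \<omega> * psd_sqrt S));
            P = proj_perp_equiv n S g
        in r / real k = \<rho> \<longrightarrow> r \<ge> C \<longrightarrow>
            loewner_le n ((1 - C / sqrt r) \<cdot>\<^sub>m P) EP \<and> loewner_le n EP ((1 + C / sqrt r) \<cdot>\<^sub>m P)"
    using L[unfolded expected_projection_bound_def, rule_format, OF n k S iid_rows_L[OF M iid k] _ g tr, of]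
      rowsL expectation_proj_perp_L[OF M iid k B] by simp
qed

theorem theorem2:
  fixes \<rho> K :: real
  assumes "\<rho> > 1" and "K > 0"
  shows "(\<exists>C>0. uniform_projection_constant \<rho> K C) \<and>
         (\<forall>C. uniform_projection_constant \<rho> K C \<longrightarrow>
            (\<forall>M :: 'a measure. prob_space M \<longrightarrow> expected_projection_bound \<rho> K C M))"
proof (intro conjI allI impI)
  \<comment> \<open>The estimate with \<open>projection_const\<close> holds over every sample space
    type; here it is instantiated at the type of matrices.\<close>
  show "\<exists>C>0. uniform_projection_constant \<rho> K C"
    using projection_const_pos[OF assms(1)] expected_projection_bound_const[OF _ assms]
    unfolding uniform_projection_constant_def by blast
qed (rule expected_projection_bound_transfer)

end
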